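(* Let $\mathbb K$ be a field, let $d$ be a nonnegative integer and let $A,A^*$ be matrices in $\mathrm{Mat}_{d+1}(\mathbb K)$. Assume $A$ is lower bidiagonal and $A^*$ is upper bidiagonal. Then the following (i), (ii) are equivalent. (i) The pair $A,A^*$ is a Leonard pair in $\mathrm{Mat}_{d+1}(\mathbb K)$ which is in $LB$-$UB$ canonical form. (ii) There exists a parameter array $(\theta_i,\theta^*_i,i=0..d;\varphi_j,\phi_j,j=1..d)$ over $\mathbb K$ such that $$A_{ii}=\theta_i,\qquad A^*_{ii}=\theta^*_i\qquad(0\le i\le d),$$ $$A_{i,i-1}=1,\qquad A^*_{i-1,i}=\varphi_i\qquad(1\le i\le d).$$ Suppose (i), (ii) hold. Then the parameter array in (ii) is uniquely determined by $A,A^*$. This parameter array is the designated parameter array for $A,A^*$.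
   Context: $\mathrm{Mat}_{d+1}(\mathbb K)$ is the algebra of $(d+1)\times(d+1)$ matrices over $\mathbb K$, rows and columns indexed by $0,1,\dots,d$. A matrix is lower bidiagonal if every nonzero entry lies on the diagonal or the subdiagonal, and upper bidiagonal if its transpose is lower bidiagonal. Leonard pairs and systems. Let $\mathcal A$ be a $\mathbb K$-algebra isomorphic to $\mathrm{Mat}_{d+1}(\mathbb K)$. An element $A\in\mathcal A$ is multiplicity-free if it has $d+1$ distinct eigenvalues in $\mathbb K$; if these are $\theta_0,\dots,\theta_d$, the primitive idempotent of $A$ associated with $\theta_i$ is $E_i=\prod_{j\ne i}(A-\theta_jI)/(\theta_i-\theta_j)$. For multiplicity-free $A,A^*\in\mathcal A$ ($A^*$ is just a name, not an adjoint), an idempotent sequence for $A,A^*$ is an ordering $E_0,\dots,E_d$ of the primitive idempotents of $A$ such that $E_iA^*E_j=0$ if $|i-j|>1$ and $E_iA^*E_j\ne0$ if $|i-j|=1$ ($0\le i,j\le d$); a dual idempotent sequence for $A,A^*$ is an idempotent sequence for $A^*,A$. A Leonard pair in $\mathcal A$ is an ordered pair $A,A^*$ of multiplicity-free elements of $\mathcal A$ for which an idempotent sequence and a dual idempotent sequence exist. A Leonard system in $\mathcal A$ is a sequence $\Phi=(A,A^*;E_i,E^*_i,i=0..d)$ where $A,A^*\in\mathcal A$ are multiplicity-free, $E_0,\dots,E_d$ is an idempotent sequence for $A,A^*$ and $E^*_0,\dots,E^*_d$ is a dual idempotent sequence for $A,A^*$; then $A,A^*$ is a Leonard pair, said to be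 associated with $\Phi$. The eigenvalue sequence (resp. dual eigenvalue sequence) of $\Phi$ is $\theta_0,\dots,\theta_d$ (resp. $\theta^*_0,\dots,\theta^*_d$), where $\theta_i$ (resp. $\theta^*_i$) is the eigenvalue of $A$ (resp. $A^*$) associated with $E_i$ (resp. $E^*_i$). Split sequences. Let $V$ be an irreducible left $\mathcal A$-module (unique up to isomorphism, of dimension $d+1$) and set $U_i=(E^*_0V+\cdots+E^*_iV)\cap(E_iV+\cdots+E_dV)$. It is known that each $U_i$ has dimension 1, $V$ is the direct sum of $U_0,\dots,U_d$, $(A-\theta_iI)U_i=U_{i+1}$ ($0\le i\le d-1$), $(A-\theta_dI)U_d=0$, $(A^*-\theta^*_iI)U_i=U_{i-1}$ ($1\le i\le d$), $(A^*-\theta_0^*I)U_0=0$. For $1\le i\le d$, $\varphi_i$ is the (nonzero) eigenvalue of $(A-\theta_{i-1}I)(A^*-\theta^*_iI)$ on $U_i$. The sequence $\varphi_1,\dots,\varphi_d$ is the first split sequence of $\Phi$. The second split sequence $\phi_1,\dots,\phi_d$ of $\Phi$ is the first split sequence of $\Phi^\Downarrow=(A,A^*;E_{d-i},E^*_i,i=0..d)$. Parameter arrays. A parameter array over $\mathbb K$ of diameter $d$ is a sequence $(\theta_i,\theta^*_i,i=0..d;\varphi_j,\phi_j,j=1..d)$ of scalars in $\mathbb K$ such that: (1) $\varphi_i\ne0$, $\phi_i\ne0$ ($1\le i\le d$); (2) $\theta_i\ne\theta_j$, $\theta^*_i\ne\theta^*_j$ if $i\ne j$; (3) $\varphi_i=\phi_1\sum_{h=0}^{i-1}\frac{\theta_h-\theta_{d-h}}{\theta_0-\theta_d}+(\theta^*_i-\theta^*_0)(\theta_{i-1}-\theta_d)$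 ($1\le i\le d$); (4) $\phi_i=\varphi_1\sum_{h=0}^{i-1}\frac{\theta_h-\theta_{d-h}}{\theta_0-\theta_d}+(\theta^*_i-\theta^*_0)(\theta_{d-i+1}-\theta_0)$ ($1\le i\le d$); (5) the expressions $\frac{\theta_{i-2}-\theta_{i+1}}{\theta_{i-1}-\theta_i}$ and $\frac{\theta^*_{i-2}-\theta^*_{i+1}}{\theta^*_{i-1}-\theta^*_i}$ are equal and independent of $i$ for $2\le i\le d-1$. The parameter array of a Leonard system $\Phi$ consists of its eigenvalue sequence, dual eigenvalue sequence, first split sequence and second split sequence; it is known that this sequence is a parameter array over $\mathbb K$ of diameter $d$, and that $\Phi\mapsto$ (parameter array of $\Phi$) induces a bijection from isomorphism classes of Leonard systems over $\mathbb K$ to parameter arrays over $\mathbb K$. $LB$-$UB$ canonical form. A Leonard pair $A,A^*$ is in $LB$-$UB$ canonical form if its ambient algebra is $\mathrm{Mat}_{d+1}(\mathbb K)$, $A$ is lower bidiagonal and $A^*$ is upper bidiagonal, and $A_{i,i-1}=1$ for $1\le i\le d$. If $A,A^*$ is a Leonard pair in $\mathrm{Mat}_{d+1}(\mathbb K)$ with $A$ lower bidiagonal and $A^*$ upper bidiagonal, then there is a unique Leonard system associated with $A,A^*$ having eigenvalue sequence $A_{00},\dots,A_{dd}$ and dual eigenvalue sequence $A^*_{00},\dots,A^*_{dd}$; it is the designated Leonard system for $A,A^*$, and its parameter array is the designated parameter array for $A,A^*$. *)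

theory Defs
  imports "Jordan_Normal_Form.Char_Poly" "HOL-Library.FuncSet"
begin

(* Throughout, Mat_{d+1}(K) is carrier_mat (d+1) (d+1) with K the type 'a :: field, and its
   irreducible left module V is carrier_vec (d+1).

   A finite sequence x_0, ..., x_d (resp. x_1, ..., x_d) is a function on nat that is
   extensional on {0..d} (resp. {1..d}), so that equality of sequences is equality of
   functions. *)

definition lower_bidiagonal :: "'a::zero mat \<Rightarrow> bool" where
  "lower_bidiagonal M \<longleftrightarrow>
     (\<forall>i < dim_row M. \<forall>j < dim_col M. M $$ (i, j) \<noteq> 0 \<longrightarrow> i = j \<or> i = j + 1)"

definition upper_bidiagonal :: "'a::zero mat \<Rightarrow> bool" where
  "upper_bidiagonal M \<longleftrightarrow> lower_bidiagonal (transpose_mat M)"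


definition multiplicity_free :: "nat \<Rightarrow> 'a::field mat \<Rightarrow> bool" where
  "multiplicity_free d A \<longleftrightarrow>
     A \<in> carrier_mat (d + 1) (d + 1) \<and> card {k. eigenvalue A k} = d + 1"

definition eigenvalue_ordering :: "nat \<Rightarrow> 'a::field mat \<Rightarrow> (nat \<Rightarrow> 'a) \<Rightarrow> bool" where
  "eigenvalue_ordering d A \<theta> \<longleftrightarrow>
     \<theta> \<in> extensional {0..d} \<and> bij_betw \<theta> {0..d} {k. eigenvalue A k}"

(* The product over j \<noteq> i of (A - \<theta>_j I) / (\<theta>_i - \<theta>_j). The factors commute, so
   taking them in increasing order of j is no restriction; a list is used because the
   matrices of a given size do not form a type. *)
definition primitive_idempotent :: "nat \<Rightarrow> 'a::field mat \<Rightarrow> (nat \<Rightarrow> 'a) \<Rightarrow> nat \<Rightarrow> 'a mat" where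
  "primitive_idempotent d A \<theta> i =
     foldr (\<lambda>j M. ((1 / (\<theta> i - \<theta> j)) \<cdot>\<^sub>m (A - \<theta> j \<cdot>\<^sub>m 1\<^sub>m (d + 1))) * M)
       (filter (\<lambda>j. j \<noteq> i) [0..<d + 1]) (1\<^sub>m (d + 1))"

definition idempotents_for ::
    "nat \<Rightarrow> 'a::field mat \<Rightarrow> (nat \<Rightarrow> 'a) \<Rightarrow> (nat \<Rightarrow> 'a mat) \<Rightarrow> bool" where
  "idempotents_for d A \<theta> E \<longleftrightarrow>
     eigenvalue_ordering d A \<theta> \<and> E \<in> extensional {0..d} \<and>
     (\<forall>i \<in> {0..d}. E i = primitive_idempotent d A \<theta> i)"

definition idempotent_sequence ::
    "nat \<Rightarrow> 'a::field mat \<Rightarrow> 'a mat \<Rightarrow> (nat \<Rightarrow> 'a mat) \<Rightarrow> bool" where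
  "idempotent_sequence d A As E \<longleftrightarrow>
     (\<exists>\<theta>. idempotents_for d A \<theta> E) \<and>
     (\<forall>i \<in> {0..d}. \<forall>j \<in> {0..d}.
        (\<bar>int i - int j\<bar> > 1 \<longrightarrow> E i * As * E j = 0\<^sub>m (d + 1) (d + 1)) \<and>
        (\<bar>int i - int j\<bar> = 1 \<longrightarrow> E i * As * E j \<noteq> 0\<^sub>m (d + 1) (d + 1)))"

definition leonard_pair :: "nat \<Rightarrow> 'a::field mat \<Rightarrow> 'a mat \<Rightarrow> bool" where
  "leonard_pair d A As \<longleftrightarrow>
     multiplicity_free d A \<and> multiplicity_free d As \<and>
     (\<exists>E. idempotent_sequence d A As E) \<and> (\<exists>Es. idempotent_sequence d As A Es)"

record 'a leonard_data =
  ls_A  :: "'a mat"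
  ls_As :: "'a mat"
  ls_E  :: "nat \<Rightarrow> 'a mat"
  ls_Es :: "nat \<Rightarrow> 'a mat"

definition leonard_system :: "nat \<Rightarrow> 'a::field leonard_data \<Rightarrow> bool" where
  "leonard_system d \<Phi> \<longleftrightarrow>
     multiplicity_free d (ls_A \<Phi>) \<and> multiplicity_free d (ls_As \<Phi>) \<and>
     idempotent_sequence d (ls_A \<Phi>) (ls_As \<Phi>) (ls_E \<Phi>) \<and>
     idempotent_sequence d (ls_As \<Phi>) (ls_A \<Phi>) (ls_Es \<Phi>)"

definition associated :: "'a::field mat \<Rightarrow> 'a mat \<Rightarrow> 'a leonard_data \<Rightarrow> bool" where
  "associated A As \<Phi> \<longleftrightarrow> ls_A \<Phi> = A \<and> ls_As \<Phi> = As"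

definition eigenvalue_seq :: "nat \<Rightarrow> 'a::field leonard_data \<Rightarrow> nat \<Rightarrow> 'a" where
  "eigenvalue_seq d \<Phi> = (THE \<theta>. idempotents_for d (ls_A \<Phi>) \<theta> (ls_E \<Phi>))"

definition dual_eigenvalue_seq :: "nat \<Rightarrow> 'a::field leonard_data \<Rightarrow> nat \<Rightarrow> 'a" where
  "dual_eigenvalue_seq d \<Phi> = (THE \<theta>. idempotents_for d (ls_As \<Phi>) \<theta> (ls_Es \<Phi>))"


(* The subspace \<Sum>_{h \<in> S} E_h V of V. *)
definition image_sum :: "nat \<Rightarrow> (nat \<Rightarrow> 'a::field mat) \<Rightarrow> nat set \<Rightarrow> 'a vec set" where
  "image_sum d E S =
     {finsum_vec TYPE('a) (d + 1) (\<lambda>h. E h *\<^sub>v w h) S | w. \<forall>h \<in> S. w h \<in> carrier_vec (d + 1)}"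

definition split_space :: "nat \<Rightarrow> 'a::field leonard_data \<Rightarrow> nat \<Rightarrow> 'a vec set" where
  "split_space d \<Phi> i = image_sum d (ls_Es \<Phi>) {0..i} \<inter> image_sum d (ls_E \<Phi>) {i..d}"

(* The split space U_i is one-dimensional and invariant under the operator below, so the
   operator has exactly one eigenvalue with an eigenvector in U_i. *)
definition first_split_seq :: "nat \<Rightarrow> 'a::field leonard_data \<Rightarrow> nat \<Rightarrow> 'a" where
  "first_split_seq d \<Phi> = (\<lambda>i \<in> {1..d}. THE c. \<exists>u \<in> split_space d \<Phi> i.
     eigenvector
       ((ls_A \<Phi> - eigenvalue_seq d \<Phi> (i - 1) \<cdot>\<^sub>m 1\<^sub>m (d + 1)) *
        (ls_As \<Phi> - dual_eigenvalue_seq d \<Phi> i \<cdot>\<^sub>m 1\<^sub>m (d + 1))) u c)"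

definition leonard_Down :: "nat \<Rightarrow> 'a::field leonard_data \<Rightarrow> 'a leonard_data" where
  "leonard_Down d \<Phi> = \<Phi>\<lparr>ls_E := (\<lambda>i \<in> {0..d}. ls_E \<Phi> (d - i))\<rparr>"

definition second_split_seq :: "nat \<Rightarrow> 'a::field leonard_data \<Rightarrow> nat \<Rightarrow> 'a" where
  "second_split_seq d \<Phi> = first_split_seq d (leonard_Down d \<Phi>)"


record 'a parameter_data =
  pa_theta  :: "nat \<Rightarrow> 'a"
  pa_thetas :: "nat \<Rightarrow> 'a"
  pa_vphi   :: "nat \<Rightarrow> 'a"
  pa_phi    :: "nat \<Rightarrow> 'a"

definition parameter_array :: "nat \<Rightarrow> 'a::field parameter_data \<Rightarrow> bool" where
  "parameter_array d p \<longleftrightarrow>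
     (let \<theta> = pa_theta p; \<theta>s = pa_thetas p; \<phi>1 = pa_vphi p; \<phi>2 = pa_phi p in
       \<theta> \<in> extensional {0..d} \<and> \<theta>s \<in> extensional {0..d} \<and>
       \<phi>1 \<in> extensional {1..d} \<and> \<phi>2 \<in> extensional {1..d} \<and>
       (\<forall>i \<in> {1..d}. \<phi>1 i \<noteq> 0 \<and> \<phi>2 i \<noteq> 0) \<and>
       (\<forall>i \<in> {0..d}. \<forall>j \<in> {0..d}. i \<noteq> j \<longrightarrow> \<theta> i \<noteq> \<theta> j \<and> \<theta>s i \<noteq> \<theta>s j) \<and>
       (\<forall>i \<in> {1..d}. \<phi>1 i = \<phi>2 1 * (\<Sum>h = 0..i - 1. (\<theta> h - \<theta> (d - h)) / (\<theta> 0 - \<theta> d))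
                            + (\<theta>s i - \<theta>s 0) * (\<theta> (i - 1) - \<theta> d)) \<and>
       (\<forall>i \<in> {1..d}. \<phi>2 i = \<phi>1 1 * (\<Sum>h = 0..i - 1. (\<theta> h - \<theta> (d - h)) / (\<theta> 0 - \<theta> d))
                            + (\<theta>s i - \<theta>s 0) * (\<theta> (d - i + 1) - \<theta> 0)) \<and>
       (\<exists>c. \<forall>i \<in> {2..d - 1}.
          (\<theta> (i - 2) - \<theta> (i + 1)) / (\<theta> (i - 1) - \<theta> i) = c \<and>
          (\<theta>s (i - 2) - \<theta>s (i + 1)) / (\<theta>s (i - 1) - \<theta>s i) = c))"

definition parameter_array_of :: "nat \<Rightarrow> 'a::field leonard_data \<Rightarrow> 'a parameter_data" where
  "parameter_array_of d \<Phi> =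
     \<lparr>pa_theta = eigenvalue_seq d \<Phi>, pa_thetas = dual_eigenvalue_seq d \<Phi>,
      pa_vphi = first_split_seq d \<Phi>, pa_phi = second_split_seq d \<Phi>\<rparr>"


definition LB_UB_canonical_form :: "nat \<Rightarrow> 'a::field mat \<Rightarrow> 'a mat \<Rightarrow> bool" where
  "LB_UB_canonical_form d A As \<longleftrightarrow>
     A \<in> carrier_mat (d + 1) (d + 1) \<and> As \<in> carrier_mat (d + 1) (d + 1) \<and>
     lower_bidiagonal A \<and> upper_bidiagonal As \<and> (\<forall>i \<in> {1..d}. A $$ (i, i - 1) = 1)"

definition designated_leonard_system ::
    "nat \<Rightarrow> 'a::field mat \<Rightarrow> 'a mat \<Rightarrow> 'a leonard_data" where
  "designated_leonard_system d A As =
     (THE \<Phi>. leonard_system d \<Phi> \<and> associated A As \<Phi> \<and>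
        eigenvalue_seq d \<Phi> = (\<lambda>i \<in> {0..d}. A $$ (i, i)) \<and>
        dual_eigenvalue_seq d \<Phi> = (\<lambda>i \<in> {0..d}. As $$ (i, i)))"

definition designated_parameter_array ::
    "nat \<Rightarrow> 'a::field mat \<Rightarrow> 'a mat \<Rightarrow> 'a parameter_data" where
  "designated_parameter_array d A As = parameter_array_of d (designated_leonard_system d A As)"

(* The equations relating the pair A, A* to a parameter array in LB-UB canonical form. *)
definition LB_UB_entries ::
    "nat \<Rightarrow> 'a::field mat \<Rightarrow> 'a mat \<Rightarrow> 'a parameter_data \<Rightarrow> bool" where
  "LB_UB_entries d A As p \<longleftrightarrow>
     (\<forall>i \<in> {0..d}. A $$ (i, i) = pa_theta p i \<and> As $$ (i, i) = pa_thetas p i) \<and>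
     (\<forall>i \<in> {1..d}. A $$ (i, i - 1) = 1 \<and> As $$ (i - 1, i) = pa_vphi p i)"

end

theory Submission
  imports Defs
begin

text \<open>
  Let \<open>L\<close> be lower bidiagonal with diagonal \<open>\<theta>\<close> and subdiagonal \<open>1\<close>, and \<open>U\<close> upper bidiagonal with
  diagonal \<open>\<theta>\<^sup>*\<close> and superdiagonal \<open>\<phi>\<close>. In an eigenbasis of \<open>L\<close> the matrix \<open>U\<close> is always
  Hessenberg; the pair is Leonard when it is irreducible tridiagonal, and dually.

  Both directions go through the Askey-Wilson relation
  \<open>L\<^sup>2 U - \<beta> L U L + U L\<^sup>2 - \<gamma> (L U + U L) - \<rho> U = \<gamma>\<^sup>* L\<^sup>2 + \<omega> L + \<eta>\<close>, which for a bidiagonal pair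
  is a list of scalar equations. Given a parameter array, the pair \<open>(\<theta>, \<theta>\<^sup>*, \<phi>)\<close> and the pair
  formed from the reversed \<open>\<theta>\<close>, from \<open>\<theta>\<^sup>*\<close> and from the second split sequence satisfy this relation
  with the same coefficients, so the matrix \<open>G\<close> that intertwines the two lower bidiagonal matrices
  and fixes the first basis vector also intertwines the two upper bidiagonal ones. Being Hessenberg
  for both orders of the eigenvalues, \<open>U\<close> is tridiagonal. The dual statement follows because the
  scalar equations are symmetric in \<open>\<theta>\<close> and \<open>\<theta>\<^sup>*\<close>. Conversely, for a Leonard pair the tridiagonal
  shape yields the recurrence for \<open>\<theta>\<close> and then the relation; conjugating by \<open>G\<close> gives the second
  split sequence, and comparing the two sets of scalar equations determines \<open>\<phi>\<close>.
\<close>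

section \<open>Scalar identities\<close>

text \<open>The unit subdiagonal makes the first basis vector cyclic for a lower bidiagonal matrix,
  so a matrix intertwining two of them is fixed by its first column. This is why \<open>G\<close> is
  normalised there, and it also makes \<open>G\<close> unit upper triangular. The defect of
  \<open>G\<close> as an intertwiner of the upper bidiagonal matrices satisfies the homogeneous
  Askey-Wilson relation; that relation is quadratic in the right-hand operator, so it expresses
  column j + 2 through columns j and j + 1, and two vanishing columns suffice. Column 0 vanishes
  because both matrices start with the same dual eigenvalue, column 1 because of the relation
  between the first terms of the two split sequences. The last term of the second split sequence
  serves to make the constant \<eta> the same for both pairs. In addition, \<open>G\<close> is the
  change of basis that puts the Leonard system with reversed idempotents into split form, so the
  second split sequence is read off from it. In the converse the coefficients \<beta>, \<gamma> are
  not given; they are extracted from a cubic identity. Uniqueness comes from showing that every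
  admissible array equals the designated one.\<close>

text \<open>The formula of a parameter array for the first split sequence, with \<zeta> for the
  first term of the second one; for reversed \<theta> it is the formula for the second split
  sequence. Summing over \<open>h<i\<close> gives it values at 0 and \<open>Suc d\<close> as well,
  both zero.\<close>

definition split_formula :: "nat \<Rightarrow> (nat \<Rightarrow> 'a::field) \<Rightarrow> (nat \<Rightarrow> 'a) \<Rightarrow> 'a \<Rightarrow> nat \<Rightarrow> 'a" where
  "split_formula d \<theta> \<theta>s \<zeta> i =
     \<zeta> * (\<Sum>h<i. (\<theta> h - \<theta> (d - h)) / (\<theta> 0 - \<theta> d)) + (\<theta>s i - \<theta>s 0) * (\<theta> (i - 1) - \<theta> d)"

text \<open>The ratio condition of a parameter array summed once: \<beta> + 1 is the common ratio
  and \<gamma> the constant of summation.\<close>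

definition three_term :: "nat \<Rightarrow> 'a::field \<Rightarrow> 'a \<Rightarrow> (nat \<Rightarrow> 'a) \<Rightarrow> bool" where
  "three_term d \<beta> \<gamma> \<theta> \<longleftrightarrow> (\<forall>i. i + 2 \<le> d \<longrightarrow> \<theta> i - \<beta> * \<theta> (i + 1) + \<theta> (i + 2) = \<gamma>)"

lemma three_termD:
  "three_term d \<beta> \<gamma> \<theta> \<Longrightarrow> i + 2 \<le> d \<Longrightarrow> \<theta> (Suc (Suc i)) = \<gamma> + \<beta> * \<theta> (Suc i) - \<theta> i"
  unfolding three_term_def by (auto simp: algebra_simps)

lemma three_term_reverse:
  assumes "three_term d \<beta> \<gamma> \<theta>"
  shows "three_term d \<beta> \<gamma> (\<lambda>i. \<theta> (d - i))"
  unfolding three_term_def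
proof (intro allI impI)
  fix i assume i: "i + 2 \<le> d"
  define k where "k = d - (i + 2)"
  have e: "d - i = Suc (Suc k)" "d - (i + 1) = Suc k" "d - (i + 2) = k" using i k_def by auto
  have "k + 2 \<le> d" using i k_def by auto
  from three_termD[OF assms this]
  show "\<theta> (d - i) - \<beta> * \<theta> (d - (i + 1)) + \<theta> (d - (i + 2)) = \<gamma>"
    unfolding e by (simp add: algebra_simps)
qed

text \<open>The coefficient of the first subdiagonal in the Askey-Wilson expression of a bidiagonal
  pair. It is symmetric in \<open>(\<theta>, \<gamma>)\<close> and \<open>(\<theta>s, \<gamma>s)\<close>.\<close>

definition aw_sub ::
  "'a::field \<Rightarrow> 'a \<Rightarrow> 'a \<Rightarrow> (nat \<Rightarrow> 'a) \<Rightarrow> (nat \<Rightarrow> 'a) \<Rightarrow> (nat \<Rightarrow> 'a) \<Rightarrow> nat \<Rightarrow> 'a" where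
  "aw_sub \<beta> \<gamma> \<gamma>s \<theta> \<theta>s f i = f i - \<beta> * f (i + 1) + f (i + 2)
     + (\<theta> i + \<theta> (i + 1)) * (\<theta>s i + \<theta>s (i + 1)) - \<beta> * (\<theta> i * \<theta>s i + \<theta> (i + 1) * \<theta>s (i + 1))
     - \<gamma> * (\<theta>s i + \<theta>s (i + 1)) - \<gamma>s * (\<theta> i + \<theta> (i + 1))"

text \<open>The diagonal coefficient of the same expression. The out-of-range values
  \<open>\<theta> (i - 1)\<close> at 0 and \<open>\<theta> (i + 1)\<close> at \<open>d\<close> are
  multiplied by \<open>f 0\<close> and \<open>f (Suc d)\<close>, which vanish wherever those cases
  occur.\<close>

definition aw_diag ::
  "'a::field \<Rightarrow> 'a \<Rightarrow> 'a \<Rightarrow> (nat \<Rightarrow> 'a) \<Rightarrow> (nat \<Rightarrow> 'a) \<Rightarrow> (nat \<Rightarrow> 'a) \<Rightarrow> nat \<Rightarrow> 'a" where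
  "aw_diag \<beta> \<gamma> \<rho> \<theta> \<theta>s f i =
     \<theta>s i * ((2 - \<beta>) * \<theta> i ^ 2 - 2 * \<gamma> * \<theta> i - \<rho>)
     + f i * (\<theta> (i - 1) + \<theta> i - \<beta> * \<theta> i - \<gamma>)
     + f (i + 1) * (\<theta> (i + 1) + \<theta> i - \<beta> * \<theta> i - \<gamma>)"

text \<open>In an eigenbasis the Askey-Wilson expression multiplies the entry (i, j) by this
  symmetric polynomial in the i-th and j-th eigenvalue. Its zeros at consecutive eigenvalues
  therefore cancel the off-diagonal entries of a tridiagonal matrix.\<close>

definition aw_root :: "'a::field \<Rightarrow> 'a \<Rightarrow> 'a \<Rightarrow> 'a \<Rightarrow> 'a \<Rightarrow> 'a" where
  "aw_root \<beta> \<gamma> \<rho> x y = x ^ 2 - \<beta> * x * y + y ^ 2 - \<gamma> * (x + y) - \<rho>"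

lemma aw_root_commute: "aw_root \<beta> \<gamma> \<rho> x y = aw_root \<beta> \<gamma> \<rho> y x"
  unfolding aw_root_def by (simp add: algebra_simps)

text \<open>By Vieta, the two roots x of the polynomial for fixed y have sum
  \<open>\<beta> * y + \<gamma>\<close>. For y equal to a middle term, the recurrence says exactly
  that its two neighbours have this sum.\<close>

lemma aw_root_consecutive:
  assumes t: "three_term d \<beta> \<gamma> \<theta>" and "aw_root \<beta> \<gamma> \<rho> (\<theta> 0) (\<theta> 1) = 0" and "i < d"
  shows "aw_root \<beta> \<gamma> \<rho> (\<theta> i) (\<theta> (Suc i)) = 0"
  using \<open>i < d\<close>
proof (induction i)
  case 0 then show ?case using assms by simp
next
  case (Suc i)
  then have "aw_root \<beta> \<gamma> \<rho> (\<theta> i) (\<theta> (Suc i)) = 0" and "i + 2 \<le> d" by auto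
  moreover have "aw_root \<beta> \<gamma> \<rho> (\<theta> (Suc i)) (\<theta> (Suc (Suc i))) = aw_root \<beta> \<gamma> \<rho> (\<theta> i) (\<theta> (Suc i))"
    unfolding aw_root_def three_termD[OF t \<open>i + 2 \<le> d\<close>]
    by (simp add: power2_eq_square algebra_simps)
  ultimately show ?case by simp
qed

text \<open>This is the entry (i + 1, i) of the fact that the Askey-Wilson expression commutes with
  the lower bidiagonal matrix. It makes the diagonal equations follow from the subdiagonal ones, up
  to one constant.\<close>

lemma aw_diag_step:
  assumes t: "three_term d \<beta> \<gamma> \<theta>" and r: "aw_root \<beta> \<gamma> \<rho> (\<theta> i) (\<theta> (Suc i)) = 0"
    and f: "f 0 = 0" "f (Suc d) = 0" and i: "i < d"
  shows "aw_diag \<beta> \<gamma> \<rho> \<theta> \<theta>s f (Suc i) - aw_diag \<beta> \<gamma> \<rho> \<theta> \<theta>s f i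
    = \<gamma>s * (\<theta> (Suc i) ^ 2 - \<theta> i ^ 2) + (\<theta> (Suc i) - \<theta> i) * aw_sub \<beta> \<gamma> \<gamma>s \<theta> \<theta>s f i"
proof -
  have 1: "f i * (\<theta> (i - 1) + \<theta> i - \<beta> * \<theta> i - \<gamma>) = f i * (\<theta> i - \<theta> (Suc i))"
  proof (cases i)
    case (Suc k)
    then have "k + 2 \<le> d" using i by simp
    have "\<theta> (Suc i) = \<gamma> + \<beta> * \<theta> i - \<theta> (i - 1)"
      using three_termD[OF t \<open>k + 2 \<le> d\<close>] Suc by simp
    then show ?thesis by simp
  qed (simp add: f)
  have 2: "f (Suc (Suc i)) * (\<theta> (Suc (Suc i)) + \<theta> (Suc i) - \<beta> * \<theta> (Suc i) - \<gamma>)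
     = f (Suc (Suc i)) * (\<theta> (Suc i) - \<theta> i)"
  proof (cases "Suc i = d")
    case False
    then have "i + 2 \<le> d" using i by simp
    from three_termD[OF t this] show ?thesis by simp
  qed (simp add: f)
  have 3: "\<rho> = \<theta> i ^ 2 - \<beta> * \<theta> i * \<theta> (Suc i) + \<theta> (Suc i) ^ 2 - \<gamma> * (\<theta> i + \<theta> (Suc i))"
    using r unfolding aw_root_def by (simp add: algebra_simps)
  have 4: "aw_diag \<beta> \<gamma> \<rho> \<theta> \<theta>s f i = \<theta>s i * ((2 - \<beta>) * \<theta> i ^ 2 - 2 * \<gamma> * \<theta> i - \<rho>)
     + f i * (\<theta> i - \<theta> (Suc i)) + f (i + 1) * (\<theta> (i + 1) + \<theta> i - \<beta> * \<theta> i - \<gamma>)"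
    unfolding aw_diag_def 1 ..
  have 5: "aw_diag \<beta> \<gamma> \<rho> \<theta> \<theta>s f (Suc i) =
     \<theta>s (Suc i) * ((2 - \<beta>) * \<theta> (Suc i) ^ 2 - 2 * \<gamma> * \<theta> (Suc i) - \<rho>)
     + f (Suc i) * (\<theta> i + \<theta> (Suc i) - \<beta> * \<theta> (Suc i) - \<gamma>) + f (Suc (Suc i)) * (\<theta> (Suc i) - \<theta> i)"
    using 2 unfolding aw_diag_def by simp
  show ?thesis
    unfolding 4 5 aw_sub_def unfolding 3 by (simp add: power2_eq_square algebra_simps)
qed

lemma aw_diag_const:
  assumes t: "three_term d \<beta> \<gamma> \<theta>" and r: "aw_root \<beta> \<gamma> \<rho> (\<theta> 0) (\<theta> 1) = 0"
    and f: "f 0 = 0" "f (Suc d) = 0"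
    and s: "\<And>i. i < d \<Longrightarrow> aw_sub \<beta> \<gamma> \<gamma>s \<theta> \<theta>s f i = \<omega>" and i: "i \<le> d"
    and \<eta>: "aw_diag \<beta> \<gamma> \<rho> \<theta> \<theta>s f 0 = \<gamma>s * \<theta> 0 ^ 2 + \<omega> * \<theta> 0 + \<eta>"
  shows "aw_diag \<beta> \<gamma> \<rho> \<theta> \<theta>s f i = \<gamma>s * \<theta> i ^ 2 + \<omega> * \<theta> i + \<eta>"
  using i
proof (induction i)
  case 0 then show ?case using \<eta> by simp
next
  case (Suc i)
  then have i: "i < d" by simp
  show ?case
    using aw_diag_step[where \<theta>s = \<theta>s and \<gamma>s = \<gamma>s, OF t aw_root_consecutive[OF t r i] f i] Suc s[OF i]
    by (simp add: algebra_simps)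
qed

lemma aw_sub_reverse:
  assumes "i < d"
  shows "aw_sub \<beta> \<gamma> \<gamma>s (\<lambda>i. \<theta> (d - i)) (\<lambda>i. \<theta>s (d - i)) (\<lambda>i. f (Suc d - i)) i
     = aw_sub \<beta> \<gamma> \<gamma>s \<theta> \<theta>s f (d - Suc i)"
proof -
  define k where "k = d - Suc i"
  have e: "d - i = Suc k" "d - Suc i = k" "Suc d - i = Suc (Suc k)"
    using assms k_def by auto
  show ?thesis unfolding aw_sub_def by (simp add: e algebra_simps)
qed

lemma aw_sub_swap: "aw_sub \<beta> \<gamma>s \<gamma> \<theta>s \<theta> f i = aw_sub \<beta> \<gamma> \<gamma>s \<theta> \<theta>s f i"
  unfolding aw_sub_def by (simp add: algebra_simps)

section \<open>Partial sums of the antisymmetrised eigenvalues and the split formula\<close>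

context
  fixes d :: nat and \<beta> \<gamma> :: "'a::field" and \<theta> :: "nat \<Rightarrow> 'a"
  assumes t: "three_term d \<beta> \<gamma> \<theta>" and ne: "\<theta> 0 \<noteq> \<theta> d"
begin

definition vth :: "nat \<Rightarrow> 'a" where
  "vth i = (\<Sum>h<i. (\<theta> h - \<theta> (d - h)) / (\<theta> 0 - \<theta> d))"

lemma vth_0: "vth 0 = 0" and vth_1: "vth (Suc 0) = 1"
  and vth_2: "vth (Suc (Suc 0)) = 1 + (\<theta> 1 - \<theta> (d - 1)) / (\<theta> 0 - \<theta> d)"
  using ne by (auto simp: vth_def)

lemma vth_Suc_d: "vth (Suc d) = 0"
proof -
  have "(\<Sum>h<Suc d. \<theta> h) = (\<Sum>h<Suc d. \<theta> (d - h))"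
    by (subst sum.nat_diff_reindex[symmetric]) simp
  then show ?thesis unfolding vth_def sum_divide_distrib[symmetric] sum_subtractf by simp
qed

lemma vth_d: "vth d = 1"
proof -
  have "vth (Suc d) = vth d + (\<theta> d - \<theta> 0) / (\<theta> 0 - \<theta> d)" by (simp add: vth_def)
  moreover have "(\<theta> d - \<theta> 0) / (\<theta> 0 - \<theta> d) = -1" using ne by (simp add: field_simps)
  ultimately show ?thesis using vth_Suc_d by simp
qed

text \<open>The constant \<gamma> cancels in \<open>\<theta> h - \<theta> (d - h)\<close>, so these
  differences satisfy the homogeneous recurrence and their partial sums satisfy one with a constant
  right-hand side.\<close>

lemma vth_rec:
  assumes "i + 2 \<le> d"
  shows "vth (Suc i) - \<beta> * vth (Suc (Suc i)) + vth (Suc (Suc (Suc i)))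
    = vth i - \<beta> * vth (Suc i) + vth (Suc (Suc i))"
proof -
  define s where "s h = (\<theta> h - \<theta> (d - h))" for h
  have "s i - \<beta> * s (Suc i) + s (Suc (Suc i)) = 0"
    unfolding s_def three_termD[OF t assms] three_termD[OF three_term_reverse[OF t] assms]
    by (simp add: algebra_simps)
  then have "s (Suc (Suc i)) = \<beta> * s (Suc i) - s i" by (simp add: algebra_simps)
  then have "s (Suc (Suc i)) / (\<theta> 0 - \<theta> d) = \<beta> * (s (Suc i) / (\<theta> 0 - \<theta> d)) - s i / (\<theta> 0 - \<theta> d)"
    by (simp add: diff_divide_distrib)
  moreover have "vth (Suc k) = vth k + s k / (\<theta> 0 - \<theta> d)" for k
    by (simp add: vth_def s_def)
  ultimately show ?thesis by (simp add: algebra_simps)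
qed

lemma split_formula_vth:
  "split_formula d \<theta> \<theta>s \<zeta> i = \<zeta> * vth i + (\<theta>s i - \<theta>s 0) * (\<theta> (i - 1) - \<theta> d)"
  by (simp add: split_formula_def vth_def)

lemma split_formula_0: "split_formula d \<theta> \<theta>s \<zeta> 0 = 0"
  and split_formula_1: "split_formula d \<theta> \<theta>s \<zeta> (Suc 0) = \<zeta> + (\<theta>s 1 - \<theta>s 0) * (\<theta> 0 - \<theta> d)"
  and split_formula_Suc_d: "split_formula d \<theta> \<theta>s \<zeta> (Suc d) = 0"
  by (simp_all add: split_formula_vth vth_0 vth_1 vth_Suc_d)

text \<open>Once every term is reduced by the recurrences to two neighbouring values this is a
  polynomial identity. The work lies at the two ends, where a term refers outside the range of
  \<theta> or \<theta>s.\<close>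

lemma aw_sub_split_formula_step:
  assumes ts: "three_term d \<beta> \<gamma>s \<theta>s" and i: "i + 2 \<le> d"
  shows "aw_sub \<beta> \<gamma> \<gamma>s \<theta> \<theta>s (split_formula d \<theta> \<theta>s \<zeta>) (Suc i)
    = aw_sub \<beta> \<gamma> \<gamma>s \<theta> \<theta>s (split_formula d \<theta> \<theta>s \<zeta>) i"
proof -
  define \<kappa> where "\<kappa> = vth i - \<beta> * vth (Suc i) + vth (Suc (Suc i))"
  \<comment> \<open>Continues \<theta> one step below 0 by the recurrence. The value is free there,
    since its factor \<open>\<theta>s i - \<theta>s 0\<close> is zero at 0.\<close>
  define c where "c = (if i = 0 then \<gamma> + \<beta> * \<theta> 0 - \<theta> 1 else \<theta> (i - 1))"
  have v2: "vth (Suc (Suc i)) = \<kappa> - vth i + \<beta> * vth (Suc i)" by (simp add: \<kappa>_def)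
  have v3: "vth (Suc (Suc (Suc i))) = \<kappa> - vth (Suc i) + \<beta> * vth (Suc (Suc i))"
    using vth_rec[OF i] by (simp add: \<kappa>_def algebra_simps)
  have f0: "split_formula d \<theta> \<theta>s \<zeta> i = \<zeta> * vth i + (\<theta>s i - \<theta>s 0) * (c - \<theta> d)"
    by (simp add: split_formula_vth c_def)
  have t1: "\<theta> (Suc i) = \<gamma> + \<beta> * \<theta> i - c"
  proof (cases i)
    case 0 then show ?thesis by (simp add: c_def)
  next
    case (Suc k)
    with i have "k + 2 \<le> d" by simp
    from three_termD[OF t this] Suc show ?thesis by (simp add: c_def)
  qed
  have t2: "\<theta> (Suc (Suc i)) = \<gamma> + \<beta> * \<theta> (Suc i) - \<theta> i" using three_termD[OF t i] .
  have s2: "\<theta>s (Suc (Suc i)) = \<gamma>s + \<beta> * \<theta>s (Suc i) - \<theta>s i" using three_termD[OF ts i] .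
  \<comment> \<open>Continues \<theta>s one step beyond \<open>d\<close>, where its factor
    \<open>\<theta> (Suc (Suc i)) - \<theta> d\<close> is zero.\<close>
  define x where "x = (\<gamma>s + \<beta> * \<theta>s (Suc (Suc i)) - \<theta>s (Suc i))"
  have f3: "split_formula d \<theta> \<theta>s \<zeta> (Suc (Suc (Suc i)))
     = \<zeta> * vth (Suc (Suc (Suc i))) + (x - \<theta>s 0) * (\<theta> (Suc (Suc i)) - \<theta> d)"
  proof (cases "i + 2 = d")
    case True
    then have e: "\<theta> (Suc (Suc i)) = \<theta> d" by (simp flip: True)
    show ?thesis by (simp add: split_formula_vth e)
  next
    case False
    with i have "Suc i + 2 \<le> d" by simp
    from three_termD[OF ts this] show ?thesis by (simp add: x_def split_formula_vth)
  qed
  have f1: "split_formula d \<theta> \<theta>s \<zeta> (Suc i) = \<zeta> * vth (Suc i) + (\<theta>s (Suc i) - \<theta>s 0) * (\<theta> i - \<theta> d)"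
   and f2: "split_formula d \<theta> \<theta>s \<zeta> (Suc (Suc i)) = \<zeta> * vth (Suc (Suc i)) + (\<theta>s (Suc (Suc i)) - \<theta>s 0) * (\<theta> (Suc i) - \<theta> d)"
    by (simp_all add: split_formula_vth)
  show ?thesis unfolding aw_sub_def
    by (simp add: f0 f1 f2 f3 v3 v2 x_def t2 s2 t1) (simp add: algebra_simps)
qed

lemma aw_sub_split_formula:
  assumes ts: "three_term d \<beta> \<gamma>s \<theta>s" and i: "i < d"
  shows "aw_sub \<beta> \<gamma> \<gamma>s \<theta> \<theta>s (split_formula d \<theta> \<theta>s \<zeta>) i
    = aw_sub \<beta> \<gamma> \<gamma>s \<theta> \<theta>s (split_formula d \<theta> \<theta>s \<zeta>) 0"
  using i
proof (induction i)
  case (Suc i)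
  then show ?case using aw_sub_split_formula_step[OF ts, of i \<zeta>] by simp
qed simp

text \<open>Replacing \<open>\<theta>s 2\<close> by the recurrence covers \<open>d = 1\<close> too,
  where \<open>\<theta>s 2\<close> is out of range but has the factor
  \<open>\<theta> 1 - \<theta> d = 0\<close>.\<close>

lemma split_formula_2:
  assumes d: "d > 0" and ts: "three_term d \<beta> \<gamma>s \<theta>s"
  shows "split_formula d \<theta> \<theta>s \<zeta> (Suc (Suc 0))
    = \<zeta> * vth (Suc (Suc 0)) + (\<gamma>s + \<beta> * \<theta>s 1 - 2 * \<theta>s 0) * (\<theta> 1 - \<theta> d)"
proof (cases "d = 1")
  case True
  then have "\<theta> (Suc 0) = \<theta> d" by simp
  then show ?thesis by (simp add: split_formula_vth)
next
  case False
  with d have "0 + 2 \<le> d" by simp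
  from three_termD[OF ts this] show ?thesis by (simp add: split_formula_vth)
qed

text \<open>A denominator-free closed form of the constant \<omega>, affine in \<zeta>, suited to
  comparing a pair with its reversal.\<close>

lemma aw_sub_split_formula_0:
  assumes d: "d > 0" and ts: "three_term d \<beta> \<gamma>s \<theta>s"
  shows "(\<theta> 0 - \<theta> d) * aw_sub \<beta> \<gamma> \<gamma>s \<theta> \<theta>s (split_formula d \<theta> \<theta>s \<zeta>) 0
   = \<zeta> * ((1 - \<beta>) * (\<theta> 0 - \<theta> d) + \<theta> 1 - \<theta> (d - 1)) + (\<theta> 0 - \<theta> d) * (
   (\<gamma>s + \<beta> * \<theta>s 1 - 2 * \<theta>s 0) * (\<theta> 1 - \<theta> d) - \<beta> * ((\<theta>s 1 - \<theta>s 0) * (\<theta> 0 - \<theta> d)) +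
   (\<theta> 0 + \<theta> 1) * (\<theta>s 0 + \<theta>s 1) - \<beta> * (\<theta> 0 * \<theta>s 0 + \<theta> 1 * \<theta>s 1)
     - \<gamma> * (\<theta>s 0 + \<theta>s 1) - \<gamma>s * (\<theta> 0 + \<theta> 1))"
proof -
  have 1: "(\<theta> 0 - \<theta> d) * vth (Suc (Suc 0)) = \<theta> 0 - \<theta> d + \<theta> 1 - \<theta> (d - 1)"
    unfolding vth_2 using ne by (simp add: distrib_left)
  have "(\<theta> 0 - \<theta> d) * (\<zeta> * vth (Suc (Suc 0))) = \<zeta> * (\<theta> 0 - \<theta> d + \<theta> 1 - \<theta> (d - 1))"
    unfolding 1[symmetric] by (simp add: ac_simps)
  moreover have "D * (0 - \<beta> * (\<zeta> + q) + (\<zeta> * w + r) + x - y - z - u) =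
     \<zeta> * ((1 - \<beta>) * D + b - e) + D * (r - \<beta> * q + x - y - z - u)"
    if "D * (\<zeta> * w) = \<zeta> * (D + b - e)" for D w b e q r x y z u :: 'a
  proof -
    have "D * (0 - \<beta> * (\<zeta> + q) + (\<zeta> * w + r) + x - y - z - u)
      = D * (\<zeta> * w) + D * (r - \<beta> * (\<zeta> + q) + x - y - z - u)" by (simp add: algebra_simps)
    then show ?thesis unfolding that by (simp add: algebra_simps)
  qed
  ultimately show ?thesis
    unfolding aw_sub_def using split_formula_0 split_formula_1 split_formula_2[OF assms] by simp
qed

end


text \<open>The closed form above changes sign under reversal of \<theta> combined with the
  substitution of \<zeta>' for \<zeta>, and so does the factor
  \<open>\<theta> 0 - \<theta> d\<close>. Hence both pairs have the same \<omega>.\<close>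

lemma aw_sub_split_formula_reverse:
  fixes \<theta> :: "nat \<Rightarrow> 'a::field"
  assumes t: "three_term d \<beta> \<gamma> \<theta>" and ne: "\<theta> 0 \<noteq> \<theta> d" and d: "d > 0"
    and ts: "three_term d \<beta> \<gamma>s \<theta>s"
    and z: "\<zeta>' = \<zeta> + (\<theta>s 1 - \<theta>s 0) * (\<theta> 0 - \<theta> d)"
  shows "aw_sub \<beta> \<gamma> \<gamma>s (\<lambda>i. \<theta> (d - i)) \<theta>s (split_formula d (\<lambda>i. \<theta> (d - i)) \<theta>s \<zeta>') 0
    = aw_sub \<beta> \<gamma> \<gamma>s \<theta> \<theta>s (split_formula d \<theta> \<theta>s \<zeta>) 0"
proof -
  let ?r = "\<lambda>i. \<theta> (d - i)"
  have e: "d - (d - 1) = 1" using d by simp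
  have ne': "?r 0 \<noteq> ?r d" using ne by simp
  have "(?r 0 - ?r d) * aw_sub \<beta> \<gamma> \<gamma>s ?r \<theta>s (split_formula d ?r \<theta>s \<zeta>') 0
     = - ((\<theta> 0 - \<theta> d) * aw_sub \<beta> \<gamma> \<gamma>s \<theta> \<theta>s (split_formula d \<theta> \<theta>s \<zeta>) 0)"
    unfolding aw_sub_split_formula_0[OF t ne d ts]
      aw_sub_split_formula_0[OF three_term_reverse[OF t] ne' d ts]
    using d by (simp add: e z) (simp add: algebra_simps)
  moreover have "?r 0 - ?r d = - (\<theta> 0 - \<theta> d)" by simp
  ultimately show ?thesis using ne by (metis minus_mult_left mult_cancel_left neg_equal_iff_equal right_minus_eq)
qed

text \<open>The left-hand side is \<open>aw_root\<close> at equal arguments x, x. As a polynomial in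
  its second argument it has the roots y and \<open>\<beta> * x + \<gamma> - y\<close>, which gives
  the factorisation.\<close>

lemma aw_root_diag:
  assumes "aw_root \<beta> \<gamma> \<rho> x y = 0"
  shows "(2 - \<beta>) * x ^ 2 - 2 * \<gamma> * x - \<rho> = (x - y) * (x + y - \<beta> * x - \<gamma>)"
proof -
  have "\<rho> = x ^ 2 - \<beta> * x * y + y ^ 2 - \<gamma> * (x + y)"
    using assms unfolding aw_root_def by (simp add: algebra_simps)
  then show ?thesis by (simp add: power2_eq_square algebra_simps)
qed

text \<open>Both sides belong to the eigenvalue \<open>\<theta> 0\<close>, so equality here
  identifies the constants \<eta> of the pair and of its reversal.\<close>

lemma aw_diag_reverse_last:
  assumes d: "d > 0" and r: "aw_root \<beta> \<gamma> \<rho> (\<theta> 0) (\<theta> 1) = 0" and "f 0 = 0" "g (Suc d) = 0"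
    and b: "f 1 - g d = (\<theta>s d - \<theta>s 0) * (\<theta> 0 - \<theta> 1)"
  shows "aw_diag \<beta> \<gamma> \<rho> (\<lambda>i. \<theta> (d - i)) \<theta>s g d = aw_diag \<beta> \<gamma> \<rho> \<theta> \<theta>s f 0"
proof -
  have e: "d - (d - 1) = 1" using d by simp
  have f1: "f (Suc 0) = g d + (\<theta>s d - \<theta>s 0) * (\<theta> 0 - \<theta> 1)" using b by (simp add: algebra_simps)
  show ?thesis unfolding aw_diag_def using assms(3,4) d
    by (simp add: e f1 aw_root_diag[OF r]) (simp add: algebra_simps)
qed

text \<open>The equations \<open>\<eta> = aw_diag \<dots>\<close> for the pair and its reversal determine \<open>\<omega>\<close>, hence
  the whole sequence \<open>f\<close>, from the value of \<open>f 1\<close>.\<close>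

lemma split_formula_unique:
  fixes \<theta> :: "nat \<Rightarrow> 'a::field"
  assumes t: "three_term d \<beta> \<gamma> \<theta>" and ne: "\<theta> 0 \<noteq> \<theta> d" and d: "d > 0"
    and ts: "three_term d \<beta> \<gamma>s \<theta>s"
    and r: "aw_root \<beta> \<gamma> \<rho> (\<theta> 0) (\<theta> 1) = 0"
    and f: "f 0 = 0" and g: "g 0 = 0"
    and s: "\<And>i. i < d \<Longrightarrow> aw_sub \<beta> \<gamma> \<gamma>s \<theta> \<theta>s f i = \<omega>"
    and \<eta>: "aw_diag \<beta> \<gamma> \<rho> \<theta> \<theta>s f 0 = \<gamma>s * \<theta> 0 ^ 2 + \<omega> * \<theta> 0 + \<eta>"
    and \<eta>': "aw_diag \<beta> \<gamma> \<rho> (\<lambda>i. \<theta> (d - i)) \<theta>s g 0 = \<gamma>s * \<theta> d ^ 2 + \<omega> * \<theta> d + \<eta>"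
    and a: "f 1 = g 1 + (\<theta>s 1 - \<theta>s 0) * (\<theta> 0 - \<theta> d)"
    and i: "i \<le> d"
  shows "f i = split_formula d \<theta> \<theta>s (g 1) i"
proof -
  let ?h = "split_formula d \<theta> \<theta>s (g 1)"
  let ?Q = "\<lambda>x. (2 - \<beta>) * x ^ 2 - 2 * \<gamma> * x - \<rho>"
  have "(\<theta> 0 - \<theta> d) * \<omega> = (\<gamma>s * \<theta> 0 ^ 2 + \<omega> * \<theta> 0 + \<eta>) - (\<gamma>s * \<theta> d ^ 2 + \<omega> * \<theta> d + \<eta>)
      - \<gamma>s * (\<theta> 0 ^ 2 - \<theta> d ^ 2)"
    by (simp add: algebra_simps)
  also have "\<dots> = \<theta>s 0 * ?Q (\<theta> 0) - \<theta>s 0 * ?Q (\<theta> d) + f 1 * (\<theta> 1 + \<theta> 0 - \<beta> * \<theta> 0 - \<gamma>)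
      - g 1 * (\<theta> (d - 1) + \<theta> d - \<beta> * \<theta> d - \<gamma>) - \<gamma>s * (\<theta> 0 ^ 2 - \<theta> d ^ 2)"
    unfolding \<eta>[symmetric] \<eta>'[symmetric] by (simp add: aw_diag_def f g)
  also have "\<theta>s 0 * ?Q (\<theta> 0) - \<theta>s 0 * ?Q (\<theta> d)
     = \<theta>s 0 * (\<theta> 0 - \<theta> d) * ((2 - \<beta>) * (\<theta> 0 + \<theta> d) - 2 * \<gamma>)"
    by (simp add: power2_eq_square algebra_simps)
  also have "\<theta>s 0 * (\<theta> 0 - \<theta> d) * ((2 - \<beta>) * (\<theta> 0 + \<theta> d) - 2 * \<gamma>)
      + f 1 * (\<theta> 1 + \<theta> 0 - \<beta> * \<theta> 0 - \<gamma>)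
      - g 1 * (\<theta> (d - 1) + \<theta> d - \<beta> * \<theta> d - \<gamma>) - \<gamma>s * (\<theta> 0 ^ 2 - \<theta> d ^ 2)
     = (\<theta> 0 - \<theta> d) * aw_sub \<beta> \<gamma> \<gamma>s \<theta> \<theta>s ?h 0"
    unfolding aw_sub_split_formula_0[OF t ne d ts] a
    by (simp add: power2_eq_square) (simp add: algebra_simps)
  finally have \<omega>: "aw_sub \<beta> \<gamma> \<gamma>s \<theta> \<theta>s ?h 0 = \<omega>" using ne by simp
  \<comment> \<open>The value of \<open>aw_sub\<close> at i determines the term i + 2 from the terms
    i and i + 1, so the induction carries two consecutive terms.\<close>
  have "f i = ?h i \<and> (i \<le> d \<longrightarrow> f (Suc i) = ?h (Suc i))" if "i \<le> d" for i using that
  proof (induction i)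
    case 0
    then show ?case using split_formula_0[OF t ne] split_formula_1[OF t ne] f a by simp
  next
    case (Suc i)
    then have "i < d" by simp
    from s[OF this] aw_sub_split_formula[OF t ne ts this, of "g 1"] \<omega>
    have "aw_sub \<beta> \<gamma> \<gamma>s \<theta> \<theta>s f i = aw_sub \<beta> \<gamma> \<gamma>s \<theta> \<theta>s ?h i" by simp
    with Suc show ?case unfolding aw_sub_def by simp
  qed
  with i show ?thesis by blast
qed

section \<open>Bidiagonal matrices and the Askey-Wilson expression\<close>

abbreviation sq :: "nat \<Rightarrow> 'a mat set" where
  "sq d \<equiv> carrier_mat (Suc d) (Suc d)"

lemma sq_mult [simp]: "A \<in> sq d \<Longrightarrow> B \<in> sq d \<Longrightarrow> A * B \<in> sq d"
  by (rule mult_carrier_mat)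

lemma sq_minus [simp]: "A \<in> sq d \<Longrightarrow> B \<in> sq d \<Longrightarrow> A - B \<in> sq d"
  by (rule minus_carrier_mat)

lemma mult_index:
  fixes A B :: "'a::field mat"
  assumes "A \<in> sq d" "B \<in> sq d" "i \<le> d" "j \<le> d"
  shows "(A * B) $$ (i, j) = (\<Sum>k\<le>d. A $$ (i, k) * B $$ (k, j))"
proof -
  have "(A * B) $$ (i, j) = (\<Sum>k<Suc d. A $$ (i, k) * B $$ (k, j))"
    using assms by (auto simp: scalar_prod_def atLeast0LessThan intro!: sum.cong)
  then show ?thesis by (simp only: lessThan_Suc_atMost)
qed

lemma sq_eqI:
  assumes "A \<in> sq d" "B \<in> sq d" "\<And>i j. i \<le> d \<Longrightarrow> j \<le> d \<Longrightarrow> A $$ (i, j) = B $$ (i, j)"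
  shows "A = B"
  using assms by (intro eq_matI) auto

definition low :: "nat \<Rightarrow> (nat \<Rightarrow> 'a::field) \<Rightarrow> 'a mat" where
  "low d \<theta> = mat (Suc d) (Suc d) (\<lambda>(i, j). if i = j then \<theta> i else if i = Suc j then 1 else 0)"

definition upp :: "nat \<Rightarrow> (nat \<Rightarrow> 'a::field) \<Rightarrow> (nat \<Rightarrow> 'a) \<Rightarrow> 'a mat" where
  "upp d \<theta>s f = mat (Suc d) (Suc d) (\<lambda>(i, j). if i = j then \<theta>s i else if j = Suc i then f j else 0)"

lemma low_carrier [simp]: "low d \<theta> \<in> sq d" and upp_carrier [simp]: "upp d \<theta>s f \<in> sq d"
  by (simp_all add: low_def upp_def)

lemma low_index: "i \<le> d \<Longrightarrow> j \<le> d \<Longrightarrow>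
    low d \<theta> $$ (i, j) = (if i = j then \<theta> i else if i = Suc j then 1 else 0)"
  and upp_index: "i \<le> d \<Longrightarrow> j \<le> d \<Longrightarrow>
    upp d \<theta>s f $$ (i, j) = (if i = j then \<theta>s i else if j = Suc i then f j else 0)"
  by (simp_all add: low_def upp_def)

lemma low_mult:
  assumes "M \<in> sq d" "i \<le> d" "j \<le> d"
  shows "(low d \<theta> * M) $$ (i, j) = \<theta> i * M $$ (i, j) + (if i = 0 then 0 else M $$ (i - 1, j))"
proof -
  have "(low d \<theta> * M) $$ (i, j) = (\<Sum>k\<le>d. (if k = i then \<theta> i * M $$ (i, j) else 0)
      + (if k = i - 1 then (if i = 0 then 0 else M $$ (i - 1, j)) else 0))"
    unfolding mult_index[OF low_carrier assms]
    using assms by (intro sum.cong) (auto simp: low_index)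
  also have "\<dots> = \<theta> i * M $$ (i, j) + (if i = 0 then 0 else M $$ (i - 1, j))"
    unfolding sum.distrib using assms by simp
  finally show ?thesis .
qed

lemma mult_low:
  assumes "M \<in> sq d" "i \<le> d" "j \<le> d"
  shows "(M * low d \<theta>) $$ (i, j) = M $$ (i, j) * \<theta> j + (if j < d then M $$ (i, Suc j) else 0)"
proof -
  have "(M * low d \<theta>) $$ (i, j) = (\<Sum>k\<le>d. (if k = j then M $$ (i, j) * \<theta> j else 0)
      + (if k = Suc j then (if j < d then M $$ (i, Suc j) else 0) else 0))"
    unfolding mult_index[OF assms(1) low_carrier assms(2,3)]
    using assms by (intro sum.cong) (auto simp: low_index)
  also have "\<dots> = M $$ (i, j) * \<theta> j + (if j < d then M $$ (i, Suc j) else 0)"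
    unfolding sum.distrib using assms by simp
  finally show ?thesis .
qed

lemma upp_mult:
  assumes "M \<in> sq d" "i \<le> d" "j \<le> d"
  shows "(upp d \<theta>s f * M) $$ (i, j)
    = \<theta>s i * M $$ (i, j) + (if i < d then f (Suc i) * M $$ (Suc i, j) else 0)"
proof -
  have "(upp d \<theta>s f * M) $$ (i, j) = (\<Sum>k\<le>d. (if k = i then \<theta>s i * M $$ (i, j) else 0)
      + (if k = Suc i then (if i < d then f (Suc i) * M $$ (Suc i, j) else 0) else 0))"
    unfolding mult_index[OF upp_carrier assms]
    using assms by (intro sum.cong) (auto simp: upp_index)
  also have "\<dots> = \<theta>s i * M $$ (i, j) + (if i < d then f (Suc i) * M $$ (Suc i, j) else 0)"
    unfolding sum.distrib using assms by simp
  finally show ?thesis .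
qed

lemma mult_upp:
  assumes "M \<in> sq d" "i \<le> d" "j \<le> d"
  shows "(M * upp d \<theta>s f) $$ (i, j)
    = M $$ (i, j) * \<theta>s j + (if j = 0 then 0 else M $$ (i, j - 1) * f j)"
proof -
  have "(M * upp d \<theta>s f) $$ (i, j) = (\<Sum>k\<le>d. (if k = j then M $$ (i, j) * \<theta>s j else 0)
      + (if k = j - 1 then (if j = 0 then 0 else M $$ (i, j - 1) * f j) else 0))"
    unfolding mult_index[OF assms(1) upp_carrier assms(2,3)]
    using assms by (intro sum.cong) (auto simp: upp_index)
  also have "\<dots> = M $$ (i, j) * \<theta>s j + (if j = 0 then 0 else M $$ (i, j - 1) * f j)"
    unfolding sum.distrib using assms by simp
  finally show ?thesis .
qed

lemma diag_mult_index:
  fixes M :: "'a::field mat"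
  assumes "M \<in> sq d" "i \<le> d" "j \<le> d"
  shows "(mat_diag (Suc d) z * M) $$ (i, j) = z i * M $$ (i, j)"
    and "(M * mat_diag (Suc d) z) $$ (i, j) = M $$ (i, j) * z j"
  using assms mat_diag_mult_left[of M "Suc d" "Suc d" z] mat_diag_mult_right[of M "Suc d" "Suc d" z]
  by auto

lemma mat_diag_index: "i \<le> d \<Longrightarrow> j \<le> d \<Longrightarrow> mat_diag (Suc d) z $$ (i, j) = (if i = j then z j else 0)"
  by (simp add: mat_diag_def)

section \<open>Matrices of bounded upper bandwidth\<close>

definition band :: "nat \<Rightarrow> nat \<Rightarrow> 'a::field mat \<Rightarrow> bool" where
  "band d a M \<longleftrightarrow> (\<forall>i \<le> d. \<forall>j \<le> d. i + a < j \<longrightarrow> M $$ (i, j) = 0)"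

text \<open>Used with bandwidth 0 for lower triangular and 1 for Hessenberg matrices. The outermost
  diagonal is recorded as well because its nonvanishing yields irreducibility.\<close>

lemma band_mult:
  fixes A B :: "'a::field mat"
  assumes "A \<in> sq d" "B \<in> sq d" "band d a A" "band d b B"
  shows "band d (a + b) (A * B)"
    and "i + (a + b) \<le> d \<Longrightarrow>
      (A * B) $$ (i, i + (a + b)) = A $$ (i, i + a) * B $$ (i + a, i + (a + b))"
proof -
  have z: "A $$ (i, k) * B $$ (k, j) = 0" if "i \<le> d" "j \<le> d" "k \<le> d" "i + (a + b) < j" for i j k
  proof (cases "i + a < k")
    case True
    then show ?thesis using that assms by (auto simp: band_def)
  next
    case False
    then have "k + b < j" using that by linarith
    then show ?thesis using that assms by (auto simp: band_def)
  qed
  show "band d (a + b) (A * B)"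
    unfolding band_def using z by (auto simp: mult_index[OF assms(1,2)] intro!: sum.neutral)
  assume i: "i + (a + b) \<le> d"
  have h: "A $$ (i, k) * B $$ (k, i + (a + b)) = (if k = i + a then A $$ (i, i + a) * B $$ (i + a, i + (a + b)) else 0)"
    if "k \<le> d" for k
  proof -
    consider "k = i + a" | "i + a < k" | "k + b < i + (a + b)" by linarith
    then show ?thesis using that assms i by cases (auto simp: band_def)
  qed
  have "(\<Sum>k\<le>d. A $$ (i, k) * B $$ (k, i + (a + b))) = (\<Sum>k\<le>d.
      if k = i + a then A $$ (i, i + a) * B $$ (i + a, i + (a + b)) else 0)"
    by (intro sum.cong refl h) simp
  then show "(A * B) $$ (i, i + (a + b)) = A $$ (i, i + a) * B $$ (i + a, i + (a + b))"
    unfolding mult_index[OF assms(1,2) add_leD1[OF i] i] using i by simp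
qed

text \<open>The left-hand side of the Askey-Wilson relation, with different matrices on the two sides of
  \<open>T\<close> so that it can be moved through intertwiners and eigenvector matrices.\<close>

definition aw2 :: "'a::field \<Rightarrow> 'a \<Rightarrow> 'a \<Rightarrow> 'a mat \<Rightarrow> 'a mat \<Rightarrow> 'a mat \<Rightarrow> 'a mat" where
  "aw2 \<beta> \<gamma> \<rho> L L' T = L * (L * T) + (- \<beta>) \<cdot>\<^sub>m (L * (T * L')) + (T * L') * L'
     + (- \<gamma>) \<cdot>\<^sub>m (L * T + T * L') + (- \<rho>) \<cdot>\<^sub>m T"

lemma aw2_carrier [simp]: "L \<in> sq d \<Longrightarrow> L' \<in> sq d \<Longrightarrow> T \<in> sq d \<Longrightarrow> aw2 \<beta> \<gamma> \<rho> L L' T \<in> sq d"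
  by (auto simp: aw2_def)

lemma assoc_sq: "A \<in> sq d \<Longrightarrow> B \<in> sq d \<Longrightarrow> C \<in> sq d \<Longrightarrow> (A * B) * C = A * (B * (C :: 'a::field mat))"
  by (rule assoc_mult_mat)

text \<open>Think of \<open>T\<close> as a map between two spaces, each with its own operator; an
  intertwiner \<open>G\<close> replaces the space on the right, and \<open>aw2_mult_left\<close>
  does the same on the left.\<close>

lemma aw2_mult_right:
  assumes c: "L \<in> sq d" "L' \<in> sq d" "L'' \<in> sq d" "T \<in> sq d" "G \<in> sq d" and g: "L' * G = G * L''"
  shows "aw2 \<beta> \<gamma> \<rho> L L'' (T * G) = aw2 \<beta> \<gamma> \<rho> L L' T * G"
proof -
  have g': "L' * (G * L'') = G * (L'' * L'')"
    using assoc_sq[OF c(2,5,3)] assoc_sq[OF c(5,3,3)] g by simp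
  have 1: "T * G * L'' = (T * L') * G"
    using c by (simp add: assoc_sq g)
  have 2: "(T * L') * G * L'' = ((T * L') * L') * G"
    using c by (simp add: assoc_sq g g')
  have d: "aw2 \<beta> \<gamma> \<rho> L L' T * G = (L * (L * T)) * G + (- \<beta>) \<cdot>\<^sub>m ((L * (T * L')) * G) + ((T * L') * L') * G
     + (- \<gamma>) \<cdot>\<^sub>m ((L * T) * G + (T * L') * G) + (- \<rho>) \<cdot>\<^sub>m (T * G)"
    unfolding aw2_def using c
    by (simp add: add_mult_distrib_mat[of _ "Suc d" "Suc d"] mult_smult_assoc_mat[of _ "Suc d" "Suc d"])
  show ?thesis unfolding d unfolding aw2_def 1 2 using c by (simp add: assoc_sq)
qed

lemma aw2_mult_left:
  assumes c: "L \<in> sq d" "L' \<in> sq d" "L'' \<in> sq d" "T \<in> sq d" "G \<in> sq d" and g: "G * L' = L'' * G"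
  shows "aw2 \<beta> \<gamma> \<rho> L'' L (G * T) = G * aw2 \<beta> \<gamma> \<rho> L' L T"
proof -
  have g': "L'' * (G * M) = G * (L' * M)" if "M \<in> sq d" for M
    using assoc_sq[OF c(3,5) that] assoc_sq[OF c(5,2) that] g by simp
  have d: "G * aw2 \<beta> \<gamma> \<rho> L' L T = G * (L' * (L' * T)) + (- \<beta>) \<cdot>\<^sub>m (G * (L' * (T * L))) + G * ((T * L) * L)
     + (- \<gamma>) \<cdot>\<^sub>m (G * (L' * T) + G * (T * L)) + (- \<rho>) \<cdot>\<^sub>m (G * T)"
    unfolding aw2_def using c
    by (simp add: mult_add_distrib_mat[of _ "Suc d" "Suc d" _ "Suc d"] mult_smult_distrib[of _ "Suc d" "Suc d" _ "Suc d"])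
  show ?thesis unfolding d unfolding aw2_def using c by (simp add: assoc_sq g')
qed

lemma aw2_index:
  assumes "L \<in> sq d" "L' \<in> sq d" "T \<in> sq d" "i \<le> d" "j \<le> d"
  shows "aw2 \<beta> \<gamma> \<rho> L L' T $$ (i, j) = (L * (L * T)) $$ (i, j) - \<beta> * (L * (T * L')) $$ (i, j)
    + ((T * L') * L') $$ (i, j) - \<gamma> * ((L * T) $$ (i, j) + (T * L') $$ (i, j)) - \<rho> * T $$ (i, j)"
proof -
  have c: "L * (L * T) \<in> sq d" "L * (T * L') \<in> sq d" "(T * L') * L' \<in> sq d" "L * T \<in> sq d" "T * L' \<in> sq d"
    using assms by auto
  show ?thesis unfolding aw2_def using assms(3,4,5) c by (auto simp del: index_mult_mat)
qed

lemma aw2_minus: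
  assumes "L \<in> sq d" "L' \<in> sq d" "T \<in> sq d" "T' \<in> sq d"
  shows "aw2 \<beta> \<gamma> \<rho> L L' (T - T') = aw2 \<beta> \<gamma> \<rho> L L' T - aw2 \<beta> \<gamma> \<rho> L L' T'"
proof (rule sq_eqI[where d = d])
  fix i j assume ij: "i \<le> d" "j \<le> d"
  have m: "L * (T - T') = L * T - L * T'" "(T - T') * L' = T * L' - T' * L'"
    "L * (L * T - L * T') = L * (L * T) - L * (L * T')"
    "L * (T * L' - T' * L') = L * (T * L') - L * (T' * L')"
    "(T * L' - T' * L') * L' = T * L' * L' - T' * L' * L'"
    using assms by (simp_all add: mult_minus_distrib_mat[of _ "Suc d" "Suc d" _ "Suc d"]
        minus_mult_distrib_mat[of _ "Suc d" "Suc d" _ _ "Suc d"])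
  have c: "L * (L * T) \<in> sq d" "L * (T * L') \<in> sq d" "(T * L') * L' \<in> sq d" "L * T \<in> sq d" "T * L' \<in> sq d"
     "L * (L * T') \<in> sq d" "L * (T' * L') \<in> sq d" "(T' * L') * L' \<in> sq d" "L * T' \<in> sq d" "T' * L' \<in> sq d"
    using assms by auto
  have mi: "(A - B) $$ (i, j) = A $$ (i, j) - B $$ (i, j)" if "B \<in> sq d" for A B :: "'a mat"
    using that ij by auto
  have "T - T' \<in> sq d" using assms by auto
  then show "aw2 \<beta> \<gamma> \<rho> L L' (T - T') $$ (i, j) = (aw2 \<beta> \<gamma> \<rho> L L' T - aw2 \<beta> \<gamma> \<rho> L L' T') $$ (i, j)"
    using assms c ij
    by (simp add: mi aw2_index[of _ d] m del: index_mult_mat minus_carrier_mat) (simp add: algebra_simps)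
qed (use assms in simp_all)

text \<open>Between diagonal matrices the expression acts entry by entry, which is how
  \<open>aw_root\<close> arises.\<close>

lemma aw2_diag:
  assumes "B \<in> sq d" "i \<le> d" "j \<le> d"
  shows "aw2 \<beta> \<gamma> \<rho> (mat_diag (Suc d) \<theta>) (mat_diag (Suc d) \<theta>') B $$ (i, j)
    = aw_root \<beta> \<gamma> \<rho> (\<theta> i) (\<theta>' j) * B $$ (i, j)"
proof -
  have "mat_diag (Suc d) \<theta> * B \<in> sq d" "B * mat_diag (Suc d) \<theta>' \<in> sq d" using assms by simp_all
  then show ?thesis using assms
    by (simp add: aw2_index[of _ d] diag_mult_index[where d = d] del: index_mult_mat)
      (simp add: aw_root_def power2_eq_square algebra_simps)
qed

definition poly2 :: "nat \<Rightarrow> 'a::field \<Rightarrow> 'a \<Rightarrow> 'a \<Rightarrow> 'a mat \<Rightarrow> 'a mat" where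
  "poly2 d \<gamma>s \<omega> \<eta> L = \<gamma>s \<cdot>\<^sub>m (L * L) + \<omega> \<cdot>\<^sub>m L + \<eta> \<cdot>\<^sub>m 1\<^sub>m (Suc d)"

lemma poly2_carrier [simp]: "L \<in> sq d \<Longrightarrow> poly2 d \<gamma>s \<omega> \<eta> L \<in> sq d"
  by (auto simp: poly2_def)

lemma poly2_index:
  assumes "L \<in> sq d" "i \<le> d" "j \<le> d"
  shows "poly2 d \<gamma>s \<omega> \<eta> L $$ (i, j) = \<gamma>s * (L * L) $$ (i, j) + \<omega> * L $$ (i, j) + (if i = j then \<eta> else 0)"
proof -
  have c: "L * L \<in> sq d" using assms by auto
  show ?thesis unfolding poly2_def using assms carrier_matD[OF c] by (auto simp del: index_mult_mat(1))
qed

lemma poly2_intertwine: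
  assumes c: "L \<in> sq d" "L' \<in> sq d" "G \<in> sq d" and g: "L * G = G * L'"
  shows "poly2 d \<gamma>s \<omega> \<eta> L * G = G * poly2 d \<gamma>s \<omega> \<eta> L'"
proof -
  have "(L * L) * G = G * (L' * L')"
  proof -
    have "(L * L) * G = L * (G * L')" using c by (simp add: assoc_sq g)
    also have "\<dots> = (L * G) * L'" using c by (simp add: assoc_sq)
    finally show ?thesis using c by (simp add: g assoc_sq)
  qed
  then show ?thesis unfolding poly2_def using c g
    by (simp add: add_mult_distrib_mat[of _ "Suc d" "Suc d"] mult_smult_assoc_mat[of _ "Suc d" "Suc d"]
      mult_add_distrib_mat[of _ "Suc d" "Suc d" _ "Suc d"] mult_smult_distrib[of _ "Suc d" "Suc d" _ "Suc d"])
qed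

lemma low_low_index:
  assumes "i \<le> d" "j \<le> d"
  shows "(low d \<theta> * low d \<theta>) $$ (i, j) = (if i = j then \<theta> i ^ 2 else if i = Suc j then \<theta> i + \<theta> j
     else if i = Suc (Suc j) then 1 else 0)"
  using assms by (cases i) (auto simp: low_mult low_index power2_eq_square simp del: index_mult_mat)

section \<open>The diagonals of the Askey-Wilson expression of a bidiagonal pair\<close>

context
  fixes d :: nat and \<beta> \<gamma> \<rho> :: "'a::field" and \<theta> \<theta>s f :: "nat \<Rightarrow> 'a"
begin

abbreviation (input) "W \<equiv> aw2 \<beta> \<gamma> \<rho> (low d \<theta>) (low d \<theta>) (upp d \<theta>s f)"

lemma W_index:
  assumes "i \<le> d" "j \<le> d"
  shows "W $$ (i, j) =
    \<theta> i * (\<theta> i * upp d \<theta>s f $$ (i, j) + (if i = 0 then 0 else upp d \<theta>s f $$ (i - 1, j)))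
    + (if i = 0 then 0 else \<theta> (i - 1) * upp d \<theta>s f $$ (i - 1, j)
        + (if i - 1 = 0 then 0 else upp d \<theta>s f $$ (i - 1 - 1, j)))
    - \<beta> * (\<theta> i * (upp d \<theta>s f $$ (i, j) * \<theta> j + (if j < d then upp d \<theta>s f $$ (i, Suc j) else 0))
        + (if i = 0 then 0 else upp d \<theta>s f $$ (i - 1, j) * \<theta> j
             + (if j < d then upp d \<theta>s f $$ (i - 1, Suc j) else 0)))
    + ((upp d \<theta>s f $$ (i, j) * \<theta> j + (if j < d then upp d \<theta>s f $$ (i, Suc j) else 0)) * \<theta> j
       + (if j < d then upp d \<theta>s f $$ (i, Suc j) * \<theta> (Suc j)
            + (if Suc j < d then upp d \<theta>s f $$ (i, Suc (Suc j)) else 0) else 0))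
    - \<gamma> * (\<theta> i * upp d \<theta>s f $$ (i, j) + (if i = 0 then 0 else upp d \<theta>s f $$ (i - 1, j))
       + (upp d \<theta>s f $$ (i, j) * \<theta> j + (if j < d then upp d \<theta>s f $$ (i, Suc j) else 0)))
    - \<rho> * upp d \<theta>s f $$ (i, j)"
proof -
  have c: "low d \<theta> * upp d \<theta>s f \<in> sq d" "upp d \<theta>s f * low d \<theta> \<in> sq d"
    by (auto intro: mult_carrier_mat)
  show ?thesis using assms
    by (simp add: aw2_index[of _ d] c low_mult mult_low del: index_mult_mat)
qed

lemma W_sub2: "i + 2 \<le> d \<Longrightarrow> W $$ (Suc (Suc i), i) = \<theta>s i - \<beta> * \<theta>s (Suc i) + \<theta>s (Suc (Suc i))"
  by (simp add: W_index upp_index)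

lemma W_sub1:
  assumes "i < d" "f 0 = 0" "f (Suc d) = 0"
  shows "W $$ (Suc i, i) = aw_sub \<beta> \<gamma> \<gamma>s \<theta> \<theta>s f i + \<gamma>s * (\<theta> i + \<theta> (Suc i))"
proof (cases "Suc i < d")
  case True
  then show ?thesis using assms
    by (cases i) (simp_all add: W_index upp_index aw_sub_def, simp_all add: algebra_simps)
next
  case False
  then have "Suc i = d" using assms by simp
  then have "f (Suc (Suc i)) = 0" using assms by simp
  then show ?thesis using assms False
    by (cases i) (simp_all add: W_index upp_index aw_sub_def, simp_all add: algebra_simps)
qed

lemma W_diag:
  assumes "i \<le> d" "f 0 = 0" "f (Suc d) = 0"
  shows "W $$ (i, i) = aw_diag \<beta> \<gamma> \<rho> \<theta> \<theta>s f i"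
proof (cases "i < d")
  case True
  then show ?thesis using assms
    by (cases i) (simp_all add: W_index upp_index aw_diag_def power2_eq_square, simp_all add: algebra_simps)
next
  case False
  then have "f (Suc i) = 0" using assms le_neq_implies_less by blast
  then show ?thesis using assms(1,2) False unfolding W_index[OF assms(1) assms(1)]
    by (cases i) (simp_all add: upp_index aw_diag_def power2_eq_square, simp_all add: algebra_simps,
      intro conjI impI, linarith+)
qed

lemma W_super: "i < d \<Longrightarrow> W $$ (i, Suc i) = f (Suc i) * aw_root \<beta> \<gamma> \<rho> (\<theta> i) (\<theta> (Suc i))"
  by (cases i) (auto simp: W_index upp_index aw_root_def power2_eq_square algebra_simps)

lemma W_other:
  assumes "i \<le> d" "j \<le> d" "Suc i < j \<or> Suc (Suc j) < i"
  shows "W $$ (i, j) = 0"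
  using assms(3)
proof
  assume "Suc i < j"
  then show ?thesis using assms(1,2) by (cases i; cases "i - 1") (simp_all add: W_index upp_index)
next
  assume "Suc (Suc j) < i"
  then obtain k where "i = Suc (Suc k)" "j < k" by (metis Suc_lessE Suc_lessD)
  then show ?thesis using assms(1,2) by (simp add: W_index upp_index)
qed

text \<open>Both sides live on two subdiagonals, the diagonal and one superdiagonal. The hypotheses
  are the equations of these four diagonals; on the superdiagonal the condition on
  \<open>aw_root\<close> makes the left-hand side vanish.\<close>

lemma aw2_low_upp:
  assumes f: "f 0 = 0" "f (Suc d) = 0"
    and t: "three_term d \<beta> \<gamma>s \<theta>s"
    and r: "\<And>i. i < d \<Longrightarrow> aw_root \<beta> \<gamma> \<rho> (\<theta> i) (\<theta> (Suc i)) = 0"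
    and s: "\<And>i. i < d \<Longrightarrow> aw_sub \<beta> \<gamma> \<gamma>s \<theta> \<theta>s f i = \<omega>"
    and g: "\<And>i. i \<le> d \<Longrightarrow> aw_diag \<beta> \<gamma> \<rho> \<theta> \<theta>s f i = \<gamma>s * \<theta> i ^ 2 + \<omega> * \<theta> i + \<eta>"
  shows "W = poly2 d \<gamma>s \<omega> \<eta> (low d \<theta>)"
proof (rule sq_eqI[where d = d])
  fix i j assume ij: "i \<le> d" "j \<le> d"
  consider "i = j" | "i = Suc j" | "i = Suc (Suc j)" | "j = Suc i" | "Suc i < j \<or> Suc (Suc j) < i" by linarith
  then show "W $$ (i, j) = poly2 d \<gamma>s \<omega> \<eta> (low d \<theta>) $$ (i, j)"
  proof cases
    case 3
    with ij three_termD[OF t, of j] show ?thesis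
      using W_sub2[of j] by (simp add: poly2_index low_low_index low_index del: index_mult_mat)
  qed (use ij in \<open>auto simp: poly2_index low_low_index low_index W_diag W_sub1[where \<gamma>s = \<gamma>s]
    W_super W_other f r s g algebra_simps simp del: index_mult_mat\<close>)
qed auto

text \<open>The second subdiagonal gives a recurrence for \<theta>s with the same \<beta> as for
  \<theta>. This is the source of the common ratio in a parameter array.\<close>

lemma aw2_low_upp_D:
  assumes f: "f 0 = 0" "f (Suc d) = 0" and w: "W = poly2 d \<gamma>s \<omega> \<eta> (low d \<theta>)"
  shows "three_term d \<beta> \<gamma>s \<theta>s"
    and "\<And>i. i < d \<Longrightarrow> aw_sub \<beta> \<gamma> \<gamma>s \<theta> \<theta>s f i = \<omega>"
    and "\<And>i. i \<le> d \<Longrightarrow> aw_diag \<beta> \<gamma> \<rho> \<theta> \<theta>s f i = \<gamma>s * \<theta> i ^ 2 + \<omega> * \<theta> i + \<eta>"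
proof -
  show "three_term d \<beta> \<gamma>s \<theta>s" unfolding three_term_def
  proof (intro allI impI)
    fix i assume i: "i + 2 \<le> d"
    from W_sub2[OF this] i show "\<theta>s i - \<beta> * \<theta>s (i + 1) + \<theta>s (i + 2) = \<gamma>s"
      unfolding w by (simp add: poly2_index low_low_index low_index del: index_mult_mat)
  qed
  fix i
  show "aw_sub \<beta> \<gamma> \<gamma>s \<theta> \<theta>s f i = \<omega>" if "i < d"
    using W_sub1[OF that f, of \<gamma>s] that
    unfolding w by (simp add: poly2_index low_low_index low_index algebra_simps del: index_mult_mat)
  show "aw_diag \<beta> \<gamma> \<rho> \<theta> \<theta>s f i = \<gamma>s * \<theta> i ^ 2 + \<omega> * \<theta> i + \<eta>" if "i \<le> d"
    using W_diag[OF that f] that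
    unfolding w by (simp add: poly2_index low_low_index low_index algebra_simps del: index_mult_mat)
qed

end

section \<open>Diagonalized matrices and primitive idempotents\<close>

text \<open>The inverse \<open>Y\<close> is part of the data: its rows are left eigenvectors, and
  \<open>Y * M * X\<close> is the matrix of \<open>M\<close> in the eigenbasis.\<close>

definition eigdec :: "nat \<Rightarrow> 'a::field mat \<Rightarrow> (nat \<Rightarrow> 'a) \<Rightarrow> 'a mat \<Rightarrow> 'a mat \<Rightarrow> bool" where
  "eigdec d A \<theta> X Y \<longleftrightarrow> A \<in> sq d \<and> X \<in> sq d \<and> Y \<in> sq d \<and> X * Y = 1\<^sub>m (Suc d) \<and>
     Y * X = 1\<^sub>m (Suc d) \<and> A * X = X * mat_diag (Suc d) \<theta>"

lemma eigdecD:
  assumes "eigdec d A \<theta> X Y"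
  shows "A \<in> sq d" "X \<in> sq d" "Y \<in> sq d" "X * Y = 1\<^sub>m (Suc d)" "Y * X = 1\<^sub>m (Suc d)"
    "A * X = X * mat_diag (Suc d) \<theta>" "Y * A = mat_diag (Suc d) \<theta> * Y"
    "A = X * (mat_diag (Suc d) \<theta> * Y)"
proof -
  show c: "A \<in> sq d" "X \<in> sq d" "Y \<in> sq d" and xy: "X * Y = 1\<^sub>m (Suc d)" and yx: "Y * X = 1\<^sub>m (Suc d)"
    and e: "A * X = X * mat_diag (Suc d) \<theta>"
    using assms by (auto simp: eigdec_def)
  have "A = (A * X) * Y" using c by (simp add: xy)
  then show a: "A = X * (mat_diag (Suc d) \<theta> * Y)" unfolding e using c by (simp add: assoc_sq[where d = d])
  have "Y * A = (Y * X) * (mat_diag (Suc d) \<theta> * Y)"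
    by (subst a) (use c in \<open>simp add: assoc_sq[OF c(3,2)]\<close>)
  then show "Y * A = mat_diag (Suc d) \<theta> * Y"
    unfolding yx left_mult_one_mat[OF sq_mult[OF mat_diag_dim c(3)]] .
qed

lemma mult_cancel_left_inverse:
  assumes "X \<in> sq d" "Y \<in> sq d" "X * Y = 1\<^sub>m (Suc d)" "M \<in> sq d"
  shows "X * (Y * M) = (M :: 'a::field mat)"
  using assoc_sq[OF assms(1,2,4)] assms by simp

lemma eigdec_similar:
  assumes "eigdec d A \<theta> X Y"
  shows "similar_mat A (mat_diag (Suc d) \<theta>)"
  unfolding similar_mat_def
  by (rule exI[of _ X], rule exI[of _ Y], rule similar_mat_witI[where n = "Suc d"])
    (use eigdecD(1-5,8)[OF assms] in \<open>simp_all add: assoc_sq[where d = d]\<close>)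

lemma eigenvalues_upper_triangular:
  fixes A :: "'a::field mat"
  assumes "A \<in> sq d" "upper_triangular A"
  shows "{k. eigenvalue A k} = (\<lambda>i. A $$ (i, i)) ` {0..d}"
proof -
  have "eigenvalue A k \<longleftrightarrow> k \<in> set (diag_mat A)" for k
    unfolding eigenvalue_root_char_poly[OF assms(1)] char_poly_upper_triangular[OF assms]
    by (auto simp: poly_prod_list prod_list_zero_iff)
  moreover have "set (diag_mat A) = (\<lambda>i. A $$ (i, i)) ` {0..d}"
    using assms(1) by (auto simp: diag_mat_def atLeastLessThanSuc_atLeastAtMost simp del: upt_Suc)
  ultimately show ?thesis by auto
qed

lemma eigdec_eigenvalues:
  assumes "eigdec d A \<theta> X Y"
  shows "{k. eigenvalue A k} = \<theta> ` {0..d}"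
proof -
  have "{k. eigenvalue A k} = {k. eigenvalue (mat_diag (Suc d) \<theta>) k}"
    using char_poly_similar[OF eigdec_similar[OF assms]] eigdecD(1)[OF assms]
    by (simp add: eigenvalue_root_char_poly[where n = "Suc d"])
  also have "\<dots> = (\<lambda>i. mat_diag (Suc d) \<theta> $$ (i, i)) ` {0..d}"
    by (rule eigenvalues_upper_triangular) (auto simp: mat_diag_def upper_triangular_def)
  also have "\<dots> = \<theta> ` {0..d}" by (intro image_cong) (auto simp: mat_diag_index)
  finally show ?thesis .
qed

definition proj :: "nat \<Rightarrow> 'a::field mat \<Rightarrow> 'a mat \<Rightarrow> nat \<Rightarrow> 'a mat" where
  "proj d X Y i = X * (mat_diag (Suc d) (\<lambda>j. if j = i then 1 else 0) * Y)"

text \<open>In the eigenbasis the product becomes a Lagrange basis polynomial evaluated at the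
  eigenvalues, which is 1 at the i-th one and 0 at the others.\<close>

lemma primitive_idempotent_eigdec:
  assumes e: "eigdec d A \<theta> X Y" and inj: "inj_on \<theta> {0..d}" and i: "i \<le> d"
  shows "primitive_idempotent d A \<theta> i = proj d X Y i"
proof -
  note D = eigdecD[OF e]
  define D where "D f = mat_diag (Suc d) f" for f :: "nat \<Rightarrow> 'a"
  have Dc: "D f \<in> sq d" for f by (simp add: D_def)
  have step: "((1 / (\<theta> i - \<theta> j)) \<cdot>\<^sub>m (A - \<theta> j \<cdot>\<^sub>m 1\<^sub>m (Suc d))) * (X * (D g * Y))
     = X * (D (\<lambda>k. (\<theta> k - \<theta> j) / (\<theta> i - \<theta> j) * g k) * Y)" for j g
  proof -
    let ?c = "1 / (\<theta> i - \<theta> j)"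
    have sm: "(a \<cdot>\<^sub>m M) $$ (k, l) = a * M $$ (k, l)" if "M \<in> sq d" "k \<le> d" "l \<le> d" for a :: 'a and M k l
      using that by auto
    have "A * X - \<theta> j \<cdot>\<^sub>m X = X * D (\<lambda>k. \<theta> k - \<theta> j)"
      unfolding D(6) by (rule sq_eqI[where d = d])
        (use D(2) in \<open>auto simp: D_def diag_mult_index[where d = d] right_diff_distrib simp del: index_mult_mat(1)\<close>)
    then have 1: "(A - \<theta> j \<cdot>\<^sub>m 1\<^sub>m (Suc d)) * X = X * D (\<lambda>k. \<theta> k - \<theta> j)"
      using D(1,2) by (simp add: minus_mult_distrib_mat[of _ "Suc d" "Suc d" _ _ "Suc d"]
        mult_smult_assoc_mat[of _ "Suc d" "Suc d" _ "Suc d"])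
    have c: "A - \<theta> j \<cdot>\<^sub>m 1\<^sub>m (Suc d) \<in> sq d" using D(1) by simp
    have "(?c \<cdot>\<^sub>m (A - \<theta> j \<cdot>\<^sub>m 1\<^sub>m (Suc d))) * (X * (D g * Y))
      = ?c \<cdot>\<^sub>m (((A - \<theta> j \<cdot>\<^sub>m 1\<^sub>m (Suc d)) * X) * (D g * Y))"
      using D(1,2,3) c Dc by (simp add: assoc_sq[where d = d] mult_smult_assoc_mat[of _ "Suc d" "Suc d" _ "Suc d"])
    also have "\<dots> = ?c \<cdot>\<^sub>m (X * ((D (\<lambda>k. \<theta> k - \<theta> j) * D g) * Y))"
      unfolding 1 using D(2,3) Dc by (simp add: assoc_sq[where d = d])
    also have "\<dots> = X * ((?c \<cdot>\<^sub>m (D (\<lambda>k. \<theta> k - \<theta> j) * D g)) * Y)"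
      using D(2,3) Dc by (simp add: assoc_sq[where d = d] mult_smult_assoc_mat[of _ "Suc d" "Suc d" _ "Suc d"]
        mult_smult_distrib[of _ "Suc d" "Suc d" _ "Suc d"])
    also have "?c \<cdot>\<^sub>m (D (\<lambda>k. \<theta> k - \<theta> j) * D g) = D (\<lambda>k. (\<theta> k - \<theta> j) / (\<theta> i - \<theta> j) * g k)"
      by (rule sq_eqI[where d = d]) (auto simp: D_def mat_diag_index sm)
    finally show ?thesis .
  qed
  have "foldr (\<lambda>j M. ((1 / (\<theta> i - \<theta> j)) \<cdot>\<^sub>m (A - \<theta> j \<cdot>\<^sub>m 1\<^sub>m (Suc d))) * M) js (1\<^sub>m (Suc d))
     = X * (D (\<lambda>k. \<Prod>j\<leftarrow>js. (\<theta> k - \<theta> j) / (\<theta> i - \<theta> j)) * Y)" for js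
  proof (induction js)
    case Nil
    then show ?case using D by (simp add: D_def)
  next
    case (Cons j js)
    then show ?case by (simp only: foldr.simps o_apply step) simp
  qed
  then have "primitive_idempotent d A \<theta> i
     = X * (D (\<lambda>k. \<Prod>j\<leftarrow>filter (\<lambda>j. j \<noteq> i) [0..<Suc d]. (\<theta> k - \<theta> j) / (\<theta> i - \<theta> j)) * Y)"
    unfolding primitive_idempotent_def by simp
  also have "D (\<lambda>k. \<Prod>j\<leftarrow>filter (\<lambda>j. j \<noteq> i) [0..<Suc d]. (\<theta> k - \<theta> j) / (\<theta> i - \<theta> j))
     = D (\<lambda>j. if j = i then 1 else 0)"
  proof (rule sq_eqI[where d = d])
    fix k l assume kl: "k \<le> d" "l \<le> d"
    have "(\<Prod>j\<leftarrow>filter (\<lambda>j. j \<noteq> i) [0..<Suc d]. (\<theta> l - \<theta> j) / (\<theta> i - \<theta> j)) = (if l = i then 1 else 0)"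
    proof (cases "l = i")
      case True
      have "(\<Prod>j\<leftarrow>js. (\<theta> i - \<theta> j) / (\<theta> i - \<theta> j)) = 1" if "\<forall>j \<in> set js. \<theta> j \<noteq> \<theta> i" for js
        using that by (induction js) auto
      moreover have "\<forall>j \<in> set (filter (\<lambda>j. j \<noteq> i) [0..<Suc d]). \<theta> j \<noteq> \<theta> i"
        using inj i by (auto simp: inj_on_def)
      ultimately show ?thesis using True by simp
    next
      case False
      then have "0 \<in> set (map (\<lambda>j. (\<theta> l - \<theta> j) / (\<theta> i - \<theta> j)) (filter (\<lambda>j. j \<noteq> i) [0..<Suc d]))"
        using kl by (auto simp: image_iff simp del: upt_Suc intro!: exI[of _ l])
      then show ?thesis using False unfolding prod_list_zero_iff[symmetric] by simp
    qed
    then show "D (\<lambda>k. \<Prod>j\<leftarrow>filter (\<lambda>j. j \<noteq> i) [0..<Suc d]. (\<theta> k - \<theta> j) / (\<theta> i - \<theta> j)) $$ (k, l)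
     = D (\<lambda>j. if j = i then 1 else 0) $$ (k, l)"
      using kl by (simp add: D_def mat_diag_index del: upt_Suc filter.simps)
  qed (simp_all add: D_def)
  finally show ?thesis by (simp add: proj_def D_def)
qed

lemma proj_index:
  assumes "X \<in> sq d" "Y \<in> sq d" "i \<le> d" "k \<le> d" "l \<le> d"
  shows "proj d X Y i $$ (k, l) = X $$ (k, i) * Y $$ (i, l)"
proof -
  have "proj d X Y i $$ (k, l) = (\<Sum>m\<le>d. X $$ (k, m) * ((if m = i then 1 else 0) * Y $$ (m, l)))"
    unfolding proj_def using assms
    by (subst mult_index[where d = d]) (simp_all add: diag_mult_index[where d = d] del: index_mult_mat)
  also have "\<dots> = (\<Sum>m\<le>d. if m = i then X $$ (k, i) * Y $$ (i, l) else 0)"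
    by (rule sum.cong) auto
  finally have "proj d X Y i $$ (k, l) = (\<Sum>m\<le>d. if m = i then X $$ (k, i) * Y $$ (i, l) else 0)" .
  then show ?thesis using assms by simp
qed

lemma proj_carrier [simp]: "X \<in> sq d \<Longrightarrow> Y \<in> sq d \<Longrightarrow> proj d X Y i \<in> sq d"
  by (simp add: proj_def)

text \<open>In the eigenbasis the two projections cut out the single entry (i, j). This turns the
  conditions on an idempotent sequence into conditions on matrix entries.\<close>

lemma proj_sandwich_eq_0_iff:
  assumes e: "eigdec d A \<theta> X Y" and M: "M \<in> sq d" and ij: "i \<le> d" "j \<le> d"
  shows "proj d X Y i * M * proj d X Y j = 0\<^sub>m (Suc d) (Suc d) \<longleftrightarrow> (Y * M * X) $$ (i, j) = 0"
proof -
  note D = eigdecD[OF e]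
  define U where "U i = mat_diag (Suc d) (\<lambda>j. if j = i then 1 else (0::'a))" for i
  have c: "U i \<in> sq d" for i by (simp add: U_def)
  let ?N = "U i * ((Y * M * X) * U j)"
  have P: "proj d X Y i * M * proj d X Y j = X * (?N * Y)"
    unfolding proj_def U_def[symmetric] using D(2,3) M c by (simp add: assoc_sq[where d = d])
  have N: "?N $$ (k, l) = (if k = i \<and> l = j then (Y * M * X) $$ (i, j) else 0)" if "k \<le> d" "l \<le> d" for k l
    using that D(2,3) M c ij unfolding U_def
    by (simp add: diag_mult_index[where d = d] del: index_mult_mat assoc_mult_mat)
  have cN: "?N \<in> sq d" using D(2,3) M c by simp
  have "X * (?N * Y) = 0\<^sub>m (Suc d) (Suc d) \<longleftrightarrow> ?N = 0\<^sub>m (Suc d) (Suc d)"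
  proof
    assume "X * (?N * Y) = 0\<^sub>m (Suc d) (Suc d)"
    then have "Y * (X * (?N * Y)) * X = 0\<^sub>m (Suc d) (Suc d)" using D(2,3) by simp
    moreover have "Y * (X * (?N * Y)) * X = ?N * (Y * X)"
      unfolding mult_cancel_left_inverse[OF D(3,2,5) sq_mult[OF cN D(3)]]
      by (rule assoc_sq[OF cN D(3,2)])
    ultimately show "?N = 0\<^sub>m (Suc d) (Suc d)" unfolding D(5) right_mult_one_mat[OF cN] by simp
  qed (use D(2,3) in simp)
  also have "\<dots> \<longleftrightarrow> (Y * M * X) $$ (i, j) = 0"
  proof
    assume "?N = 0\<^sub>m (Suc d) (Suc d)"
    then show "(Y * M * X) $$ (i, j) = 0" using N[OF ij] ij by (simp del: index_mult_mat)
  next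
    assume "(Y * M * X) $$ (i, j) = 0"
    then show "?N = 0\<^sub>m (Suc d) (Suc d)"
      by (intro sq_eqI[where d = d]) (use cN N in \<open>simp_all del: index_mult_mat assoc_mult_mat\<close>)
  qed
  finally show ?thesis unfolding P .
qed

lemma eigdec_permute:
  assumes e: "eigdec d A \<theta> X Y" and s: "bij_betw \<sigma> {0..d} {0..d}"
    and \<theta>': "\<And>i. i \<le> d \<Longrightarrow> \<theta>' i = \<theta> (\<sigma> i)"
    and X': "X' = mat (Suc d) (Suc d) (\<lambda>(i, j). X $$ (i, \<sigma> j))"
    and Y': "Y' = mat (Suc d) (Suc d) (\<lambda>(i, j). Y $$ (\<sigma> i, j))"
  shows "eigdec d A \<theta>' X' Y'"
    and "M \<in> sq d \<Longrightarrow> i \<le> d \<Longrightarrow> j \<le> d \<Longrightarrow> (Y' * M * X') $$ (i, j) = (Y * M * X) $$ (\<sigma> i, \<sigma> j)"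
proof -
  note D = eigdecD[OF e]
  have c: "X' \<in> sq d" "Y' \<in> sq d" by (simp_all add: X' Y')
  have s': "\<sigma> i \<le> d" if "i \<le> d" for i using bij_betwE[OF s] that by auto
  have YM: "(Y' * M) $$ (i, j) = (Y * M) $$ (\<sigma> i, j)" if "M \<in> sq d" "i \<le> d" "j \<le> d" for M i j
    using that D(3) c s' by (simp add: mult_index[where d = d] Y' del: index_mult_mat)
  have MX: "(M * X') $$ (i, j) = (M * X) $$ (i, \<sigma> j)" if "M \<in> sq d" "i \<le> d" "j \<le> d" for M i j
    using that D(2) c s' by (simp add: mult_index[where d = d] X' del: index_mult_mat)
  have "(Y' * (M * X')) $$ (i, j) = (Y * (M * X)) $$ (\<sigma> i, \<sigma> j)" if "M \<in> sq d" "i \<le> d" "j \<le> d" for M i j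
    using that D(3) c s' by (simp add: mult_index[where d = d and B = "M * X'"]
      mult_index[where d = d and B = "M * X"] D(2) MX Y' del: index_mult_mat(1))
  then show "M \<in> sq d \<Longrightarrow> i \<le> d \<Longrightarrow> j \<le> d \<Longrightarrow> (Y' * M * X') $$ (i, j) = (Y * M * X) $$ (\<sigma> i, \<sigma> j)"
    using D(2,3) c by (simp del: index_mult_mat(1))
  have inj: "\<sigma> i = \<sigma> j \<longleftrightarrow> i = j" if "i \<le> d" "j \<le> d" for i j
    using s that by (auto simp: bij_betw_def inj_on_def)
  have 1: "Y' * X' = 1\<^sub>m (Suc d)"
  proof (rule sq_eqI[where d = d])
    fix i j assume ij: "i \<le> d" "j \<le> d"
    then show "(Y' * X') $$ (i, j) = (1\<^sub>m (Suc d) :: 'a mat) $$ (i, j)"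
      using s' by (simp add: MX[OF c(2)] YM[OF D(2)] D(5) inj less_Suc_eq_le del: index_mult_mat(1))
  qed (use c in simp_all)
  have 2: "X' * Y' = 1\<^sub>m (Suc d)"
    by (rule mat_mult_left_right_inverse[OF c(2,1) 1])
  have 3: "A * X' = X' * mat_diag (Suc d) \<theta>'"
  proof (rule sq_eqI[where d = d])
    fix i j assume ij: "i \<le> d" "j \<le> d"
    have "(A * X') $$ (i, j) = X $$ (i, \<sigma> j) * \<theta> (\<sigma> j)"
      unfolding MX[OF D(1) ij] D(6) by (rule diag_mult_index(2)[OF D(2) ij(1) s'[OF ij(2)]])
    also have "\<dots> = X' $$ (i, j) * \<theta>' j" using ij by (simp add: X' \<theta>')
    finally show "(A * X') $$ (i, j) = (X' * mat_diag (Suc d) \<theta>') $$ (i, j)"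
      unfolding diag_mult_index(2)[OF c(1) ij] .
  qed (use c D in simp_all)
  show "eigdec d A \<theta>' X' Y'" using c D(1) 1 2 3 by (simp add: eigdec_def)
qed

section \<open>Irreducible tridiagonal shape and idempotent sequences\<close>

definition tri :: "nat \<Rightarrow> (nat \<Rightarrow> nat \<Rightarrow> 'a::zero) \<Rightarrow> bool" where
  "tri d b \<longleftrightarrow> (\<forall>i \<le> d. \<forall>j \<le> d. (Suc i < j \<or> Suc j < i \<longrightarrow> b i j = 0) \<and> (j = Suc i \<or> i = Suc j \<longrightarrow> b i j \<noteq> 0))"

lemma tri_iff_int: "tri d b \<longleftrightarrow> (\<forall>i \<in> {0..d}. \<forall>j \<in> {0..d}.
    (\<bar>int i - int j\<bar> > 1 \<longrightarrow> b i j = 0) \<and> (\<bar>int i - int j\<bar> = 1 \<longrightarrow> b i j \<noteq> 0))"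
proof -
  have "\<bar>int i - int j\<bar> > 1 \<longleftrightarrow> Suc i < j \<or> Suc j < i" "\<bar>int i - int j\<bar> = 1 \<longleftrightarrow> j = Suc i \<or> i = Suc j" for i j
    by auto
  then show ?thesis unfolding tri_def by auto
qed

lemma idempotents_for_eigdec:
  assumes e: "eigdec d A \<theta> X Y" and inj: "inj_on \<theta> {0..d}" and ext: "\<theta> \<in> extensional {0..d}"
  shows "idempotents_for d A \<theta> (\<lambda>i\<in>{0..d}. proj d X Y i)"
  unfolding idempotents_for_def eigenvalue_ordering_def
  using eigdec_eigenvalues[OF e] primitive_idempotent_eigdec[OF e inj] inj ext
  by (auto simp: bij_betw_def)

lemma idempotent_sequence_eigdec:
  assumes e: "eigdec d A \<theta> X Y" and inj: "inj_on \<theta> {0..d}" and ext: "\<theta> \<in> extensional {0..d}"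
    and M: "M \<in> sq d"
  shows "idempotent_sequence d A M (\<lambda>i\<in>{0..d}. proj d X Y i) \<longleftrightarrow> tri d (\<lambda>i j. (Y * M * X) $$ (i, j))"
  unfolding idempotent_sequence_def tri_iff_int
  using idempotents_for_eigdec[OF e inj ext] proj_sandwich_eq_0_iff[OF e M]
  by (auto simp del: index_mult_mat(1) assoc_mult_mat)

lemma multiplicity_free_eigdec:
  assumes e: "eigdec d A \<theta> X Y" and inj: "inj_on \<theta> {0..d}"
  shows "multiplicity_free d A"
  using eigdec_eigenvalues[OF e] eigdecD(1)[OF e] card_image[OF inj]
  by (simp add: multiplicity_free_def)

text \<open>An idempotent sequence may come with any ordering of the eigenvalues; since these are
  distinct, it is obtained from the fixed eigenbasis by permuting columns of \<open>X\<close> and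
  rows of \<open>Y\<close>.\<close>

lemma idempotents_for_permuted:
  assumes e: "eigdec d A \<theta> X Y" and inj: "inj_on \<theta> {0..d}" and f: "idempotents_for d A \<theta>' E"
  obtains \<sigma> X' Y' where "bij_betw \<sigma> {0..d} {0..d}" "eigdec d A \<theta>' X' Y'" "inj_on \<theta>' {0..d}"
    "E = (\<lambda>i\<in>{0..d}. proj d X' Y' i)"
    "\<And>M i j. M \<in> sq d \<Longrightarrow> i \<le> d \<Longrightarrow> j \<le> d \<Longrightarrow> (Y' * M * X') $$ (i, j) = (Y * M * X) $$ (\<sigma> i, \<sigma> j)"
proof -
  have \<theta>': "\<theta>' \<in> extensional {0..d}" "bij_betw \<theta>' {0..d} (\<theta> ` {0..d})"
    using f by (auto simp: idempotents_for_def eigenvalue_ordering_def eigdec_eigenvalues[OF e])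
  define \<sigma> where "\<sigma> i = inv_into {0..d} \<theta> (\<theta>' i)" for i
  have "bij_betw (inv_into {0..d} \<theta>) (\<theta> ` {0..d}) {0..d}"
    using inj by (simp add: inj_on_imp_bij_betw bij_betw_inv_into)
  from bij_betw_trans[OF \<theta>'(2) this] have b: "bij_betw \<sigma> {0..d} {0..d}"
    by (simp add: \<sigma>_def[abs_def] o_def)
  have t: "\<theta>' i = \<theta> (\<sigma> i)" if "i \<le> d" for i
  proof -
    have "\<theta>' i \<in> \<theta> ` {0..d}" using bij_betwE[OF \<theta>'(2)] that by simp
    then show ?thesis by (simp add: \<sigma>_def f_inv_into_f)
  qed
  define X' where "X' = mat (Suc d) (Suc d) (\<lambda>(i, j). X $$ (i, \<sigma> j))"
  define Y' where "Y' = mat (Suc d) (Suc d) (\<lambda>(i, j). Y $$ (\<sigma> i, j))"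
  have e': "eigdec d A \<theta>' X' Y'" by (rule eigdec_permute(1)[OF e b t X'_def Y'_def])
  have inj': "inj_on \<theta>' {0..d}" using \<theta>'(2) by (simp add: bij_betw_def)
  have "E = (\<lambda>i\<in>{0..d}. proj d X' Y' i)"
    using f primitive_idempotent_eigdec[OF e' inj']
    by (auto simp: idempotents_for_def fun_eq_iff extensional_def)
  from that[OF b e' inj' this eigdec_permute(2)[OF e b t X'_def Y'_def]] show ?thesis by blast
qed

lemma idempotent_sequence_permuted:
  assumes e: "eigdec d A \<theta> X Y" and inj: "inj_on \<theta> {0..d}" and M: "M \<in> sq d"
    and s: "idempotent_sequence d A M E"
  obtains \<sigma> where "bij_betw \<sigma> {0..d} {0..d}" "tri d (\<lambda>i j. (Y * M * X) $$ (\<sigma> i, \<sigma> j))"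
proof -
  from s obtain \<theta>' where f: "idempotents_for d A \<theta>' E" by (auto simp: idempotent_sequence_def)
  then have ext: "\<theta>' \<in> extensional {0..d}"
    by (auto simp: idempotents_for_def eigenvalue_ordering_def)
  from f obtain \<sigma> X' Y' where b: "bij_betw \<sigma> {0..d} {0..d}" and e': "eigdec d A \<theta>' X' Y'"
    and inj': "inj_on \<theta>' {0..d}" and E: "E = (\<lambda>i\<in>{0..d}. proj d X' Y' i)"
    and B: "\<And>M i j. M \<in> sq d \<Longrightarrow> i \<le> d \<Longrightarrow> j \<le> d \<Longrightarrow> (Y' * M * X') $$ (i, j) = (Y * M * X) $$ (\<sigma> i, \<sigma> j)"
    by (rule idempotents_for_permuted[OF e inj]) blast
  from s idempotent_sequence_eigdec[OF e' inj' ext M]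
  have "tri d (\<lambda>i j. (Y' * M * X') $$ (i, j))" unfolding E by simp
  then have "tri d (\<lambda>i j. (Y * M * X) $$ (\<sigma> i, \<sigma> j))"
    by (simp add: B[OF M] tri_def del: index_mult_mat(1) assoc_mult_mat)
  with b show ?thesis by (rule that)
qed

section \<open>Intertwiners of bidiagonal matrices\<close>

lemma low_eigdec:
  assumes inj: "inj_on \<theta> {0..d}"
  obtains X Y where "eigdec d (low d \<theta>) \<theta> X Y" "band d 0 X" "band d 0 Y"
    "\<And>i. i \<le> d \<Longrightarrow> X $$ (i, i) = 1" "\<And>i. i \<le> d \<Longrightarrow> Y $$ (i, i) = 1" "\<And>i. i \<le> d \<Longrightarrow> Y $$ (i, 0) \<noteq> 0"
proof -
  have ne: "\<theta> i \<noteq> \<theta> j" if "i \<le> d" "j \<le> d" "i \<noteq> j" for i j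
    using inj that by (auto simp: inj_on_def)
  \<comment> \<open>Right and left eigenvectors obtained by solving the two-term relation of the
    bidiagonal matrix from the diagonal entry 1 onwards.\<close>
  define X where "X = mat (Suc d) (Suc d) (\<lambda>(i, j). if i < j then 0 else \<Prod>h\<in>{j<..i}. 1 / (\<theta> j - \<theta> h))"
  define Y where "Y = mat (Suc d) (Suc d) (\<lambda>(i, j). if i < j then 0 else \<Prod>h\<in>{j..<i}. 1 / (\<theta> i - \<theta> h))"
  have c: "X \<in> sq d" "Y \<in> sq d" by (simp_all add: X_def Y_def)
  have b: "band d 0 X" "band d 0 Y" by (auto simp: X_def Y_def band_def)
  have x1: "X $$ (i, i) = 1" and y1: "Y $$ (i, i) = 1" if "i \<le> d" for i
    using that by (simp_all add: X_def Y_def)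
  have y0: "Y $$ (i, 0) \<noteq> 0" if "i \<le> d" for i
    using that ne by (auto simp: Y_def)
  have 1: "low d \<theta> * X = X * mat_diag (Suc d) \<theta>"
  proof (rule sq_eqI[where d = d])
    fix i j assume ij: "i \<le> d" "j \<le> d"
    have "\<theta> i * X $$ (i, j) + (if i = 0 then 0 else X $$ (i - 1, j)) = X $$ (i, j) * \<theta> j"
    proof (cases "j < i")
      case True
      then obtain k where k: "i = Suc k" "j \<le> k" by (metis less_Suc_eq_le not0_implies_Suc not_less0)
      have "{j<..Suc k} = insert (Suc k) {j<..k}" using k by auto
      then have "X $$ (i, j) = 1 / (\<theta> j - \<theta> i) * X $$ (k, j)"
        using ij k by (simp add: X_def)
      moreover have "\<theta> j \<noteq> \<theta> i" using ne ij True by simp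
      ultimately show ?thesis using k by (simp add: field_simps)
    next
      case False
      then show ?thesis using ij by (cases "i = j") (auto simp: X_def)
    qed
    then show "(low d \<theta> * X) $$ (i, j) = (X * mat_diag (Suc d) \<theta>) $$ (i, j)"
      using ij c by (simp add: low_mult diag_mult_index[where d = d] del: index_mult_mat)
  qed (use c in simp_all)
  have 2: "Y * low d \<theta> = mat_diag (Suc d) \<theta> * Y"
  proof (rule sq_eqI[where d = d])
    fix i j assume ij: "i \<le> d" "j \<le> d"
    have "Y $$ (i, j) * \<theta> j + (if j < d then Y $$ (i, Suc j) else 0) = \<theta> i * Y $$ (i, j)"
    proof (cases "j < i")
      case True
      then have "{j..<i} = insert j {Suc j..<i}" by auto
      then have "Y $$ (i, j) = 1 / (\<theta> i - \<theta> j) * Y $$ (i, Suc j)"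
        using ij True by (simp add: Y_def)
      moreover have "\<theta> j \<noteq> \<theta> i" using ne ij True by simp
      ultimately show ?thesis using ij True by (simp add: field_simps)
    next
      case False
      then show ?thesis using ij by (cases "i = j") (auto simp: Y_def)
    qed
    then show "(Y * low d \<theta>) $$ (i, j) = (mat_diag (Suc d) \<theta> * Y) $$ (i, j)"
      using ij c by (simp add: mult_low diag_mult_index[where d = d] del: index_mult_mat)
  qed (use c in simp_all)
  \<comment> \<open>\<open>Y * X\<close> commutes with a diagonal matrix having distinct entries, so
    it is diagonal, and its factors are unit triangular. This replaces a direct evaluation of sums
    of products of fractions.\<close>
  have 3: "mat_diag (Suc d) \<theta> * (Y * X) = (Y * X) * mat_diag (Suc d) \<theta>"
    using assoc_sq[OF mat_diag_dim c(2,1), of \<theta>] assoc_sq[OF c(2) low_carrier c(1), of \<theta>]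
      assoc_sq[OF c(2,1) mat_diag_dim, of \<theta>] 1 2 by simp
  have 4: "Y * X = 1\<^sub>m (Suc d)"
  proof (rule sq_eqI[where d = d])
    fix i j assume ij: "i \<le> d" "j \<le> d"
    show "(Y * X) $$ (i, j) = (1\<^sub>m (Suc d) :: 'a mat) $$ (i, j)"
    proof (cases "i = j")
      case True
      with band_mult(2)[OF c(2,1) b(2,1), of i] ij x1 y1 show ?thesis
        by (simp del: index_mult_mat(1))
    next
      case False
      have "\<theta> i * (Y * X) $$ (i, j) = (Y * X) $$ (i, j) * \<theta> j"
        using 3 diag_mult_index[OF sq_mult[OF c(2,1)] ij, of \<theta>] by metis
      then show ?thesis using ne[OF ij False] False ij by (auto simp del: index_mult_mat(1))
    qed
  qed (use c in simp_all)
  have 5: "X * Y = 1\<^sub>m (Suc d)" by (rule mat_mult_left_right_inverse[OF c(2,1) 4])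
  have "eigdec d (low d \<theta>) \<theta> X Y" using c 1 4 5 by (simp add: eigdec_def)
  then show ?thesis using b x1 y1 y0 by (rule that)
qed

text \<open>A left eigenvector is its first entry times the values of the Newton polynomials with
  nodes \<open>\<theta> 0\<close>, \<open>\<theta> 1\<close>, ... at the eigenvalue. In particular a
  nonzero row has a nonzero first entry.\<close>

lemma eigdec_low_row:
  assumes e: "eigdec d (low d \<theta>) \<theta>' X Y" and ij: "i \<le> d" "j < d"
  shows "Y $$ (i, Suc j) = (\<theta>' i - \<theta> j) * Y $$ (i, j)"
proof -
  note D = eigdecD[OF e]
  have j: "j \<le> d" using ij by simp
  have "Y $$ (i, j) * \<theta> j + Y $$ (i, Suc j) = \<theta>' i * Y $$ (i, j)"
    using D(7) mult_low[OF D(3) ij(1) j, of \<theta>] diag_mult_index(1)[OF D(3) ij(1) j, of \<theta>'] ij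
    by (simp del: index_mult_mat)
  then show ?thesis by (simp add: algebra_simps)
qed

text \<open>The unit subdiagonal sends each basis vector to the next one plus a multiple of itself,
  so an intertwiner is generated from its first column.\<close>

lemma low_intertwine_columns:
  assumes M: "M \<in> sq d" "L \<in> sq d" and g: "L * M = M * low d \<theta>'"
    and ij: "i \<le> d" "j < d"
  shows "M $$ (i, Suc j) = (L * M) $$ (i, j) - \<theta>' j * M $$ (i, j)"
  using mult_low[OF M(1) ij(1), of j \<theta>'] g ij by (simp add: algebra_simps)

lemma low_intertwine_zero:
  assumes M: "M \<in> sq d" "L \<in> sq d" and g: "L * M = M * low d \<theta>'"
    and z: "\<And>i. i \<le> d \<Longrightarrow> M $$ (i, 0) = 0"
  shows "M = 0\<^sub>m (Suc d) (Suc d)"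
proof (rule sq_eqI[where d = d])
  have "\<forall>i \<le> d. M $$ (i, j) = 0" if "j \<le> d" for j using that
  proof (induction j)
    case 0 then show ?case using z by simp
  next
    case (Suc j)
    then have "\<forall>i \<le> d. (L * M) $$ (i, j) = 0" using M by (auto simp: mult_index[where d = d] simp del: index_mult_mat)
    then show ?case using Suc low_intertwine_columns[OF M g] by simp
  qed
  then show "M $$ (i, j) = (0\<^sub>m (Suc d) (Suc d)) $$ (i, j)" if "i \<le> d" "j \<le> d" for i j
    using that by simp
qed (use M in simp_all)

text \<open>Generating the columns from the first basis vector, each application of
  \<open>low d \<theta>\<close> reaches one row further down, with coefficient 1.\<close>

lemma low_intertwine_triangular:
  assumes M: "M \<in> sq d" and g: "low d \<theta> * M = M * low d \<theta>'"
    and z: "\<And>i. i \<le> d \<Longrightarrow> M $$ (i, 0) = (if i = 0 then 1 else 0)"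
    and ij: "i \<le> d" "j \<le> i"
  shows "M $$ (i, j) = (if i = j then 1 else 0)"
  using ij
proof (induction j arbitrary: i)
  case 0 then show ?case using z by simp
next
  case (Suc j)
  then have "i - 1 \<le> d" "j \<le> i - 1" "i \<noteq> 0" "i \<noteq> j" "j < d" by auto
  then show ?case
    using Suc.IH[of i] Suc.IH[of "i - 1"] Suc.prems low_intertwine_columns[OF M low_carrier g, of i j]
      low_mult[OF M Suc.prems(1), of j \<theta>] by auto
qed

text \<open>The two matrices have the same eigenvalues in opposite orders, so matching eigenvectors
  yields intertwiners with one free scalar per eigenvalue. For an intertwined pair \<open>U\<close>,
  \<open>U'\<close> the matrices in the two eigenbases agree up to reversal of indices and nonzero
  diagonal scaling, hence have corresponding zero patterns.\<close>

lemma eigdec_intertwiner: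
  assumes e: "eigdec d L \<theta> X Y" and e': "eigdec d L' (\<lambda>i. \<theta> (d - i)) X' Y'"
    and y: "\<And>i. i \<le> d \<Longrightarrow> Y $$ (i, 0) \<noteq> 0" and y': "\<And>i. i \<le> d \<Longrightarrow> Y' $$ (i, 0) \<noteq> 0"
  obtains G H where "G \<in> sq d" "H \<in> sq d" "G * H = 1\<^sub>m (Suc d)" "H * G = 1\<^sub>m (Suc d)"
    "L * G = G * L'" "\<And>i. i \<le> d \<Longrightarrow> G $$ (i, 0) = (if i = 0 then 1 else 0)"
    "\<And>U U' i j. U \<in> sq d \<Longrightarrow> U' \<in> sq d \<Longrightarrow> U * G = G * U' \<Longrightarrow> i \<le> d \<Longrightarrow> j \<le> d \<Longrightarrow>
       (Y * U * X) $$ (i, j) = 0 \<longleftrightarrow> (Y' * U' * X') $$ (d - i, d - j) = 0"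
proof -
  define Xr where "Xr = mat (Suc d) (Suc d) (\<lambda>(i, j). X' $$ (i, d - j))"
  define Yr where "Yr = mat (Suc d) (Suc d) (\<lambda>(i, j). Y' $$ (d - i, j))"
  have rev: "bij_betw (\<lambda>i. d - i) {0..d} {0..d}"
    by (rule bij_betwI[where g = "\<lambda>i. d - i"]) auto
  have t: "\<theta> i = \<theta> (d - (d - i))" if "i \<le> d" for i using that by simp
  have er: "eigdec d L' \<theta> Xr Yr" by (rule eigdec_permute(1)[OF e' rev t Xr_def Yr_def])
  have B: "(Yr * M * Xr) $$ (i, j) = (Y' * M * X') $$ (d - i, d - j)" if "M \<in> sq d" "i \<le> d" "j \<le> d" for M i j
    by (rule eigdec_permute(2)[OF e' rev t Xr_def Yr_def]) (use that in simp_all)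
  note D = eigdecD[OF e] note R = eigdecD[OF er]
  have yr: "Yr $$ (i, 0) \<noteq> 0" if "i \<le> d" for i using y' that by (simp add: Yr_def)
  \<comment> \<open>The diagonal factor is chosen so that \<open>G\<close> fixes the first basis vector.\<close>
  define \<delta> where "\<delta> i = Y $$ (i, 0) / Yr $$ (i, 0)" for i
  have \<delta>: "\<delta> i \<noteq> 0" if "i \<le> d" for i using y[OF that] yr[OF that] by (simp add: \<delta>_def)
  define Dl where "Dl = mat_diag (Suc d) \<delta>"
  define Di where "Di = mat_diag (Suc d) (\<lambda>i. 1 / \<delta> i)"
  have c: "Dl \<in> sq d" "Di \<in> sq d" by (simp_all add: Dl_def Di_def)
  have DD: "Dl * Di = 1\<^sub>m (Suc d)" "Di * Dl = 1\<^sub>m (Suc d)"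
    by (rule sq_eqI[where d = d]; simp add: Dl_def Di_def mat_diag_index \<delta> less_Suc_eq_le)+
  define G where "G = X * (Dl * Yr)"
  define H where "H = Xr * (Di * Y)"
  have cGH: "G \<in> sq d" "H \<in> sq d" using D(2,3) R(2,3) c by (simp_all add: G_def H_def)
  note mc = mult_cancel_left_inverse
  have GH: "G * H = 1\<^sub>m (Suc d)"
    using D(2-4) R(2,3) c unfolding G_def H_def
    by (simp add: assoc_sq[where d = d] mc[OF R(3,2,5)] mc[OF c(1,2) DD(1)])
  have HG: "H * G = 1\<^sub>m (Suc d)" by (rule mat_mult_left_right_inverse[OF cGH GH])
  have LG: "L * G = G * L'"
  proof -
    let ?T = "mat_diag (Suc d) \<theta>"
    have "L * G = (L * X) * (Dl * Yr)" unfolding G_def using D(1,2) R(3) c by (simp add: assoc_sq[where d = d])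
    also have "\<dots> = X * ((?T * Dl) * Yr)" unfolding D(6) using D(2) R(3) c by (simp add: assoc_sq[where d = d])
    also have "?T * Dl = Dl * ?T" by (simp add: Dl_def mult.commute)
    also have "X * ((Dl * ?T) * Yr) = X * (Dl * (Yr * L'))"
      unfolding R(7) using D(2) R(3) c by (simp add: assoc_sq[where d = d])
    also have "\<dots> = G * L'" unfolding G_def using D(2) R(1,3) c by (simp add: assoc_sq[where d = d])
    finally show ?thesis .
  qed
  have G0: "G $$ (i, 0) = (if i = 0 then 1 else 0)" if "i \<le> d" for i
  proof -
    have "G $$ (i, 0) = (\<Sum>k\<le>d. X $$ (i, k) * (\<delta> k * Yr $$ (k, 0)))"
      unfolding G_def Dl_def using that D(2) R(3)
      by (subst mult_index[where d = d]) (simp_all add: diag_mult_index[where d = d] del: index_mult_mat)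
    also have "\<dots> = (\<Sum>k\<le>d. X $$ (i, k) * Y $$ (k, 0))"
      using yr by (intro sum.cong) (simp_all add: \<delta>_def)
    also have "\<dots> = (X * Y) $$ (i, 0)" using that D(2,3) by (simp add: mult_index[where d = d] del: index_mult_mat)
    finally show ?thesis using that unfolding D(4) by simp
  qed
  have tr: "(Y * U * X) $$ (i, j) = 0 \<longleftrightarrow> (Y' * U' * X') $$ (d - i, d - j) = 0"
    if U: "U \<in> sq d" "U' \<in> sq d" "U * G = G * U'" and ij: "i \<le> d" "j \<le> d" for U U' i j
  proof -
    have "(Y * U * X) * Dl = Y * (U * (X * (Dl * (Yr * Xr))))"
      using D(2,3) R(2,3) c U(1,2) by (simp add: assoc_sq[where d = d] R(5))
    also have "\<dots> = Y * ((U * G) * Xr)"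
      unfolding G_def using D(2,3) R(2,3) c U(1,2) by (simp add: assoc_sq[where d = d])
    also have "\<dots> = (Y * X) * (Dl * (Yr * U' * Xr))"
      unfolding U(3) unfolding G_def using D(2,3) R(2,3) c U(1,2) by (simp add: assoc_sq[where d = d])
    also have "\<dots> = Dl * (Yr * U' * Xr)"
      unfolding D(5) by (rule left_mult_one_mat[where nc = "Suc d"]) (use R(2,3) c U(2) in simp)
    finally have "((Y * U * X) * Dl) $$ (i, j) = (Dl * (Yr * U' * Xr)) $$ (i, j)" by simp
    then have "(Y * U * X) $$ (i, j) * \<delta> j = \<delta> i * (Yr * U' * Xr) $$ (i, j)"
      unfolding Dl_def using D(2,3) R(2,3) U(1,2) ij
      by (simp add: diag_mult_index[where d = d] del: index_mult_mat assoc_mult_mat)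
    then show ?thesis using \<delta>[OF ij(1)] \<delta>[OF ij(2)] unfolding B[OF U(2) ij]
      by (metis mult_eq_0_iff)
  qed
  show ?thesis by (rule that[OF cGH GH HG LG G0 tr])
qed

section \<open>From split sequences to tridiagonal shape\<close>

lemma eigdec_low_triangular:
  assumes e: "eigdec d (low d \<theta>) \<theta> X Y" and inj: "inj_on \<theta> {0..d}"
  shows "band d 0 X" "band d 0 Y" "i \<le> d \<Longrightarrow> X $$ (i, i) * Y $$ (i, i) = 1"
proof -
  note D = eigdecD[OF e]
  have ne: "\<theta> i \<noteq> \<theta> j" if "i \<le> d" "j \<le> d" "i \<noteq> j" for i j
    using inj that by (auto simp: inj_on_def)
  have "X $$ (i, j) = 0" if "i < j" "j \<le> d" for i j using that
  proof (induction i)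
    case 0
    then have "\<theta> 0 * X $$ (0, j) = X $$ (0, j) * \<theta> j"
      using D(6) low_mult[OF D(2), of 0 j \<theta>] diag_mult_index(2)[OF D(2), of 0 j \<theta>] by (auto simp del: index_mult_mat)
    then show ?case using ne[of 0 j] 0 by auto
  next
    case (Suc i)
    then have "\<theta> (Suc i) * X $$ (Suc i, j) = X $$ (Suc i, j) * \<theta> j"
      using D(6) low_mult[OF D(2), of "Suc i" j \<theta>] diag_mult_index(2)[OF D(2), of "Suc i" j \<theta>]
      by (auto simp del: index_mult_mat)
    then show ?case using ne[of "Suc i" j] Suc by auto
  qed
  then show b: "band d 0 X" by (simp add: band_def)
  have "Y $$ (i, Suc (i + k)) = 0" if "Suc (i + k) \<le> d" for i k using that
    by (induction k) (simp_all add: eigdec_low_row[OF e])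
  then show b': "band d 0 Y" by (auto simp: band_def dest!: less_imp_Suc_add)
  assume "i \<le> d"
  then show "X $$ (i, i) * Y $$ (i, i) = 1"
    using band_mult(2)[OF D(2,3) b b', of i] D(4) by (simp del: index_mult_mat(1))
qed

text \<open>Both eigenvector matrices are lower triangular, so the bandwidth of the upper bidiagonal
  factor survives, and each superdiagonal entry is multiplied by two nonzero diagonal
  entries.\<close>

lemma low_upp_hessenberg:
  assumes e: "eigdec d (low d \<theta>) \<theta> X Y" and inj: "inj_on \<theta> {0..d}"
  shows "i \<le> d \<Longrightarrow> j \<le> d \<Longrightarrow> Suc i < j \<Longrightarrow> (Y * upp d \<theta>s f * X) $$ (i, j) = 0"
    and "i < d \<Longrightarrow> (Y * upp d \<theta>s f * X) $$ (i, Suc i) = 0 \<longleftrightarrow> f (Suc i) = 0"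
proof -
  note D = eigdecD[OF e] note T = eigdec_low_triangular[OF e inj]
  have b: "band d 1 (upp d \<theta>s f)" by (simp add: band_def upp_index)
  note m1 = band_mult[OF D(3) upp_carrier T(2) b]
  have c: "Y * upp d \<theta>s f \<in> sq d" using D(3) by simp
  note m2 = band_mult[OF c D(2) m1(1) T(1)]
  show "i \<le> d \<Longrightarrow> j \<le> d \<Longrightarrow> Suc i < j \<Longrightarrow> (Y * upp d \<theta>s f * X) $$ (i, j) = 0"
    using m2(1) by (simp add: band_def del: index_mult_mat assoc_mult_mat)
  assume i: "i < d"
  have "Y $$ (i, i) \<noteq> 0" "X $$ (Suc i, Suc i) \<noteq> 0" using T(3)[of i] T(3)[of "Suc i"] i by auto
  then show "(Y * upp d \<theta>s f * X) $$ (i, Suc i) = 0 \<longleftrightarrow> f (Suc i) = 0"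
    using m2(2)[of i] m1(2)[of i] i by (simp add: upp_index del: index_mult_mat(1) assoc_mult_mat)
qed

text \<open>Here \<open>f\<close> and \<open>g\<close> are the two split sequences, extended by zero to the indices \<open>0\<close> and
  \<open>d + 1\<close>. The data are invariant under exchanging \<open>\<theta>\<close> and \<open>\<theta>s\<close> and reversing \<open>g\<close>.\<close>

definition aw_pair :: "nat \<Rightarrow> 'a::field \<Rightarrow> 'a \<Rightarrow> 'a \<Rightarrow> 'a \<Rightarrow> (nat \<Rightarrow> 'a) \<Rightarrow> (nat \<Rightarrow> 'a) \<Rightarrow>
    (nat \<Rightarrow> 'a) \<Rightarrow> (nat \<Rightarrow> 'a) \<Rightarrow> bool" where
  "aw_pair d \<beta> \<gamma> \<gamma>s \<omega> \<theta> \<theta>s f g \<longleftrightarrow>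
     inj_on \<theta> {0..d} \<and> inj_on \<theta>s {0..d} \<and> three_term d \<beta> \<gamma> \<theta> \<and> three_term d \<beta> \<gamma>s \<theta>s \<and>
     (\<forall>i < d. aw_sub \<beta> \<gamma> \<gamma>s \<theta> \<theta>s f i = \<omega>) \<and>
     (\<forall>i < d. aw_sub \<beta> \<gamma> \<gamma>s (\<lambda>i. \<theta> (d - i)) \<theta>s g i = \<omega>) \<and>
     f 0 = 0 \<and> f (Suc d) = 0 \<and> g 0 = 0 \<and> g (Suc d) = 0 \<and>
     (\<forall>i \<in> {1..d}. f i \<noteq> 0 \<and> g i \<noteq> 0) \<and>
     f 1 = g 1 + (\<theta>s 1 - \<theta>s 0) * (\<theta> 0 - \<theta> d) \<and>
     f 1 = g d + (\<theta> 1 - \<theta> 0) * (\<theta>s 0 - \<theta>s d)"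

lemma inj_on_reverse: "inj_on \<theta> {0..d} \<Longrightarrow> inj_on (\<lambda>i. \<theta> (d - i)) {0..d::nat}"
  unfolding inj_on_def by (metis atLeastAtMost_iff diff_diff_cancel diff_le_self zero_le)

text \<open>After swapping \<theta> and \<theta>s, the second pair is the total reversal of the
  original second pair. That is why \<open>f\<close> stays and \<open>g\<close> is read backwards,
  from \<open>Suc d\<close> down to 0.\<close>

lemma aw_pair_dual:
  assumes "aw_pair d \<beta> \<gamma> \<gamma>s \<omega> \<theta> \<theta>s f g"
  shows "aw_pair d \<beta> \<gamma>s \<gamma> \<omega> \<theta>s \<theta> f (\<lambda>i. g (Suc d - i))"
proof -
  note A = assms[unfolded aw_pair_def]
  have "aw_sub \<beta> \<gamma>s \<gamma> (\<lambda>i. \<theta>s (d - i)) \<theta> (\<lambda>i. g (Suc d - i)) i = \<omega>" if i: "i < d" for i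
  proof -
    have "aw_sub \<beta> \<gamma>s \<gamma> (\<lambda>i. \<theta>s (d - i)) \<theta> (\<lambda>i. g (Suc d - i)) i
       = aw_sub \<beta> \<gamma> \<gamma>s (\<lambda>i. \<theta> (d - (d - i))) (\<lambda>i. \<theta>s (d - i)) (\<lambda>i. g (Suc d - i)) i"
      unfolding aw_sub_swap[of \<beta> \<gamma>s \<gamma> "\<lambda>i. \<theta>s (d - i)"] using i by (simp add: aw_sub_def)
    also have "\<dots> = aw_sub \<beta> \<gamma> \<gamma>s (\<lambda>i. \<theta> (d - i)) \<theta>s g (d - Suc i)"
      by (rule aw_sub_reverse[OF i, where \<theta> = "\<lambda>i. \<theta> (d - i)"])
    also have "\<dots> = \<omega>" using A i by simp
    finally show ?thesis .
  qed
  moreover have "f 1 = g 1 + (\<theta>s 1 - \<theta>s 0) * (\<theta> 0 - \<theta> d)" using A by blast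
  then have "f 1 = g (Suc d - d) + (\<theta>s 1 - \<theta>s 0) * (\<theta> 0 - \<theta> d)" by simp
  moreover have "g (Suc d - i) \<noteq> 0" if "i \<in> {1..d}" for i
  proof -
    have "Suc d - i \<in> {1..d}" using that by auto
    then show ?thesis using A by blast
  qed
  ultimately show ?thesis using A unfolding aw_pair_def by (simp add: aw_sub_swap)
qed

text \<open>The two Askey-Wilson relations have the same polynomial on the right, and
  \<open>G\<close> intertwines its two values. They cancel in the relation for the defect
  \<open>T\<close>, which is thus homogeneous and recursive in the columns of
  \<open>T\<close>.\<close>

lemma aw_pair_intertwine:
  fixes d :: nat and \<theta> \<theta>s f g :: "nat \<Rightarrow> 'a::field"
  assumes aw: "aw_pair d \<beta> \<gamma> \<gamma>s \<omega> \<theta> \<theta>s f g" and d: "d > 0"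
    and G: "G \<in> sq d" "low d \<theta> * G = G * low d (\<lambda>i. \<theta> (d - i))"
      "\<And>i. i \<le> d \<Longrightarrow> G $$ (i, 0) = (if i = 0 then 1 else 0)"
  shows "upp d \<theta>s f * G = G * upp d \<theta>s g"
proof -
  note A = aw[unfolded aw_pair_def]
  let ?r = "\<lambda>i. \<theta> (d - i)" and ?U = "upp d \<theta>s f" and ?U' = "upp d \<theta>s g"
  let ?L = "low d \<theta>" and ?L' = "low d (\<lambda>i. \<theta> (d - i))"
  \<comment> \<open>Chosen so that the first two eigenvalues satisfy the root condition; the
    recurrence propagates it.\<close>
  define \<rho> where "\<rho> = \<theta> 0 ^ 2 - \<beta> * \<theta> 0 * \<theta> 1 + \<theta> 1 ^ 2 - \<gamma> * (\<theta> 0 + \<theta> 1)"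
  have t: "three_term d \<beta> \<gamma> \<theta>" "three_term d \<beta> \<gamma>s \<theta>s" using A by auto
  note tr = three_term_reverse[OF t(1)]
  have f: "f 0 = 0" "f (Suc d) = 0" and g: "g 0 = 0" "g (Suc d) = 0" using A by auto
  have sf: "aw_sub \<beta> \<gamma> \<gamma>s \<theta> \<theta>s f i = \<omega>" and sg: "aw_sub \<beta> \<gamma> \<gamma>s ?r \<theta>s g i = \<omega>" if "i < d" for i
    using A that by auto
  have r0: "aw_root \<beta> \<gamma> \<rho> (\<theta> 0) (\<theta> 1) = 0" by (simp add: \<rho>_def aw_root_def)
  have r: "aw_root \<beta> \<gamma> \<rho> (\<theta> i) (\<theta> (Suc i)) = 0" if "i < d" for i
    using aw_root_consecutive[OF t(1) r0 that] .
  have rr: "aw_root \<beta> \<gamma> \<rho> (?r i) (?r (Suc i)) = 0" if "i < d" for i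
    using r[of "d - Suc i"] that Suc_diff_Suc[OF that] by (simp add: aw_root_commute)
  define \<eta> where "\<eta> = aw_diag \<beta> \<gamma> \<rho> \<theta> \<theta>s f 0 - \<gamma>s * \<theta> 0 ^ 2 - \<omega> * \<theta> 0"
  define \<eta>' where "\<eta>' = aw_diag \<beta> \<gamma> \<rho> ?r \<theta>s g 0 - \<gamma>s * \<theta> d ^ 2 - \<omega> * \<theta> d"
  have Df: "aw_diag \<beta> \<gamma> \<rho> \<theta> \<theta>s f i = \<gamma>s * \<theta> i ^ 2 + \<omega> * \<theta> i + \<eta>" if "i \<le> d" for i
    by (rule aw_diag_const[OF t(1) r0 f sf that]) (simp_all add: \<eta>_def)
  have Dg: "aw_diag \<beta> \<gamma> \<rho> ?r \<theta>s g i = \<gamma>s * ?r i ^ 2 + \<omega> * ?r i + \<eta>'" if "i \<le> d" for i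
    by (rule aw_diag_const[OF tr _ g sg that]) (use rr[OF d] in \<open>simp_all add: \<eta>'_def\<close>)
  have "aw_diag \<beta> \<gamma> \<rho> ?r \<theta>s g d = aw_diag \<beta> \<gamma> \<rho> \<theta> \<theta>s f 0"
  proof (rule aw_diag_reverse_last[where \<theta> = \<theta> and f = f and g = g, OF d r0 f(1) g(2)])
    have "f 1 = g d + (\<theta> 1 - \<theta> 0) * (\<theta>s 0 - \<theta>s d)" using A by blast
    then show "f 1 - g d = (\<theta>s d - \<theta>s 0) * (\<theta> 0 - \<theta> 1)" by (simp add: algebra_simps)
  qed
  with Df[of 0] Dg[of d] have \<eta>: "\<eta>' = \<eta>" by simp
  have W: "aw2 \<beta> \<gamma> \<rho> ?L ?L ?U = poly2 d \<gamma>s \<omega> \<eta> ?L"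
    by (rule aw2_low_upp[OF f t(2) r sf Df])
  have W': "aw2 \<beta> \<gamma> \<rho> ?L' ?L' ?U' = poly2 d \<gamma>s \<omega> \<eta> ?L'"
    by (rule aw2_low_upp[OF g t(2) rr sg Dg[unfolded \<eta>]])
  define T where "T = ?U * G - G * ?U'"
  have cT: "T \<in> sq d" using G by (simp add: T_def)
  have "aw2 \<beta> \<gamma> \<rho> ?L ?L' T = aw2 \<beta> \<gamma> \<rho> ?L ?L ?U * G - G * aw2 \<beta> \<gamma> \<rho> ?L' ?L' ?U'"
    unfolding T_def using G
    by (simp add: aw2_minus[where d = d] aw2_mult_right[where d = d, OF low_carrier low_carrier low_carrier upp_carrier G(1,2)]
      aw2_mult_left[where d = d, OF low_carrier low_carrier low_carrier upp_carrier G(1) G(2)[symmetric]])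
  also have "\<dots> = 0\<^sub>m (Suc d) (Suc d)"
    unfolding W W' poly2_intertwine[OF low_carrier low_carrier G(1,2)]
    by (rule minus_r_inv_mat) (use G in simp)
  finally have T0: "aw2 \<beta> \<gamma> \<rho> ?L ?L' T = 0\<^sub>m (Suc d) (Suc d)" .
  have Gc1: "G $$ (i, Suc 0) = (if i = 0 then \<theta> 0 - \<theta> d else if i = 1 then 1 else 0)" if "i \<le> d" for i
    using low_intertwine_columns[OF G(1) low_carrier G(2) that d] low_mult[OF G(1) that, of 0 \<theta>] that G(3)
    by (auto simp: simp del: index_mult_mat)
  have Ti: "T $$ (i, j) = (\<theta>s i * G $$ (i, j) + (if i < d then f (Suc i) * G $$ (Suc i, j) else 0))
      - (G $$ (i, j) * \<theta>s j + (if j = 0 then 0 else G $$ (i, j - 1) * g j))" if "i \<le> d" "j \<le> d" for i j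
    using that G(1) carrier_matD[OF sq_mult[OF G(1) upp_carrier]] unfolding T_def
    by (simp add: upp_mult mult_upp del: index_mult_mat)
  have a: "f (Suc 0) = g (Suc 0) + (\<theta>s 1 - \<theta>s 0) * (\<theta> 0 - \<theta> d)" using A by simp
  \<comment> \<open>Both upper bidiagonal matrices multiply the first basis vector by
    \<open>\<theta>s 0\<close>, and \<open>G\<close> fixes it.\<close>
  have col0: "T $$ (i, 0) = 0" if "i \<le> d" for i using that by (simp add: Ti G(3))
  have col1: "T $$ (i, Suc 0) = 0" if "i \<le> d" for i
    using that d by (auto simp: Ti G(3) Gc1 a algebra_simps)
  \<comment> \<open>When columns j and j + 1 of \<open>T\<close> vanish, the only part of the
    relation left in column j comes from \<open>T * ?L' * ?L'\<close>, and it equals column j + 2 of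
    \<open>T\<close>.\<close>
  have "\<forall>i \<le> d. T $$ (i, j) = 0 \<and> (Suc j \<le> d \<longrightarrow> T $$ (i, Suc j) = 0)" if "j \<le> d" for j using that
  proof (induction j)
    case 0 then show ?case using col0 col1 by simp
  next
    case (Suc j)
    show ?case
    proof (cases "Suc (Suc j) \<le> d")
      case True
      have z: "T $$ (i, j) = 0" "T $$ (i, Suc j) = 0" if "i \<le> d" for i using Suc that by auto
      have cTL: "T * ?L' \<in> sq d" "?L * T \<in> sq d" using cT by simp_all
      have z1: "(T * ?L') $$ (i, j) = 0" if "i \<le> d" for i
        using that True cT z by (simp add: mult_low del: index_mult_mat)
      have z2: "(?L * T) $$ (i, j) = 0" if "i \<le> d" for i
        using that True cT z by (simp add: low_mult del: index_mult_mat)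
      have "T $$ (i, Suc (Suc j)) = 0" if i: "i \<le> d" for i
      proof -
        have "0 = aw2 \<beta> \<gamma> \<rho> ?L ?L' T $$ (i, j)" unfolding T0 using i True by simp
        also have "\<dots> = (T * ?L') $$ (i, Suc j)"
          using i True cT cTL z z1 z2
          by (simp add: aw2_index[where d = d] low_mult[where M = "T * ?L'"] low_mult[where M = "?L * T"]
             mult_low[where M = "T * ?L'"] del: index_mult_mat)
        also have "\<dots> = T $$ (i, Suc (Suc j))"
          using i True cT z by (simp add: mult_low del: index_mult_mat)
        finally show ?thesis by simp
      qed
      then show ?thesis using Suc by simp
    next
      case False
      then show ?thesis using Suc by simp
    qed
  qed
  then have "T $$ (i, j) = 0" if "i \<le> d" "j \<le> d" for i j using that by blast
  then have "(?U * G) $$ (i, j) = (G * ?U') $$ (i, j)" if "i \<le> d" "j \<le> d" for i j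
    using that carrier_matD[OF sq_mult[OF G(1) upp_carrier, of \<theta>s g]] unfolding T_def
    by (simp del: index_mult_mat)
  then show ?thesis using G(1) by (intro sq_eqI[where d = d]) simp_all
qed

text \<open>The Hessenberg shape for the given order of the eigenvalues bounds the entries above the
  diagonal, the one for the reversed order those below. Irreducibility comes from \<open>f\<close>
  on one side and \<open>g\<close> on the other.\<close>

lemma aw_pair_tri:
  fixes d :: nat and \<theta> \<theta>s f g :: "nat \<Rightarrow> 'a::field"
  assumes aw: "aw_pair d \<beta> \<gamma> \<gamma>s \<omega> \<theta> \<theta>s f g" and d: "d > 0"
  obtains X Y G H where "eigdec d (low d \<theta>) \<theta> X Y" "tri d (\<lambda>i j. (Y * upp d \<theta>s f * X) $$ (i, j))"
    "G \<in> sq d" "H \<in> sq d" "G * H = 1\<^sub>m (Suc d)" "H * G = 1\<^sub>m (Suc d)"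
    "low d \<theta> * G = G * low d (\<lambda>i. \<theta> (d - i))" "upp d \<theta>s f * G = G * upp d \<theta>s g"
proof -
  have nz: "f i \<noteq> 0" "g i \<noteq> 0" if "i \<in> {1..d}" for i
    using aw that unfolding aw_pair_def by auto
  have inj: "inj_on \<theta> {0..d}" using aw unfolding aw_pair_def by auto
  note inj' = inj_on_reverse[OF inj]
  obtain X Y where e: "eigdec d (low d \<theta>) \<theta> X Y" and y: "\<And>i. i \<le> d \<Longrightarrow> Y $$ (i, 0) \<noteq> 0"
    using low_eigdec[OF inj] by metis
  obtain X' Y' where e': "eigdec d (low d (\<lambda>i. \<theta> (d - i))) (\<lambda>i. \<theta> (d - i)) X' Y'"
    and y': "\<And>i. i \<le> d \<Longrightarrow> Y' $$ (i, 0) \<noteq> 0"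
    using low_eigdec[OF inj'] by metis
  obtain G H where G: "G \<in> sq d" "H \<in> sq d" "G * H = 1\<^sub>m (Suc d)" "H * G = 1\<^sub>m (Suc d)"
    "low d \<theta> * G = G * low d (\<lambda>i. \<theta> (d - i))" "\<And>i. i \<le> d \<Longrightarrow> G $$ (i, 0) = (if i = 0 then 1 else 0)"
    "\<And>U U' i j. U \<in> sq d \<Longrightarrow> U' \<in> sq d \<Longrightarrow> U * G = G * U' \<Longrightarrow> i \<le> d \<Longrightarrow> j \<le> d \<Longrightarrow>
       (Y * U * X) $$ (i, j) = 0 \<longleftrightarrow> (Y' * U' * X') $$ (d - i, d - j) = 0"
    using eigdec_intertwiner[OF e e' y y'] by blast
  have U: "upp d \<theta>s f * G = G * upp d \<theta>s g" by (rule aw_pair_intertwine[OF aw d G(1,5,6)])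
  note h = low_upp_hessenberg[OF e inj] and h' = low_upp_hessenberg[OF e' inj']
  have "tri d (\<lambda>i j. (Y * upp d \<theta>s f * X) $$ (i, j))"
    unfolding tri_def
  proof (intro allI impI conjI)
    fix i j assume ij: "i \<le> d" "j \<le> d"
    note tr = G(7)[OF upp_carrier upp_carrier U ij]
    show "(Y * upp d \<theta>s f * X) $$ (i, j) = 0" if "Suc i < j \<or> Suc j < i"
      using that
    proof
      assume "Suc j < i"
      then show ?thesis unfolding tr by (intro h'(1)) (use ij in auto)
    qed (use h(1) ij in blast)
    show "(Y * upp d \<theta>s f * X) $$ (i, j) \<noteq> 0" if "j = Suc i \<or> i = Suc j"
      using that
    proof
      assume "j = Suc i"
      then show ?thesis using h(2)[of i] nz(1)[of "Suc i"] ij by simp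
    next
      assume i: "i = Suc j"
      then have "d - j = Suc (d - i)" "d - i < d" "Suc (d - i) \<in> {1..d}" using ij by auto
      then show ?thesis unfolding tr using h'(2)[of "d - i"] nz(2) by simp
    qed
  qed
  from that[OF e this G(1-5) U] show ?thesis .
qed

text \<open>The transpose of the upper bidiagonal matrix becomes lower bidiagonal with unit subdiagonal
  after a diagonal conjugation.\<close>

lemma low_transpose_eigdec:
  fixes d :: nat and f :: "nat \<Rightarrow> 'a::field"
  assumes e: "eigdec d (low d \<theta>s) \<theta>s X Y" and nz: "\<And>i. i \<in> {1..d} \<Longrightarrow> f i \<noteq> 0"
  obtains X2 Y2 where "eigdec d (upp d \<theta>s f) \<theta>s X2 Y2"
    "\<And>\<theta> i j. i \<le> d \<Longrightarrow> j \<le> d \<Longrightarrow> (Y2 * low d \<theta> * X2) $$ (i, j) = (Y * upp d \<theta> f * X) $$ (j, i)"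
proof -
  note D = eigdecD[OF e]
  \<comment> \<open>Diagonal scaling that moves the superdiagonal entries \<open>f\<close> to the
    other factor; \<open>n 0 = 1\<close> is the empty product.\<close>
  define n where "n i = (\<Prod>h\<in>{1..i}. f h)" for i
  have n0: "n i \<noteq> 0" if "i \<le> d" for i using that nz by (auto simp: n_def)
  have nS: "n (Suc i) = n i * f (Suc i)" for i by (simp add: n_def mult.commute)
  define N where "N = mat_diag (Suc d) n"
  define M where "M = mat_diag (Suc d) (\<lambda>i. 1 / n i)"
  have c: "N \<in> sq d" "M \<in> sq d" "X\<^sup>T \<in> sq d" "Y\<^sup>T \<in> sq d" "(low d \<theta>)\<^sup>T \<in> sq d" "(upp d \<theta> f)\<^sup>T \<in> sq d" for \<theta>
    using D(2,3) by (simp_all add: N_def M_def)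
  have NM: "N * M = 1\<^sub>m (Suc d)" "M * N = 1\<^sub>m (Suc d)"
    by (rule sq_eqI[where d = d]; simp add: N_def M_def mat_diag_index n0 less_Suc_eq_le)+
  have XY: "Y\<^sup>T * X\<^sup>T = 1\<^sub>m (Suc d)" "X\<^sup>T * Y\<^sup>T = 1\<^sub>m (Suc d)"
    using transpose_mult[OF D(2,3), symmetric] transpose_mult[OF D(3,2), symmetric]
    unfolding D(4,5) transpose_one .
  have ti: "A\<^sup>T $$ (i, j) = A $$ (j, i)" if "A \<in> sq d" "i \<le> d" "j \<le> d" for A :: "'a mat" and i j
    using that by simp
  have U: "upp d \<theta>s f = M * ((low d \<theta>s)\<^sup>T * N)"
  proof (rule sq_eqI[where d = d])
    fix i j assume "i \<le> d" "j \<le> d"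
    then show "upp d \<theta>s f $$ (i, j) = (M * ((low d \<theta>s)\<^sup>T * N)) $$ (i, j)"
      using n0 c unfolding M_def N_def
      by (simp add: diag_mult_index[where d = d] ti upp_index low_index nS del: index_mult_mat)
  qed (use c in simp_all)
  have L: "N * (low d \<theta> * M) = (upp d \<theta> f)\<^sup>T" for \<theta>
  proof (rule sq_eqI[where d = d])
    fix i j assume "i \<le> d" "j \<le> d"
    then show "(N * (low d \<theta> * M)) $$ (i, j) = (upp d \<theta> f)\<^sup>T $$ (i, j)"
      using n0 c unfolding M_def N_def
      by (simp add: diag_mult_index[where d = d] ti upp_index low_index nS del: index_mult_mat)
  qed (use c in simp_all)
  define X2 where "X2 = M * Y\<^sup>T"
  define Y2 where "Y2 = X\<^sup>T * N"
  have c2: "X2 \<in> sq d" "Y2 \<in> sq d" using c by (simp_all add: X2_def Y2_def)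
  note mc = mult_cancel_left_inverse
  have 1: "X2 * Y2 = 1\<^sub>m (Suc d)"
    unfolding X2_def Y2_def using c NM by (simp add: assoc_sq[where d = d] mc[OF c(4,3) XY(1)])
  have 2: "Y2 * X2 = 1\<^sub>m (Suc d)" by (rule mat_mult_left_right_inverse[OF c2 1])
  have "(low d \<theta>s)\<^sup>T * Y\<^sup>T = (Y * low d \<theta>s)\<^sup>T"
    by (rule transpose_mult[symmetric, OF D(3,1)])
  also have "\<dots> = Y\<^sup>T * mat_diag (Suc d) \<theta>s"
    unfolding D(7) using D(3)
    by (intro sq_eqI[where d = d])
      (simp_all add: ti diag_mult_index[where d = d] c mult.commute del: index_mult_mat(1))
  finally have 3: "(low d \<theta>s)\<^sup>T * Y\<^sup>T = Y\<^sup>T * mat_diag (Suc d) \<theta>s" .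
  have "upp d \<theta>s f * X2 = X2 * mat_diag (Suc d) \<theta>s"
    unfolding U X2_def using c by (simp add: assoc_sq[where d = d] mc[OF c(1,2) NM(1)] 3)
  with 1 2 c2 have e2: "eigdec d (upp d \<theta>s f) \<theta>s X2 Y2" by (simp add: eigdec_def)
  have "(Y2 * low d \<theta> * X2) $$ (i, j) = (Y * upp d \<theta> f * X) $$ (j, i)" if "i \<le> d" "j \<le> d" for \<theta> i j
  proof -
    have "Y2 * low d \<theta> * X2 = X\<^sup>T * ((N * (low d \<theta> * M)) * Y\<^sup>T)"
      unfolding X2_def Y2_def using c by (simp add: assoc_sq[where d = d])
    also have "\<dots> = X\<^sup>T * (Y * upp d \<theta> f)\<^sup>T"
      unfolding L transpose_mult[OF D(3) upp_carrier] ..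
    also have "\<dots> = (Y * upp d \<theta> f * X)\<^sup>T"
      by (rule transpose_mult[symmetric, OF sq_mult[OF D(3) upp_carrier] D(2)])
    finally show ?thesis using that D(2,3) by (simp add: ti del: index_mult_mat assoc_mult_mat)
  qed
  with e2 show ?thesis by (rule that)
qed

section \<open>Split spaces\<close>

lemma mult_vec_index:
  fixes A :: "'a::field mat"
  assumes "A \<in> sq d" "v \<in> carrier_vec (Suc d)" "i \<le> d"
  shows "(A *\<^sub>v v) $ i = (\<Sum>k\<le>d. A $$ (i, k) * v $ k)"
proof -
  have "(A *\<^sub>v v) $ i = (\<Sum>k<Suc d. A $$ (i, k) * v $ k)"
    using assms by (auto simp: scalar_prod_def atLeast0LessThan intro!: sum.cong)
  then show ?thesis by (simp only: lessThan_Suc_atMost)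
qed

lemma sq_mult_vec [simp]: "A \<in> sq d \<Longrightarrow> v \<in> carrier_vec (Suc d) \<Longrightarrow> A *\<^sub>v v \<in> carrier_vec (Suc d)"
  by (rule mult_mat_vec_carrier)

lemma carrier_vec_eqI: "v \<in> carrier_vec (Suc d) \<Longrightarrow> w \<in> carrier_vec (Suc d) \<Longrightarrow>
    (\<And>i. i \<le> d \<Longrightarrow> v $ i = w $ i) \<Longrightarrow> v = w"
  by (intro eq_vecI) auto

lemma proj_mult_vec:
  assumes c: "X \<in> sq d" "Y \<in> sq d" "v \<in> carrier_vec (Suc d)" and i: "i \<le> d" "k \<le> d"
  shows "(proj d X Y i *\<^sub>v v) $ k = X $$ (k, i) * (Y *\<^sub>v v) $ i"
proof -
  have "(proj d X Y i *\<^sub>v v) $ k = (\<Sum>l\<le>d. X $$ (k, i) * (Y $$ (i, l) * v $ l))"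
    using c i by (simp add: mult_vec_index[where d = d] proj_index mult.assoc del: index_mult_mat_vec)
  then show ?thesis using c i by (simp add: mult_vec_index[where d = d] sum_distrib_left del: index_mult_mat_vec)
qed

lemma eigdec_mult_vec:
  assumes "eigdec d A \<theta> X Y" "v \<in> carrier_vec (Suc d)"
  shows "X *\<^sub>v (Y *\<^sub>v v) = v"
proof -
  note D = eigdecD[OF assms(1)]
  have "X *\<^sub>v (Y *\<^sub>v v) = (X * Y) *\<^sub>v v"
    by (rule assoc_mult_mat_vec[symmetric, OF D(2,3) assms(2)])
  then show ?thesis unfolding D(4) using assms(2) by simp
qed

text \<open>\<open>Y\<close> computes coordinates in the eigenbasis, and a sum of eigenspaces is cut
  out by the vanishing of the remaining coordinates.\<close>

lemma image_sum_proj: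
  assumes e: "eigdec d A \<theta> X Y" and S: "S \<subseteq> {0..d}"
  shows "image_sum d (\<lambda>i\<in>{0..d}. proj d X Y i) S
    = {v \<in> carrier_vec (Suc d). \<forall>k \<le> d. k \<notin> S \<longrightarrow> (Y *\<^sub>v v) $ k = 0}"
proof (intro equalityI subsetI)
  note D = eigdecD[OF e]
  let ?E = "\<lambda>i\<in>{0..d}. proj d X Y i"
  have fin: "finite S" using S finite_subset by blast
  have Eh: "?E h = proj d X Y h" if "h \<in> S" for h using S that by auto
  have cl: "finsum_vec TYPE('a) (d + 1) (\<lambda>h. ?E h *\<^sub>v w h) S \<in> carrier_vec (Suc d)"
    and ix: "\<And>k. k \<le> d \<Longrightarrow> finsum_vec TYPE('a) (d + 1) (\<lambda>h. ?E h *\<^sub>v w h) S $ k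
       = (\<Sum>h\<in>S. X $$ (k, h) * (Y *\<^sub>v w h) $ h)"
    if w: "\<forall>h \<in> S. w h \<in> carrier_vec (Suc d)" for w
  proof -
    have c: "(\<lambda>h. ?E h *\<^sub>v w h) \<in> S \<rightarrow> carrier_vec (Suc d)" using w D(2,3) Eh by auto
    then show "finsum_vec TYPE('a) (d + 1) (\<lambda>h. ?E h *\<^sub>v w h) S \<in> carrier_vec (Suc d)"
      using finsum_vec_closed[OF c] by simp
    fix k assume k: "k \<le> d"
    have "finsum_vec TYPE('a) (Suc d) (\<lambda>h. ?E h *\<^sub>v w h) S $ k = (\<Sum>h\<in>S. (?E h *\<^sub>v w h) $ k)"
      by (rule index_finsum_vec[OF fin _ c]) (use k in simp)
    also have "\<dots> = (\<Sum>h\<in>S. X $$ (k, h) * (Y *\<^sub>v w h) $ h)"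
    proof (rule sum.cong[OF refl])
      fix h assume "h \<in> S"
      then show "(?E h *\<^sub>v w h) $ k = X $$ (k, h) * (Y *\<^sub>v w h) $ h"
        using proj_mult_vec[OF D(2,3), of "w h" h k] w S k Eh by auto
    qed
    finally show "finsum_vec TYPE('a) (d + 1) (\<lambda>h. ?E h *\<^sub>v w h) S $ k
       = (\<Sum>h\<in>S. X $$ (k, h) * (Y *\<^sub>v w h) $ h)" by simp
  qed
  { fix v assume "v \<in> image_sum d ?E S"
    then obtain w where w: "\<forall>h \<in> S. w h \<in> carrier_vec (Suc d)"
      and v: "v = finsum_vec TYPE('a) (d + 1) (\<lambda>h. ?E h *\<^sub>v w h) S"
      by (auto simp: image_sum_def)
    have cv: "v \<in> carrier_vec (Suc d)" unfolding v by (rule cl[OF w])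
    have "(Y *\<^sub>v v) $ k = 0" if k: "k \<le> d" "k \<notin> S" for k
    proof -
      have vl: "v $ l = (\<Sum>h\<in>S. X $$ (l, h) * (Y *\<^sub>v w h) $ h)" if "l \<le> d" for l
        unfolding v by (rule ix[OF w that])
      have "(Y *\<^sub>v v) $ k = (\<Sum>l\<le>d. \<Sum>h\<in>S. Y $$ (k, l) * (X $$ (l, h) * (Y *\<^sub>v w h) $ h))"
        unfolding mult_vec_index[OF D(3) cv k(1)] sum_distrib_left[symmetric]
        by (rule sum.cong) (simp_all add: vl del: index_mult_mat_vec)
      also have "\<dots> = (\<Sum>h\<in>S. (\<Sum>l\<le>d. Y $$ (k, l) * X $$ (l, h)) * (Y *\<^sub>v w h) $ h)"
        by (subst sum.swap) (simp add: sum_distrib_right mult.assoc)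
      also have "\<dots> = (\<Sum>h\<in>S. (Y * X) $$ (k, h) * (Y *\<^sub>v w h) $ h)"
        using S k D(2,3) by (intro sum.cong refl) (auto simp: mult_index[where d = d] simp del: index_mult_mat)
      also have "\<dots> = 0" unfolding D(5) using S k by (intro sum.neutral) auto
      finally show ?thesis .
    qed
    with cv show "v \<in> {v \<in> carrier_vec (Suc d). \<forall>k \<le> d. k \<notin> S \<longrightarrow> (Y *\<^sub>v v) $ k = 0}" by blast
  }
  fix v assume "v \<in> {v \<in> carrier_vec (Suc d). \<forall>k \<le> d. k \<notin> S \<longrightarrow> (Y *\<^sub>v v) $ k = 0}"
  then have cv: "v \<in> carrier_vec (Suc d)" and z: "\<And>k. k \<le> d \<Longrightarrow> k \<notin> S \<Longrightarrow> (Y *\<^sub>v v) $ k = 0" by auto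
  have w: "\<forall>h \<in> S. v \<in> carrier_vec (Suc d)" using cv by simp
  have "v = finsum_vec TYPE('a) (d + 1) (\<lambda>h. ?E h *\<^sub>v v) S"
  proof (rule carrier_vec_eqI[OF cv cl[OF w]])
    fix k assume k: "k \<le> d"
    have "v = X *\<^sub>v (Y *\<^sub>v v)" using eigdec_mult_vec[OF e cv] by simp
    then have "v $ k = (X *\<^sub>v (Y *\<^sub>v v)) $ k" by simp
    also have "\<dots> = (\<Sum>h\<le>d. X $$ (k, h) * (Y *\<^sub>v v) $ h)"
      by (rule mult_vec_index[OF D(2) sq_mult_vec[OF D(3) cv] k])
    also have "\<dots> = (\<Sum>h\<in>S. X $$ (k, h) * (Y *\<^sub>v v) $ h)"
      using S z by (intro sum.mono_neutral_right) (auto simp del: index_mult_mat_vec)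
    finally show "v $ k = finsum_vec TYPE('a) (d + 1) (\<lambda>h. ?E h *\<^sub>v v) S $ k" unfolding ix[OF w k] .
  qed
  then show "v \<in> image_sum d ?E S"
    unfolding image_sum_def using w by (intro CollectI exI[of _ "\<lambda>_. v"]) simp
qed

lemma eigdec_upp_triangular:
  assumes e: "eigdec d (upp d \<theta> f) \<theta> X Y" and inj: "inj_on \<theta> {0..d}"
  shows "j < i \<Longrightarrow> i \<le> d \<Longrightarrow> X $$ (i, j) = 0" "j < i \<Longrightarrow> i \<le> d \<Longrightarrow> Y $$ (i, j) = 0"
proof -
  note D = eigdecD[OF e]
  have ne: "\<theta> i \<noteq> \<theta> j" if "i \<le> d" "j \<le> d" "i \<noteq> j" for i j
    using inj that by (auto simp: inj_on_def)
  have X: "\<theta> i * X $$ (i, j) + (if i < d then f (Suc i) * X $$ (Suc i, j) else 0) = X $$ (i, j) * \<theta> j"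
    if "i \<le> d" "j \<le> d" for i j
    using D(6) upp_mult[OF D(2) that, of \<theta> f] diag_mult_index(2)[OF D(2) that, of \<theta>] by metis
  have Y: "Y $$ (i, j) * \<theta> j + (if j = 0 then 0 else Y $$ (i, j - 1) * f j) = \<theta> i * Y $$ (i, j)"
    if "i \<le> d" "j \<le> d" for i j
    using D(7) mult_upp[OF D(3) that, of \<theta> f] diag_mult_index(1)[OF D(3) that, of \<theta>] by metis
  show "X $$ (i, j) = 0" if "j < i" "i \<le> d"
    using that(2,1)
  proof (induction i rule: inc_induct)
    case base
    then show ?case using X[of d j] ne[of d j] by auto
  next
    case (step i)
    then show ?case using X[of i j] ne[of i j] by auto
  qed
  show "Y $$ (i, j) = 0" if "j < i" "i \<le> d"
    using that
  proof (induction j)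
    case 0
    then show ?case using Y[of i 0] ne[of i 0] by auto
  next
    case (Suc j)
    then show ?case using Y[of i "Suc j"] ne[of i "Suc j"] by auto
  qed
qed

lemma eigdec_conjugate:
  assumes e: "eigdec d A \<theta> X Y" and G: "G \<in> sq d" "H \<in> sq d" "G * H = 1\<^sub>m (Suc d)" "H * G = 1\<^sub>m (Suc d)"
    and B: "B \<in> sq d" "A * G = G * B"
  shows "eigdec d B \<theta> (H * X) (Y * G)"
proof -
  note D = eigdecD[OF e] note mc = mult_cancel_left_inverse
  have 1: "Y * G * (H * X) = 1\<^sub>m (Suc d)"
    using D(2,3,5) G by (simp add: assoc_sq[where d = d] mc[OF G(1,2,3)])
  have 2: "(H * X) * (Y * G) = 1\<^sub>m (Suc d)"
    by (rule mat_mult_left_right_inverse[OF _ _ 1]) (use D(2,3) G in simp_all)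
  have "H * (A * G) = B" unfolding B(2) by (rule mc[OF G(2,1,4) B(1)])
  then have "B * (H * X) = (H * (A * G)) * (H * X)" by simp
  also have "\<dots> = H * (A * (G * (H * X)))"
    using D(1,2) G by (simp add: assoc_sq[where d = d])
  also have "\<dots> = (H * X) * mat_diag (Suc d) \<theta>"
    using D(1,2) G by (simp add: assoc_sq[where d = d] mc[OF G(1,2,3)] D(6))
  finally show ?thesis using 1 2 B(1) D(2,3) G by (simp add: eigdec_def)
qed

text \<open>Since \<open>X\<close> and \<open>Y\<close> are lower triangular, the span of the
  eigenvectors from the i-th on is the span of the standard basis vectors from the i-th on.\<close>

lemma low_eigdec_support:
  assumes e: "eigdec d (low d \<theta>) \<theta> X Y" and inj: "inj_on \<theta> {0..d}"
    and v: "v \<in> carrier_vec (Suc d)" and i: "i \<le> d"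
  shows "(\<forall>k \<le> d. k < i \<longrightarrow> (Y *\<^sub>v v) $ k = 0) \<longleftrightarrow> (\<forall>k \<le> d. k < i \<longrightarrow> v $ k = 0)"
proof -
  note D = eigdecD[OF e] note T = eigdec_low_triangular[OF e inj]
  have *: "(M *\<^sub>v w) $ k = 0" if "M \<in> sq d" "band d 0 M" "w \<in> carrier_vec (Suc d)"
    "\<forall>k \<le> d. k < i \<longrightarrow> w $ k = 0" "k < i" for M :: "'a mat" and w k
  proof -
    have "M $$ (k, l) * w $ l = 0" if "l \<le> d" for l
      using \<open>band d 0 M\<close> \<open>\<forall>k \<le> d. k < i \<longrightarrow> w $ k = 0\<close> \<open>k < i\<close> i that by (cases "k < l") (auto simp: band_def)
    then have "(\<Sum>l\<le>d. M $$ (k, l) * w $ l) = 0" by (intro sum.neutral) blast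
    then show ?thesis using mult_vec_index[OF that(1,3), of k] that(5) i by simp
  qed
  have "v = X *\<^sub>v (Y *\<^sub>v v)" using eigdec_mult_vec[OF e v] by simp
  then show ?thesis using *[OF D(3) T(2) v] *[OF D(2) T(1) sq_mult_vec[OF D(3) v]] by metis
qed

lemma upp_eigdec_support:
  assumes e: "eigdec d (upp d \<theta> f) \<theta> X Y" and inj: "inj_on \<theta> {0..d}"
    and v: "v \<in> carrier_vec (Suc d)"
  shows "(\<forall>k \<le> d. i < k \<longrightarrow> (Y *\<^sub>v v) $ k = 0) \<longleftrightarrow> (\<forall>k \<le> d. i < k \<longrightarrow> v $ k = 0)"
proof -
  note D = eigdecD[OF e] note T = eigdec_upp_triangular[OF e inj]
  have *: "(M *\<^sub>v w) $ k = 0" if "M \<in> sq d" "\<And>i j. j < i \<Longrightarrow> i \<le> d \<Longrightarrow> M $$ (i, j) = 0"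
    "w \<in> carrier_vec (Suc d)" "\<forall>k \<le> d. i < k \<longrightarrow> w $ k = 0" "i < k" "k \<le> d" for M :: "'a mat" and w k
  proof -
    have "M $$ (k, l) * w $ l = 0" if "l \<le> d" for l
      using \<open>\<forall>k \<le> d. i < k \<longrightarrow> w $ k = 0\<close> \<open>i < k\<close> \<open>k \<le> d\<close> that \<open>\<And>i j. j < i \<Longrightarrow> i \<le> d \<Longrightarrow> M $$ (i, j) = 0\<close>
      by (cases "l < k") auto
    then have "(\<Sum>l\<le>d. M $$ (k, l) * w $ l) = 0" by (intro sum.neutral) blast
    then show ?thesis using mult_vec_index[OF that(1,3,6)] by simp
  qed
  have "v = X *\<^sub>v (Y *\<^sub>v v)" using eigdec_mult_vec[OF e v] by simp
  then show ?thesis using *[OF D(3) T(2) v] *[OF D(2) T(1) sq_mult_vec[OF D(3) v]] by metis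
qed


text \<open>In the basis given by \<open>G\<close> one flag consists of initial and the other of
  final segments of coordinates, so their intersection is the i-th coordinate line. \<open>H\<close>
  computes the coordinates.\<close>

lemma split_space_eq:
  assumes e: "eigdec d A \<theta> X Y" and e2: "eigdec d As \<theta>s X2 Y2"
    and inj: "inj_on \<theta> {0..d}" "inj_on \<theta>s {0..d}"
    and G: "G \<in> sq d" "H \<in> sq d" "G * H = 1\<^sub>m (Suc d)" "H * G = 1\<^sub>m (Suc d)"
    and AG: "A * G = G * low d \<theta>" "As * G = G * upp d \<theta>s f"
    and \<Phi>: "ls_E \<Phi> = (\<lambda>i\<in>{0..d}. proj d X Y i)" "ls_Es \<Phi> = (\<lambda>i\<in>{0..d}. proj d X2 Y2 i)"
    and i: "i \<le> d"
  shows "split_space d \<Phi> i = {v \<in> carrier_vec (Suc d). \<forall>k \<le> d. k \<noteq> i \<longrightarrow> (H *\<^sub>v v) $ k = 0}"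
proof -
  note c = eigdec_conjugate[OF e G low_carrier AG(1)]
  note c2 = eigdec_conjugate[OF e2 G upp_carrier AG(2)]
  have YG: "Z *\<^sub>v v = (Z * G) *\<^sub>v (H *\<^sub>v v)" if "Z \<in> sq d" "v \<in> carrier_vec (Suc d)" for Z v
  proof -
    have "(Z * G) *\<^sub>v (H *\<^sub>v v) = (Z * G * H) *\<^sub>v v"
      by (rule assoc_mult_mat_vec[symmetric]) (use that G in auto)
    also have "Z * G * H = Z" using that G by (simp add: assoc_sq[where d = d])
    finally show ?thesis by simp
  qed
  have "{0..i} \<subseteq> {0..d}" "{i..d} \<subseteq> {0..d}" using i by auto
  note s1 = image_sum_proj[OF e2 this(1)] and s2 = image_sum_proj[OF e this(2)]
  have "v \<in> split_space d \<Phi> i \<longleftrightarrow> (\<forall>k \<le> d. k \<noteq> i \<longrightarrow> (H *\<^sub>v v) $ k = 0)" if v: "v \<in> carrier_vec (Suc d)" for v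
  proof -
    have Hv: "H *\<^sub>v v \<in> carrier_vec (Suc d)" using G v by simp
    have "v \<in> split_space d \<Phi> i \<longleftrightarrow>
      (\<forall>k \<le> d. i < k \<longrightarrow> (Y2 *\<^sub>v v) $ k = 0) \<and> (\<forall>k \<le> d. k < i \<longrightarrow> (Y *\<^sub>v v) $ k = 0)"
      unfolding split_space_def \<Phi> s1 s2 using i v by (auto simp del: index_mult_mat_vec)
    also have "\<dots> \<longleftrightarrow> (\<forall>k \<le> d. i < k \<longrightarrow> (H *\<^sub>v v) $ k = 0) \<and> (\<forall>k \<le> d. k < i \<longrightarrow> (H *\<^sub>v v) $ k = 0)"
      unfolding YG[OF eigdecD(3)[OF e] v] YG[OF eigdecD(3)[OF e2] v]
        low_eigdec_support[OF c inj(1) Hv i] upp_eigdec_support[OF c2 inj(2) Hv] ..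
    also have "\<dots> \<longleftrightarrow> (\<forall>k \<le> d. k \<noteq> i \<longrightarrow> (H *\<^sub>v v) $ k = 0)" by (metis linorder_neqE_nat less_irrefl)
    finally show ?thesis .
  qed
  moreover have "v \<in> carrier_vec (Suc d)" if "v \<in> split_space d \<Phi> i" for v
    using that unfolding split_space_def \<Phi> s1 by blast
  ultimately show ?thesis by blast
qed

lemma shift_intertwine:
  assumes "A \<in> sq d" "B \<in> sq d" "G \<in> sq d" "A * G = G * (B :: 'a::field mat)"
  shows "(A - a \<cdot>\<^sub>m 1\<^sub>m (Suc d)) * G = G * (B - a \<cdot>\<^sub>m 1\<^sub>m (Suc d))"
proof -
  have c: "a \<cdot>\<^sub>m 1\<^sub>m (Suc d) \<in> sq d" by simp
  have "(a \<cdot>\<^sub>m 1\<^sub>m (Suc d)) * G = a \<cdot>\<^sub>m G" "G * (a \<cdot>\<^sub>m 1\<^sub>m (Suc d)) = a \<cdot>\<^sub>m G"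
    using assms(3) by (simp_all add: mult_smult_assoc_mat[of _ "Suc d" "Suc d" _ "Suc d"]
      mult_smult_distrib[of _ "Suc d" "Suc d" _ "Suc d"])
  then show ?thesis
    unfolding minus_mult_distrib_mat[OF assms(1) c assms(3)] mult_minus_distrib_mat[OF assms(3,2) c]
    using assms(4) by simp
qed

lemma first_split_seq_eq:
  assumes e: "eigdec d A \<theta> X Y" and e2: "eigdec d As \<theta>s X2 Y2"
    and inj: "inj_on \<theta> {0..d}" "inj_on \<theta>s {0..d}"
    and G: "G \<in> sq d" "H \<in> sq d" "G * H = 1\<^sub>m (Suc d)" "H * G = 1\<^sub>m (Suc d)"
    and AG: "A * G = G * low d \<theta>" "As * G = G * upp d \<theta>s f"
    and \<Phi>: "ls_A \<Phi> = A" "ls_As \<Phi> = As"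
      "ls_E \<Phi> = (\<lambda>i\<in>{0..d}. proj d X Y i)" "ls_Es \<Phi> = (\<lambda>i\<in>{0..d}. proj d X2 Y2 i)"
      "\<And>i. i \<le> d \<Longrightarrow> eigenvalue_seq d \<Phi> i = \<theta> i" "\<And>i. i \<le> d \<Longrightarrow> dual_eigenvalue_seq d \<Phi> i = \<theta>s i"
  shows "first_split_seq d \<Phi> = (\<lambda>i\<in>{1..d}. f i)"
proof (rule ext)
  fix i
  show "first_split_seq d \<Phi> i = (\<lambda>i\<in>{1..d}. f i) i"
  proof (cases "i \<in> {1..d}")
    case True
    then have i: "i \<le> d" "i - 1 \<le> d" "Suc (i - 1) = i" by auto
    define M where "M = (A - \<theta> (i - 1) \<cdot>\<^sub>m 1\<^sub>m (Suc d)) * (As - \<theta>s i \<cdot>\<^sub>m 1\<^sub>m (Suc d))"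
    define P where "P = low d \<theta> - \<theta> (i - 1) \<cdot>\<^sub>m 1\<^sub>m (Suc d)"
    define Q where "Q = upp d \<theta>s f - \<theta>s i \<cdot>\<^sub>m 1\<^sub>m (Suc d)"
    have A: "A \<in> sq d" "As \<in> sq d" using eigdecD(1)[OF e] eigdecD(1)[OF e2] .
    have c: "A - \<theta> (i - 1) \<cdot>\<^sub>m 1\<^sub>m (Suc d) \<in> sq d" "As - \<theta>s i \<cdot>\<^sub>m 1\<^sub>m (Suc d) \<in> sq d" "P \<in> sq d" "Q \<in> sq d"
      using A by (simp_all add: P_def Q_def)
    have cM: "M \<in> sq d" using c by (simp add: M_def)
    have "M * G = (A - \<theta> (i - 1) \<cdot>\<^sub>m 1\<^sub>m (Suc d)) * (G * Q)"
      unfolding M_def Q_def shift_intertwine[OF A(2) upp_carrier G(1) AG(2), symmetric]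
      by (rule assoc_sq[OF c(1,2) G(1)])
    also have "\<dots> = ((A - \<theta> (i - 1) \<cdot>\<^sub>m 1\<^sub>m (Suc d)) * G) * Q"
      by (rule assoc_sq[symmetric, OF c(1) G(1) c(4)])
    also have "\<dots> = G * (P * Q)"
      unfolding shift_intertwine[OF A(1) low_carrier G(1) AG(1)] P_def[symmetric]
      by (rule assoc_sq[OF G(1) c(3,4)])
    finally have MG: "M * G = G * (P * Q)" .
    have P': "P = low d (\<lambda>k. \<theta> k - \<theta> (i - 1))" and Q': "Q = upp d (\<lambda>k. \<theta>s k - \<theta>s i) f"
      by (rule sq_eqI[where d = d]; simp add: P_def Q_def low_index upp_index low_def upp_def less_Suc_eq_le)+
    \<comment> \<open>The right factor takes the i-th basis vector to \<open>f i\<close> times its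
      predecessor, and the left factor takes that predecessor back to the i-th vector.\<close>
    have PQ: "(P * Q) $$ (k, i) = (if k = i then f i else 0)" if "k \<le> d" for k
      unfolding P' low_mult[OF c(4) that i(1)] using that i by (auto simp: Q' upp_index)
    have eig: "M *\<^sub>v u = f i \<cdot>\<^sub>v u"
      if u: "u \<in> carrier_vec (Suc d)" "\<forall>k \<le> d. k \<noteq> i \<longrightarrow> (H *\<^sub>v u) $ k = 0" for u
    proof -
      define w where "w = H *\<^sub>v u"
      have cw: "w \<in> carrier_vec (Suc d)" using u G by (simp add: w_def)
      have cPQ: "P * Q \<in> sq d" using c by simp
      have "G *\<^sub>v w = (G * H) *\<^sub>v u" unfolding w_def
        by (rule assoc_mult_mat_vec[symmetric, OF G(1,2) u(1)])
      then have uw: "u = G *\<^sub>v w" unfolding G(3) using u by simp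
      have "(P * Q) *\<^sub>v w = f i \<cdot>\<^sub>v w"
      proof (rule carrier_vec_eqI)
        fix k assume k: "k \<le> d"
        have "((P * Q) *\<^sub>v w) $ k = (\<Sum>l\<le>d. (P * Q) $$ (k, l) * w $ l)"
          by (rule mult_vec_index[OF cPQ cw k])
        also have "\<dots> = (\<Sum>l\<le>d. if l = i then (P * Q) $$ (k, i) * w $ i else 0)"
          using u(2) by (intro sum.cong) (auto simp: w_def simp del: index_mult_mat index_mult_mat_vec)
        also have "\<dots> = (P * Q) $$ (k, i) * w $ i" using i by simp
        also have "\<dots> = f i * w $ k" unfolding PQ[OF k] using u(2) k by (auto simp: w_def simp del: index_mult_mat_vec)
        finally show "((P * Q) *\<^sub>v w) $ k = (f i \<cdot>\<^sub>v w) $ k" using k cw by simp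
      qed (use cPQ cw in simp_all)
      moreover have "M *\<^sub>v u = G *\<^sub>v ((P * Q) *\<^sub>v w)"
        unfolding uw assoc_mult_mat_vec[OF cM G(1) cw, symmetric] MG
        by (rule assoc_mult_mat_vec[OF G(1) cPQ cw])
      ultimately show ?thesis unfolding uw using mult_mat_vec[OF G(1) cw] by simp
    qed
    note sp = split_space_eq[OF e e2 inj G AG \<Phi>(3,4) i(1)]
    have M: "(ls_A \<Phi> - eigenvalue_seq d \<Phi> (i - 1) \<cdot>\<^sub>m 1\<^sub>m (d + 1)) *
        (ls_As \<Phi> - dual_eigenvalue_seq d \<Phi> i \<cdot>\<^sub>m 1\<^sub>m (d + 1)) = M"
      using \<Phi>(5)[OF i(2)] \<Phi>(6)[OF i(1)] by (simp add: M_def \<Phi>(1,2))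
    have "(\<exists>u \<in> split_space d \<Phi> i. eigenvector M u c) \<longleftrightarrow> c = f i" for c
    proof
      assume "\<exists>u \<in> split_space d \<Phi> i. eigenvector M u c"
      then obtain u where u: "u \<in> carrier_vec (Suc d)" "\<forall>k \<le> d. k \<noteq> i \<longrightarrow> (H *\<^sub>v u) $ k = 0"
        "u \<noteq> 0\<^sub>v (Suc d)" "M *\<^sub>v u = c \<cdot>\<^sub>v u"
        using cM unfolding sp eigenvector_def by auto
      then obtain k where k: "k \<le> d" "u $ k \<noteq> 0"
        by (metis index_zero_vec(1) less_Suc_eq_le carrier_vec_eqI zero_carrier_vec)
      have "(c \<cdot>\<^sub>v u) $ k = (f i \<cdot>\<^sub>v u) $ k" using u(4) eig[OF u(1,2)] by simp
      then show "c = f i" using k u(1) by simp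
    next
      assume c: "c = f i"
      define u where "u = G *\<^sub>v unit_vec (Suc d) i"
      have cu: "u \<in> carrier_vec (Suc d)" using G by (simp add: u_def)
      have "H *\<^sub>v u = (H * G) *\<^sub>v unit_vec (Suc d) i" unfolding u_def
        by (rule assoc_mult_mat_vec[symmetric, OF G(2,1)]) simp
      then have Hu: "H *\<^sub>v u = unit_vec (Suc d) i" unfolding G(4) by simp
      have "\<forall>k \<le> d. k \<noteq> i \<longrightarrow> (H *\<^sub>v u) $ k = 0" unfolding Hu using i by simp
      moreover have "u \<noteq> 0\<^sub>v (Suc d)"
      proof
        assume "u = 0\<^sub>v (Suc d)"
        then have "H *\<^sub>v u = 0\<^sub>v (Suc d)" using G(2)
          by (intro carrier_vec_eqI[where d = d]) (simp_all add: mult_vec_index[where d = d] del: index_mult_mat_vec)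
        then have "unit_vec (Suc d) i $ i = (0\<^sub>v (Suc d) :: 'a vec) $ i" unfolding Hu by simp
        then show False using i by simp
      qed
      ultimately show "\<exists>u \<in> split_space d \<Phi> i. eigenvector M u c"
        using cu cM eig[OF cu] unfolding sp eigenvector_def c by (intro bexI[of _ u]) auto
    qed
    then show ?thesis unfolding first_split_seq_def restrict_apply M using True by simp
  qed (auto simp: first_split_seq_def)
qed

section \<open>The Leonard system of a split pair\<close>

lemma proj_nonzero:
  assumes e: "eigdec d A \<theta> X Y" and i: "i \<le> d"
  obtains k where "k \<le> d" "proj d X Y i $$ (k, k) \<noteq> 0"
proof -
  note D = eigdecD[OF e]
  have "(\<Sum>k\<le>d. Y $$ (i, k) * X $$ (k, i)) = 1"
    using mult_index[OF D(3,2) i i] i unfolding D(5) by (simp del: index_mult_mat)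
  then have "(\<Sum>k\<le>d. Y $$ (i, k) * X $$ (k, i)) \<noteq> 0" by simp
  then obtain k where k: "k \<le> d" "Y $$ (i, k) * X $$ (k, i) \<noteq> 0"
    by (rule sum.not_neutral_contains_not_neutral) simp
  then have "proj d X Y i $$ (k, k) \<noteq> 0" using D(2,3) i by (simp add: proj_index)
  with k(1) show ?thesis by (rule that)
qed

lemma mult_proj_index:
  assumes e: "eigdec d A \<theta> X Y" and i: "i \<le> d" "k \<le> d" "l \<le> d"
  shows "(A * proj d X Y i) $$ (k, l) = \<theta> i * proj d X Y i $$ (k, l)"
proof -
  note D = eigdecD[OF e]
  have ki: "(\<Sum>m\<le>d. A $$ (k, m) * X $$ (m, i)) = X $$ (k, i) * \<theta> i"
    using mult_index[OF D(1,2) i(2,1)] diag_mult_index(2)[OF D(2) i(2,1), of \<theta>] unfolding D(6) by simp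
  have "(A * proj d X Y i) $$ (k, l) = (\<Sum>m\<le>d. A $$ (k, m) * proj d X Y i $$ (m, l))"
    using D(1-3) i by (intro mult_index) simp_all
  also have "\<dots> = (\<Sum>m\<le>d. A $$ (k, m) * X $$ (m, i)) * Y $$ (i, l)"
    unfolding sum_distrib_right using D(2,3) i by (intro sum.cong) (simp_all add: proj_index)
  finally show ?thesis unfolding ki using D(2,3) i by (simp add: proj_index)
qed

text \<open>The idempotent is nonzero and \<open>A\<close> multiplies it by its eigenvalue, so the
  eigenvalue can be recovered from it. This makes the description of the eigenvalue sequence
  definite.\<close>

lemma idempotents_for_unique:
  assumes e: "eigdec d A \<theta> X Y" and inj: "inj_on \<theta> {0..d}" and ext: "\<theta> \<in> extensional {0..d}"
    and E: "idempotents_for d A \<theta>' (\<lambda>i\<in>{0..d}. proj d X Y i)"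
  shows "\<theta>' = \<theta>"
proof
  fix i
  obtain X' Y' where e': "eigdec d A \<theta>' X' Y'" and E': "(\<lambda>i\<in>{0..d}. proj d X Y i) = (\<lambda>i\<in>{0..d}. proj d X' Y' i)"
    by (rule idempotents_for_permuted[OF e inj E]) blast
  show "\<theta>' i = \<theta> i"
  proof (cases "i \<le> d")
    case True
    then have p: "proj d X Y i = proj d X' Y' i" using fun_cong[OF E', of i] by simp
    obtain k where k: "k \<le> d" "proj d X Y i $$ (k, k) \<noteq> 0" by (rule proj_nonzero[OF e True])
    have "\<theta>' i * proj d X Y i $$ (k, k) = \<theta> i * proj d X Y i $$ (k, k)"
      using mult_proj_index[OF e' True k(1) k(1)] mult_proj_index[OF e True k(1) k(1)] unfolding p by auto
    then show ?thesis using k by simp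
  next
    case False
    moreover have "\<theta>' \<in> extensional {0..d}" using E unfolding idempotents_for_def eigenvalue_ordering_def by blast
    ultimately show ?thesis using extensional_arb[OF ext, of i] extensional_arb[of \<theta>' "{0..d}" i] by simp
  qed
qed

lemma eigenvalue_seq_eigdec:
  assumes e: "eigdec d A \<theta> X Y" and inj: "inj_on \<theta> {0..d}" and ext: "\<theta> \<in> extensional {0..d}"
  shows "ls_A \<Phi> = A \<Longrightarrow> ls_E \<Phi> = (\<lambda>i\<in>{0..d}. proj d X Y i) \<Longrightarrow> eigenvalue_seq d \<Phi> = \<theta>"
    and "ls_As \<Phi> = A \<Longrightarrow> ls_Es \<Phi> = (\<lambda>i\<in>{0..d}. proj d X Y i) \<Longrightarrow> dual_eigenvalue_seq d \<Phi> = \<theta>"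
proof -
  have "(THE \<theta>. idempotents_for d A \<theta> (\<lambda>i\<in>{0..d}. proj d X Y i)) = \<theta>"
    by (rule the_equality) (rule idempotents_for_eigdec[OF assms], rule idempotents_for_unique[OF assms])
  then show "ls_A \<Phi> = A \<Longrightarrow> ls_E \<Phi> = (\<lambda>i\<in>{0..d}. proj d X Y i) \<Longrightarrow> eigenvalue_seq d \<Phi> = \<theta>"
    and "ls_As \<Phi> = A \<Longrightarrow> ls_Es \<Phi> = (\<lambda>i\<in>{0..d}. proj d X Y i) \<Longrightarrow> dual_eigenvalue_seq d \<Phi> = \<theta>"
    unfolding eigenvalue_seq_def dual_eigenvalue_seq_def by simp_all
qed

text \<open>The converse dependence: the eigenvalue sequence fixes the idempotents. It provides the
  uniqueness of the designated Leonard system.\<close>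

lemma idempotents_determined:
  assumes e: "eigdec d A \<theta> X Y" and inj: "inj_on \<theta> {0..d}"
    and E: "idempotents_for d A \<theta>' E" and s: "(THE \<theta>. idempotents_for d A \<theta> E) = \<theta>"
  shows "E = (\<lambda>i\<in>{0..d}. proj d X Y i)"
proof -
  obtain X' Y' where e': "eigdec d A \<theta>' X' Y'" and E': "E = (\<lambda>i\<in>{0..d}. proj d X' Y' i)"
    and inj': "inj_on \<theta>' {0..d}"
    by (rule idempotents_for_permuted[OF e inj E]) blast
  have "\<theta>' \<in> extensional {0..d}" using E unfolding idempotents_for_def eigenvalue_ordering_def by blast
  then have "(THE \<theta>. idempotents_for d A \<theta> E) = \<theta>'"
    using E unfolding E' by (intro the_equality idempotents_for_unique[OF e' inj'])
  then have "\<theta>' = \<theta>" using s by simp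
  then have "E \<in> extensional {0..d}" "\<And>i. i \<in> {0..d} \<Longrightarrow> E i = proj d X Y i"
    using E primitive_idempotent_eigdec[OF e inj] unfolding idempotents_for_def by auto
  then show ?thesis by (intro extensionalityI[where A = "{0..d}"]) auto
qed

locale split_pair =
  fixes d :: nat and \<theta> \<theta>s f g :: "nat \<Rightarrow> 'a::field"
  assumes inj: "inj_on \<theta> {0..d}" "inj_on \<theta>s {0..d}"
    and ext: "\<theta> \<in> extensional {0..d}" "\<theta>s \<in> extensional {0..d}"
    and nz: "\<And>i. i \<in> {1..d} \<Longrightarrow> f i \<noteq> 0"
    and aw: "d > 0 \<Longrightarrow> \<exists>\<beta> \<gamma> \<gamma>s \<omega>. aw_pair d \<beta> \<gamma> \<gamma>s \<omega> \<theta> \<theta>s f g"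
begin

lemma primal:
  obtains X Y G H where "eigdec d (low d \<theta>) \<theta> X Y" "tri d (\<lambda>i j. (Y * upp d \<theta>s f * X) $$ (i, j))"
    "G \<in> sq d" "H \<in> sq d" "G * H = 1\<^sub>m (Suc d)" "H * G = 1\<^sub>m (Suc d)"
    "low d \<theta> * G = G * low d (\<lambda>i. \<theta> (d - i))" "upp d \<theta>s f * G = G * upp d \<theta>s g"
proof (cases "d > 0")
  case True
  then obtain \<beta> \<gamma> \<gamma>s \<omega> where "aw_pair d \<beta> \<gamma> \<gamma>s \<omega> \<theta> \<theta>s f g" using aw by blast
  from aw_pair_tri[OF this True] that show ?thesis by blast
next
  case False
  then have d: "d = 0" by simp
  obtain X Y where e: "eigdec d (low d \<theta>) \<theta> X Y" using low_eigdec[OF inj(1)] by metis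
  have "upp d \<theta>s f = upp d \<theta>s g" "low d (\<lambda>i. \<theta> (d - i)) = low d \<theta>"
    by (rule sq_eqI[where d = d]; simp add: d upp_index low_index)+
  then have "low d \<theta> * 1\<^sub>m (Suc d) = 1\<^sub>m (Suc d) * low d (\<lambda>i. \<theta> (d - i))"
    "upp d \<theta>s f * 1\<^sub>m (Suc d) = 1\<^sub>m (Suc d) * upp d \<theta>s g"
    by (simp_all add: right_mult_one_mat[OF low_carrier] left_mult_one_mat[OF low_carrier]
      right_mult_one_mat[OF upp_carrier] left_mult_one_mat[OF upp_carrier])
  from that[OF e _ _ _ _ _ this] show ?thesis by (simp add: tri_def d)
qed

lemma dual:
  obtains X Y where "eigdec d (upp d \<theta>s f) \<theta>s X Y" "tri d (\<lambda>i j. (Y * low d \<theta> * X) $$ (i, j))"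
proof -
  \<comment> \<open>The scalar data are self-dual, so the tridiagonal shape for \<theta>s comes from
    the primal statement for the swapped data and is then transported by transposition.\<close>
  interpret dual: split_pair d \<theta>s \<theta> f "\<lambda>i. g (Suc d - i)"
    using inj ext nz aw aw_pair_dual by unfold_locales blast+
  obtain X0 Y0 where e0: "eigdec d (low d \<theta>s) \<theta>s X0 Y0" "tri d (\<lambda>i j. (Y0 * upp d \<theta> f * X0) $$ (i, j))"
    by (rule dual.primal)
  obtain X Y where e: "eigdec d (upp d \<theta>s f) \<theta>s X Y"
    and t: "\<And>\<theta> i j. i \<le> d \<Longrightarrow> j \<le> d \<Longrightarrow> (Y * low d \<theta> * X) $$ (i, j) = (Y0 * upp d \<theta> f * X0) $$ (j, i)"
    using low_transpose_eigdec[where f = f, OF e0(1) nz] by blast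
  have "tri d (\<lambda>i j. (Y * low d \<theta> * X) $$ (i, j))"
    using e0(2) unfolding tri_def by (auto simp: t simp del: index_mult_mat assoc_mult_mat)
  with e show ?thesis by (rule that)
qed

lemma leonard:
  obtains \<Phi> where "leonard_system d \<Phi>" "ls_A \<Phi> = low d \<theta>" "ls_As \<Phi> = upp d \<theta>s f"
    "eigenvalue_seq d \<Phi> = \<theta>" "dual_eigenvalue_seq d \<Phi> = \<theta>s"
    "first_split_seq d \<Phi> = (\<lambda>i\<in>{1..d}. f i)" "second_split_seq d \<Phi> = (\<lambda>i\<in>{1..d}. g i)"
    "\<And>\<Psi>. leonard_system d \<Psi> \<Longrightarrow> ls_A \<Psi> = low d \<theta> \<Longrightarrow> ls_As \<Psi> = upp d \<theta>s f \<Longrightarrow>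
       eigenvalue_seq d \<Psi> = \<theta> \<Longrightarrow> dual_eigenvalue_seq d \<Psi> = \<theta>s \<Longrightarrow> \<Psi> = \<Phi>"
proof -
  obtain X Y G H where e: "eigdec d (low d \<theta>) \<theta> X Y" and t: "tri d (\<lambda>i j. (Y * upp d \<theta>s f * X) $$ (i, j))"
    and G: "G \<in> sq d" "H \<in> sq d" "G * H = 1\<^sub>m (Suc d)" "H * G = 1\<^sub>m (Suc d)"
    "low d \<theta> * G = G * low d (\<lambda>i. \<theta> (d - i))" "upp d \<theta>s f * G = G * upp d \<theta>s g"
    by (rule primal)
  obtain X2 Y2 where e2: "eigdec d (upp d \<theta>s f) \<theta>s X2 Y2" and t2: "tri d (\<lambda>i j. (Y2 * low d \<theta> * X2) $$ (i, j))"
    by (rule dual)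
  define \<Phi> where "\<Phi> = \<lparr>ls_A = low d \<theta>, ls_As = upp d \<theta>s f,
    ls_E = (\<lambda>i\<in>{0..d}. proj d X Y i), ls_Es = (\<lambda>i\<in>{0..d}. proj d X2 Y2 i)\<rparr>"
  have \<Phi>: "ls_A \<Phi> = low d \<theta>" "ls_As \<Phi> = upp d \<theta>s f" "ls_E \<Phi> = (\<lambda>i\<in>{0..d}. proj d X Y i)"
    "ls_Es \<Phi> = (\<lambda>i\<in>{0..d}. proj d X2 Y2 i)" by (simp_all add: \<Phi>_def)
  have L: "leonard_system d \<Phi>"
    unfolding leonard_system_def \<Phi>
    using multiplicity_free_eigdec[OF e inj(1)] multiplicity_free_eigdec[OF e2 inj(2)] t t2
    by (simp add: idempotent_sequence_eigdec[OF e inj(1) ext(1) upp_carrier]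
      idempotent_sequence_eigdec[OF e2 inj(2) ext(2) low_carrier])
  have ev: "eigenvalue_seq d \<Phi> = \<theta>" by (rule eigenvalue_seq_eigdec(1)[OF e inj(1) ext(1) \<Phi>(1,3)])
  have evs: "dual_eigenvalue_seq d \<Phi> = \<theta>s" by (rule eigenvalue_seq_eigdec(2)[OF e2 inj(2) ext(2) \<Phi>(2,4)])
  \<comment> \<open>The pair is already in split form, so the identity serves as change of basis for
    the first split sequence; \<open>G\<close> takes its place for the second.\<close>
  have one: "1\<^sub>m (Suc d) \<in> sq d" "1\<^sub>m (Suc d) * 1\<^sub>m (Suc d) = (1\<^sub>m (Suc d) :: 'a mat)"
    "low d \<theta> * 1\<^sub>m (Suc d) = 1\<^sub>m (Suc d) * low d \<theta>" "upp d \<theta>s f * 1\<^sub>m (Suc d) = 1\<^sub>m (Suc d) * upp d \<theta>s f"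
    by (simp_all add: right_mult_one_mat[OF low_carrier] left_mult_one_mat[OF low_carrier]
      right_mult_one_mat[OF upp_carrier] left_mult_one_mat[OF upp_carrier])
  have fs: "first_split_seq d \<Phi> = (\<lambda>i\<in>{1..d}. f i)"
    by (rule first_split_seq_eq[OF e e2 inj one(1,1,2,2,3,4) \<Phi>]) (simp_all add: ev evs)
  let ?r = "\<lambda>i. \<theta> (d - i)"
  let ?D = "leonard_Down d \<Phi>"
  define Xr where "Xr = mat (Suc d) (Suc d) (\<lambda>(i, j). X $$ (i, d - j))"
  define Yr where "Yr = mat (Suc d) (Suc d) (\<lambda>(i, j). Y $$ (d - i, j))"
  have rev: "bij_betw (\<lambda>i. d - i) {0..d} {0..d}"
    by (rule bij_betwI[where g = "\<lambda>i. d - i"]) auto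
  \<comment> \<open>An eigenvalue sequence must be extensional, whereas the intertwining relation is
    stated with the unrestricted reversal; hence two versions over the same eigenvectors.\<close>
  have er: "eigdec d (low d \<theta>) (restrict ?r {0..d}) Xr Yr"
    by (rule eigdec_permute(1)[OF e rev _ Xr_def Yr_def]) simp
  have er': "eigdec d (low d \<theta>) ?r Xr Yr"
    by (rule eigdec_permute(1)[OF e rev _ Xr_def Yr_def]) simp
  note injr = inj_on_reverse[OF inj(1)]
  then have injr': "inj_on (restrict ?r {0..d}) {0..d}" by (simp add: inj_on_restrict_eq)
  have c: "X \<in> sq d" "Y \<in> sq d" "Xr \<in> sq d" "Yr \<in> sq d" using eigdecD(2,3)[OF e] eigdecD(2,3)[OF er] by auto
  have "proj d X Y (d - i) = proj d Xr Yr i" if "i \<le> d" for i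
    using c that by (intro sq_eqI[where d = d]) (simp_all add: proj_index, simp add: Xr_def Yr_def)
  then have D: "ls_A ?D = low d \<theta>" "ls_As ?D = upp d \<theta>s f" "ls_E ?D = (\<lambda>i\<in>{0..d}. proj d Xr Yr i)"
    "ls_Es ?D = (\<lambda>i\<in>{0..d}. proj d X2 Y2 i)"
    by (auto simp: leonard_Down_def \<Phi> fun_eq_iff)
  have evr: "eigenvalue_seq d ?D = restrict ?r {0..d}"
    by (rule eigenvalue_seq_eigdec(1)[OF er injr' _ D(1,3)]) simp
  have evsr: "dual_eigenvalue_seq d ?D = \<theta>s" by (rule eigenvalue_seq_eigdec(2)[OF e2 inj(2) ext(2) D(2,4)])
  have ss: "second_split_seq d \<Phi> = (\<lambda>i\<in>{1..d}. g i)"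
    unfolding second_split_seq_def
    by (rule first_split_seq_eq[OF er' e2 injr inj(2) G D]) (simp_all add: evr evsr)
  have "\<Psi> = \<Phi>" if a: "leonard_system d \<Psi>" "ls_A \<Psi> = low d \<theta>" "ls_As \<Psi> = upp d \<theta>s f"
    "eigenvalue_seq d \<Psi> = \<theta>" "dual_eigenvalue_seq d \<Psi> = \<theta>s" for \<Psi>
  proof -
    obtain t1 t2 where "idempotents_for d (ls_A \<Psi>) t1 (ls_E \<Psi>)" "idempotents_for d (ls_As \<Psi>) t2 (ls_Es \<Psi>)"
      using a(1) unfolding leonard_system_def idempotent_sequence_def by blast
    note this[unfolded a(2,3)]
    then have "ls_E \<Psi> = ls_E \<Phi>" "ls_Es \<Psi> = ls_Es \<Phi>"
      unfolding \<Phi>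
      using idempotents_determined[OF e inj(1) _ a(4)[unfolded eigenvalue_seq_def a(2)]]
        idempotents_determined[OF e2 inj(2) _ a(5)[unfolded dual_eigenvalue_seq_def a(3)]] by blast+
    then show ?thesis using a(2,3) \<Phi>(1,2) by (intro leonard_data.equality) simp_all
  qed
  from that[OF L \<Phi>(1,2) ev evs fs ss this] show ?thesis .
qed

end

section \<open>Parameter arrays\<close>

lemma sum_reverse_ratio:
  fixes \<theta> :: "nat \<Rightarrow> 'a::field"
  assumes "i \<le> d"
  shows "(\<Sum>h<i. (\<theta> (d - h) - \<theta> (d - (d - h))) / (\<theta> (d - 0) - \<theta> (d - d)))
    = (\<Sum>h<i. (\<theta> h - \<theta> (d - h)) / (\<theta> 0 - \<theta> d))"
proof (rule sum.cong[OF refl])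
  fix h assume "h \<in> {..<i}"
  then have "d - (d - h) = h" using assms by auto
  then show "(\<theta> (d - h) - \<theta> (d - (d - h))) / (\<theta> (d - 0) - \<theta> (d - d)) = (\<theta> h - \<theta> (d - h)) / (\<theta> 0 - \<theta> d)"
    using minus_divide_divide[of "\<theta> h - \<theta> (d - h)" "\<theta> 0 - \<theta> d"] by simp
qed

text \<open>Extended by zero, the split sequences agree with the split formula on the whole range
  from 0 to \<open>Suc d\<close>, so the boundary conditions and the scalar equations can be read
  off from that formula.\<close>

lemma parameter_array_split_pair:
  assumes p: "parameter_array d p"
    and f: "\<And>i. f i = (if i \<in> {1..d} then pa_vphi p i else 0)"
    and g: "\<And>i. g i = (if i \<in> {1..d} then pa_phi p i else 0)"
  shows "split_pair d (pa_theta p) (pa_thetas p) f g"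
proof -
  define \<theta> where "\<theta> = pa_theta p"
  define \<theta>s where "\<theta>s = pa_thetas p"
  note P = p[unfolded parameter_array_def Let_def, folded \<theta>_def \<theta>s_def]
  have ext: "\<theta> \<in> extensional {0..d}" "\<theta>s \<in> extensional {0..d}"
    and nz0: "\<forall>i \<in> {1..d}. pa_vphi p i \<noteq> 0 \<and> pa_phi p i \<noteq> 0"
    and ne: "\<forall>i \<in> {0..d}. \<forall>j \<in> {0..d}. i \<noteq> j \<longrightarrow> \<theta> i \<noteq> \<theta> j \<and> \<theta>s i \<noteq> \<theta>s j"
    and p3: "\<forall>i \<in> {1..d}. pa_vphi p i = pa_phi p 1 * (\<Sum>h = 0..i - 1. (\<theta> h - \<theta> (d - h)) / (\<theta> 0 - \<theta> d))
        + (\<theta>s i - \<theta>s 0) * (\<theta> (i - 1) - \<theta> d)"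
    and p4: "\<forall>i \<in> {1..d}. pa_phi p i = pa_vphi p 1 * (\<Sum>h = 0..i - 1. (\<theta> h - \<theta> (d - h)) / (\<theta> 0 - \<theta> d))
        + (\<theta>s i - \<theta>s 0) * (\<theta> (d - i + 1) - \<theta> 0)"
    and p5: "\<exists>c. \<forall>i \<in> {2..d - 1}. (\<theta> (i - 2) - \<theta> (i + 1)) / (\<theta> (i - 1) - \<theta> i) = c \<and>
          (\<theta>s (i - 2) - \<theta>s (i + 1)) / (\<theta>s (i - 1) - \<theta>s i) = c"
    using P by blast+
  have ne: "\<theta> i \<noteq> \<theta> j" "\<theta>s i \<noteq> \<theta>s j" if "i \<le> d" "j \<le> d" "i \<noteq> j" for i j
    using ne that by auto
  have inj: "inj_on \<theta> {0..d}" "inj_on \<theta>s {0..d}"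
  proof (safe intro!: inj_onI)
    fix i j assume ij: "i \<in> {0..d}" "j \<in> {0..d}"
    show "\<theta> i = \<theta> j \<Longrightarrow> i = j" by (rule ccontr) (use ij ne(1)[of i j] in simp)
    show "\<theta>s i = \<theta>s j \<Longrightarrow> i = j" by (rule ccontr) (use ij ne(2)[of i j] in simp)
  qed
  have nz: "f i \<noteq> 0" "g i \<noteq> 0" if "i \<in> {1..d}" for i using nz0 that by (auto simp: f g)
  have "\<exists>\<beta> \<gamma> \<gamma>s \<omega>. aw_pair d \<beta> \<gamma> \<gamma>s \<omega> \<theta> \<theta>s f g" if d: "d > 0"
  proof -
    let ?r = "\<lambda>i. \<theta> (d - i)"
    have ne0: "\<theta> 0 \<noteq> \<theta> d" using ne d by simp
    then have ne0': "?r 0 \<noteq> ?r d" by simp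
    obtain c where c: "\<forall>i\<in>{2..d - 1}. (\<theta> (i - 2) - \<theta> (i + 1)) / (\<theta> (i - 1) - \<theta> i) = c \<and>
          (\<theta>s (i - 2) - \<theta>s (i + 1)) / (\<theta>s (i - 1) - \<theta>s i) = c"
      using p5 by blast
    \<comment> \<open>The ratio condition says that the three-term expression with
      \<open>\<beta> = c - 1\<close> has equal values at consecutive indices; \<gamma> is its value
      at 0.\<close>
    have three: "three_term d (c - 1) (t 0 - (c - 1) * t 1 + t 2) t"
      if ct: "\<forall>i\<in>{2..d - 1}. (t (i - 2) - t (i + 1)) / (t (i - 1) - t i) = c"
        and nt: "\<And>i. i < d \<Longrightarrow> t i \<noteq> t (Suc i)" for t
      unfolding three_term_def
    proof (intro allI impI)
      fix i assume "i + 2 \<le> d"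
      then show "t i - (c - 1) * t (i + 1) + t (i + 2) = t 0 - (c - 1) * t 1 + t 2"
      proof (induction i)
        case (Suc i)
        then have i: "Suc (Suc i) \<in> {2..d - 1}" by auto
        have "t (Suc i) - t (Suc (Suc i)) \<noteq> 0" using nt[of "Suc i"] Suc.prems by simp
        moreover have "(t i - t (Suc (Suc (Suc i)))) / (t (Suc i) - t (Suc (Suc i))) = c"
          using bspec[OF ct i] by simp
        ultimately have "t i - t (Suc (Suc (Suc i))) = c * (t (Suc i) - t (Suc (Suc i)))"
          by (simp add: divide_eq_eq)
        then have t3: "t (Suc (Suc (Suc i))) = t i - c * (t (Suc i) - t (Suc (Suc i)))"
          by (simp add: algebra_simps)
        have "t (Suc i) - (c - 1) * t (Suc i + 1) + t (Suc i + 2) = t i - (c - 1) * t (i + 1) + t (i + 2)"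
          by (simp add: t3) (simp add: algebra_simps)
        then show ?case using Suc by simp
      qed (simp add: numeral_2_eq_2)
    qed
    obtain \<beta> \<gamma> \<gamma>s where t: "three_term d \<beta> \<gamma> \<theta>" and ts: "three_term d \<beta> \<gamma>s \<theta>s"
      using three[of \<theta>] three[of \<theta>s] c ne by auto
    note tr = three_term_reverse[OF t]
    have F: "f i = split_formula d \<theta> \<theta>s (g 1) i" if i: "i \<le> Suc d" for i
    proof -
      consider "i = 0" | "i \<in> {1..d}" | "i = Suc d" using i by force
      then show ?thesis
      proof cases
        case 2
        then have "{0..i - 1} = {..<i}" by auto
        have "f i = pa_vphi p i" "g 1 = pa_phi p 1" using 2 d by (simp_all add: f g)
        then show ?thesis unfolding split_formula_def \<open>{0..i - 1} = {..<i}\<close>[symmetric] using bspec[OF p3 2] by simp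
      qed (simp_all add: f split_formula_0[OF t ne0] split_formula_Suc_d[OF t ne0])
    qed
    have Gf: "g i = split_formula d ?r \<theta>s (f 1) i" if i: "i \<le> Suc d" for i
    proof -
      consider "i = 0" | "i \<in> {1..d}" | "i = Suc d" using i by force
      then show ?thesis
      proof cases
        case 2
        then have e: "{0..i - 1} = {..<i}" "d - (i - 1) = d - i + 1" by auto
        have s: "(\<Sum>h<i. (\<theta> (d - h) - \<theta> (d - (d - h))) / (\<theta> (d - 0) - \<theta> (d - d)))
          = (\<Sum>h<i. (\<theta> h - \<theta> (d - h)) / (\<theta> 0 - \<theta> d))"
          by (rule sum_reverse_ratio) (use 2 in simp)
        have "pa_phi p i = pa_vphi p 1 * (\<Sum>h<i. (\<theta> h - \<theta> (d - h)) / (\<theta> 0 - \<theta> d))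
          + (\<theta>s i - \<theta>s 0) * (\<theta> (d - i + 1) - \<theta> 0)"
          using bspec[OF p4 2] unfolding e(1) .
        moreover have "g i = pa_phi p i" "f 1 = pa_vphi p 1" using 2 d by (simp_all add: f g)
        ultimately show ?thesis unfolding split_formula_def s e(2) by simp
      qed (simp_all add: g split_formula_0[OF tr ne0'] split_formula_Suc_d[OF tr ne0'])
    qed
    have a: "f 1 = g 1 + (\<theta>s 1 - \<theta>s 0) * (\<theta> 0 - \<theta> d)"
      using F[of 1] split_formula_1[OF t ne0, of \<theta>s "g 1"] by simp
    \<comment> \<open>The partial sum at \<open>d\<close> is 1, so the formula for the last term of
      \<open>g\<close> is the second boundary relation.\<close>
    have "g d = f 1 + (\<theta>s d - \<theta>s 0) * (\<theta> (d - (d - 1)) - \<theta> 0)"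
      using Gf[of d] vth_d[OF tr ne0'] by (simp add: split_formula_vth[OF tr ne0'])
    then have b: "f 1 = g d + (\<theta> 1 - \<theta> 0) * (\<theta>s 0 - \<theta>s d)" using d by (simp add: algebra_simps)
    define \<omega> where "\<omega> = aw_sub \<beta> \<gamma> \<gamma>s \<theta> \<theta>s (split_formula d \<theta> \<theta>s (g 1)) 0"
    have "aw_sub \<beta> \<gamma> \<gamma>s \<theta> \<theta>s f i = \<omega>" if i: "i < d" for i
    proof -
      have "aw_sub \<beta> \<gamma> \<gamma>s \<theta> \<theta>s f i = aw_sub \<beta> \<gamma> \<gamma>s \<theta> \<theta>s (split_formula d \<theta> \<theta>s (g 1)) i"
        using i unfolding aw_sub_def by (simp add: F)
      then show ?thesis using aw_sub_split_formula[OF t ne0 ts i] by (simp add: \<omega>_def)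
    qed
    moreover have "aw_sub \<beta> \<gamma> \<gamma>s ?r \<theta>s g i = \<omega>" if i: "i < d" for i
    proof -
      have "aw_sub \<beta> \<gamma> \<gamma>s ?r \<theta>s g i = aw_sub \<beta> \<gamma> \<gamma>s ?r \<theta>s (split_formula d ?r \<theta>s (f 1)) i"
        using i unfolding aw_sub_def by (simp add: Gf)
      also have "\<dots> = aw_sub \<beta> \<gamma> \<gamma>s ?r \<theta>s (split_formula d ?r \<theta>s (f 1)) 0"
        by (rule aw_sub_split_formula[OF tr ne0' ts i])
      finally show ?thesis unfolding \<omega>_def aw_sub_split_formula_reverse[OF t ne0 d ts a] .
    qed
    ultimately have "aw_pair d \<beta> \<gamma> \<gamma>s \<omega> \<theta> \<theta>s f g"
      using inj t ts nz a b unfolding aw_pair_def by (simp add: f g)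
    then show ?thesis by blast
  qed
  then show ?thesis using inj nz ext unfolding \<theta>_def \<theta>s_def by unfold_locales auto
qed

section \<open>From the Leonard property back to a parameter array\<close>

text \<open>An injective walk with unit steps cannot turn round, since it would revisit the position
  two steps back.\<close>

lemma unit_steps_monotone:
  fixes \<sigma> :: "nat \<Rightarrow> nat"
  assumes inj: "inj_on \<sigma> {0..d}" and step: "\<And>a. a < d \<Longrightarrow> \<sigma> (Suc a) = Suc (\<sigma> a) \<or> \<sigma> a = Suc (\<sigma> (Suc a))"
  shows "n \<le> d \<Longrightarrow> (\<forall>a \<le> n. \<sigma> a = \<sigma> 0 + a) \<or> (\<forall>a \<le> n. \<sigma> a + a = \<sigma> 0)"
proof (induction n)
  case (Suc n)
  have s: "\<sigma> (Suc n) = Suc (\<sigma> n) \<or> \<sigma> n = Suc (\<sigma> (Suc n))" using step Suc.prems by simp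
  have ext: "\<forall>a \<le> Suc n. P a" if "\<forall>a \<le> n. P a" "P (Suc n)" for P
    using that by (simp add: le_Suc_eq)
  show ?case
  proof (cases n)
    case 0
    then show ?thesis using s by (auto simp: le_Suc_eq)
  next
    case (Suc m)
    then have nm: "\<sigma> (Suc n) \<noteq> \<sigma> m" using inj_onD[OF inj, of "Suc n" m] Suc.prems by auto
    have "m \<le> n" using Suc by simp
    from Suc.IH Suc.prems have "(\<forall>a \<le> n. \<sigma> a = \<sigma> 0 + a) \<or> (\<forall>a \<le> n. \<sigma> a + a = \<sigma> 0)" by simp
    then show ?thesis
    proof
      assume up: "\<forall>a \<le> n. \<sigma> a = \<sigma> 0 + a"
      have "\<sigma> n = \<sigma> 0 + n" "\<sigma> m = \<sigma> 0 + m" using spec[OF up, of n] spec[OF up, of m] \<open>m \<le> n\<close> by blast+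
      then have "\<sigma> (Suc n) = \<sigma> 0 + Suc n" using s nm Suc by linarith
      with up show ?thesis by (intro disjI1 ext)
    next
      assume down: "\<forall>a \<le> n. \<sigma> a + a = \<sigma> 0"
      have "\<sigma> n + n = \<sigma> 0" "\<sigma> m + m = \<sigma> 0" using spec[OF down, of n] spec[OF down, of m] \<open>m \<le> n\<close> by blast+
      then have "\<sigma> (Suc n) + Suc n = \<sigma> 0" using s nm Suc by linarith
      with down show ?thesis by (intro disjI2 ext)
    qed
  qed
qed simp

text \<open>Both \<open>B (\<sigma> a) (\<sigma> (a + 1))\<close> and \<open>B (\<sigma> (a + 1)) (\<sigma> a)\<close> are nonzero, so the Hessenberg shape of \<open>B\<close>
  forces \<open>\<sigma>\<close> to move by one in each step: it is the identity or the reversal.\<close>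

lemma tri_permuted:
  assumes b: "bij_betw \<sigma> {0..d} {0..d}" and t: "tri d (\<lambda>i j. B (\<sigma> i) (\<sigma> j))"
    and h: "\<And>i j. i \<le> d \<Longrightarrow> j \<le> d \<Longrightarrow> Suc i < j \<Longrightarrow> B i j = 0"
  shows "tri d B"
proof -
  have inj: "inj_on \<sigma> {0..d}" using b by (simp add: bij_betw_def)
  have s: "\<sigma> a \<le> d" if "a \<le> d" for a using bij_betwE[OF b] that by auto
  have "\<sigma> (Suc a) = Suc (\<sigma> a) \<or> \<sigma> a = Suc (\<sigma> (Suc a))" if a: "a < d" for a
  proof -
    have "B (\<sigma> a) (\<sigma> (Suc a)) \<noteq> 0" "B (\<sigma> (Suc a)) (\<sigma> a) \<noteq> 0"
      using t[unfolded tri_def, rule_format, of a "Suc a"] t[unfolded tri_def, rule_format, of "Suc a" a] a by auto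
    then have "\<not> Suc (\<sigma> a) < \<sigma> (Suc a)" "\<not> Suc (\<sigma> (Suc a)) < \<sigma> a"
      using h[of "\<sigma> a" "\<sigma> (Suc a)"] h[of "\<sigma> (Suc a)" "\<sigma> a"] s[of a] s[of "Suc a"] a by auto
    moreover have "\<sigma> (Suc a) \<noteq> \<sigma> a" using inj_onD[OF inj, of "Suc a" a] a by auto
    ultimately show ?thesis by linarith
  qed
  from unit_steps_monotone[OF inj this order_refl]
  have m: "(\<forall>a \<le> d. \<sigma> a = \<sigma> 0 + a) \<or> (\<forall>a \<le> d. \<sigma> a + a = \<sigma> 0)" .
  show ?thesis unfolding tri_def
  proof (intro allI impI)
    fix i j assume "i \<le> d" "j \<le> d"
    then have "i \<in> \<sigma> ` {0..d}" "j \<in> \<sigma> ` {0..d}" using b by (auto simp: bij_betw_def)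
    then obtain a a' where a: "a \<le> d" "a' \<le> d" "i = \<sigma> a" "j = \<sigma> a'" by auto
    have "i = \<sigma> 0 + a \<and> j = \<sigma> 0 + a' \<or> i + a = \<sigma> 0 \<and> j + a' = \<sigma> 0"
      using m
    proof
      assume "\<forall>a \<le> d. \<sigma> a = \<sigma> 0 + a"
      from spec[OF this, of a] spec[OF this, of a'] a show ?thesis by metis
    next
      assume "\<forall>a \<le> d. \<sigma> a + a = \<sigma> 0"
      from spec[OF this, of a] spec[OF this, of a'] a show ?thesis by simp
    qed
    then have "Suc i < j \<or> Suc j < i \<longleftrightarrow> Suc a < a' \<or> Suc a' < a"
      "j = Suc i \<or> i = Suc j \<longleftrightarrow> a' = Suc a \<or> a = Suc a'" by linarith+
    then show "(Suc i < j \<or> Suc j < i \<longrightarrow> B i j = 0) \<and> (j = Suc i \<or> i = Suc j \<longrightarrow> B i j \<noteq> 0)"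
      using t[unfolded tri_def, rule_format, OF a(1,2)] unfolding a(3,4) by simp
  qed
qed

text \<open>Conjugating by the eigenvectors turns the commutator identity
  \<open>\<Theta>\<^sup>2 B \<Theta> - \<Theta> B \<Theta>\<^sup>2 = Z B - B Z\<close>, which holds for a suitable diagonal \<open>Z\<close> because \<open>B\<close> is tridiagonal,
  into one for the bidiagonal pair, whose first column shows that \<open>Z\<close> is a cubic polynomial
  in \<open>\<Theta>\<close>.\<close>

lemma tri_cubic:
  fixes \<theta> \<theta>s f :: "nat \<Rightarrow> 'a::field"
  assumes e: "eigdec d (low d \<theta>) \<theta> X Y" and t: "tri d (\<lambda>i j. (Y * upp d \<theta>s f * X) $$ (i, j))"
    and inj: "inj_on \<theta> {0..d}" "inj_on \<theta>s {0..d}" and d: "3 \<le> d"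
    and z: "\<And>i. z (Suc i) = z i + \<theta> (Suc i) * \<theta> i * (\<theta> (Suc i) - \<theta> i)"
  obtains n0 n1 n2 n3 where "\<And>i. i \<le> d \<Longrightarrow> z i = n0 + (\<theta> i - \<theta> 0) * n1
      + (\<theta> i - \<theta> 1) * (\<theta> i - \<theta> 0) * n2 + (\<theta> i - \<theta> 2) * (\<theta> i - \<theta> 1) * (\<theta> i - \<theta> 0) * n3"
proof -
  note D = eigdecD[OF e] note mc = mult_cancel_left_inverse
  let ?L = "low d \<theta>" and ?U = "upp d \<theta>s f"
  define B where "B = Y * ?U * X"
  define Th where "Th = mat_diag (Suc d) \<theta>"
  define Zd where "Zd = mat_diag (Suc d) z"
  define Z where "Z = X * (Zd * Y)"
  have c: "B \<in> sq d" "Th \<in> sq d" "Zd \<in> sq d" "Z \<in> sq d" using D(2,3) by (simp_all add: B_def Th_def Zd_def Z_def)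
  \<comment> \<open>Next to the diagonal the left-hand side multiplies the entry by
    \<open>\<theta> i * \<theta> j * (\<theta> i - \<theta> j)\<close>, which is
    \<open>z i - z j\<close> by the choice of the increments of \<open>z\<close>; elsewhere both
    sides vanish.\<close>
  have eq: "Th * (Th * (B * Th)) - Th * (B * (Th * Th)) = Zd * B - B * Zd"
  proof (rule sq_eqI[where d = d])
    fix i j assume ij: "i \<le> d" "j \<le> d"
    have m: "(M - N) $$ (i, j) = M $$ (i, j) - N $$ (i, j)" if "N \<in> sq d" for M N :: "'a mat"
      using that ij by auto
    have c': "Th * B \<in> sq d" "B * Th \<in> sq d" "Th * (B * Th) \<in> sq d" "B * (Th * Th) \<in> sq d" "Th * Th \<in> sq d"
      using c by simp_all
    have TT: "Th * Th = mat_diag (Suc d) (\<lambda>i. \<theta> i * \<theta> i)" by (simp add: Th_def)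
    have L: "(Th * (Th * (B * Th)) - Th * (B * (Th * Th))) $$ (i, j)
      = \<theta> i * (\<theta> i * (B $$ (i, j) * \<theta> j)) - \<theta> i * (B $$ (i, j) * (\<theta> j * \<theta> j))"
      using c c' ij TT unfolding Th_def
      by (simp add: m diag_mult_index[where d = d] del: index_mult_mat assoc_mult_mat)
    have R: "(Zd * B - B * Zd) $$ (i, j) = (z i - z j) * B $$ (i, j)"
      using c ij unfolding Zd_def
      by (simp add: m diag_mult_index[where d = d] left_diff_distrib mult.commute del: index_mult_mat assoc_mult_mat)
    consider "i = j" | "i = Suc j" | "j = Suc i" | "B $$ (i, j) = 0"
      using t ij unfolding tri_def B_def[symmetric] by (metis not_less_eq linorder_neqE_nat less_antisym)
    then show "(Th * (Th * (B * Th)) - Th * (B * (Th * Th))) $$ (i, j) = (Zd * B - B * Zd) $$ (i, j)"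
      unfolding L R by cases (simp_all add: z algebra_simps)
  qed (use c in simp_all)
  have XT: "X * (Th * M) = ?L * (X * M)" if "M \<in> sq d" for M
    using assoc_sq[OF D(1,2) that] assoc_sq[OF D(2) c(2) that] D(6) by (simp add: Th_def)
  have XB: "X * (B * M) = ?U * (X * M)" if "M \<in> sq d" for M
  proof -
    have "X * (B * M) = (X * Y) * (?U * (X * M))"
      unfolding B_def using D(2,3) that by (simp add: assoc_sq[where d = d])
    then show ?thesis unfolding D(4) using D(2) that by (simp add: left_mult_one_mat[of _ "Suc d" "Suc d"])
  qed
  have TY: "Th * Y = Y * ?L" using D(7) by (simp add: Th_def)
  have XZ: "X * (Zd * M) = Z * (X * M)" if "M \<in> sq d" for M
    unfolding Z_def using D(2,3) c that by (simp add: assoc_sq[where d = d] mc[OF D(3,2,5)])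
  have one: "?L * (?L * (?U * ?L)) - ?L * (?U * (?L * ?L)) = Z * ?U - ?U * Z"
  proof -
    have "X * ((Th * (Th * (B * Th)) - Th * (B * (Th * Th))) * Y)
      = X * (Th * (Th * (B * (Th * Y)))) - X * (Th * (B * (Th * (Th * Y))))"
      using D(2,3) c by (simp add: assoc_sq[where d = d] minus_mult_distrib_mat[of _ "Suc d" "Suc d" _ _ "Suc d"]
        mult_minus_distrib_mat[of _ "Suc d" "Suc d" _ "Suc d"])
    also have "\<dots> = ?L * (?L * (?U * ?L)) - ?L * (?U * (?L * ?L))"
      using D(2,3) c by (simp add: XT XB TY mc[OF D(2,3,4)])
    finally have 1: "X * ((Th * (Th * (B * Th)) - Th * (B * (Th * Th))) * Y) = \<dots>" .
    have "X * ((Zd * B - B * Zd) * Y) = X * (Zd * (B * Y)) - X * (B * (Zd * Y))"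
      using D(2,3) c by (simp add: assoc_sq[where d = d] minus_mult_distrib_mat[of _ "Suc d" "Suc d" _ _ "Suc d"]
        mult_minus_distrib_mat[of _ "Suc d" "Suc d" _ "Suc d"])
    also have "\<dots> = Z * ?U - ?U * Z"
      using D(2,3,4) c by (simp add: XZ XB right_mult_one_mat[OF c(4)] right_mult_one_mat[OF upp_carrier])
    finally show ?thesis using 1 eq by simp
  qed
  \<comment> \<open>Each product on the left has three lower bidiagonal factors, so its first column
    ends at row 3.\<close>
  have col: "Z $$ (r, 0) * \<theta>s 0 - (\<theta>s r * Z $$ (r, 0) + (if r < d then f (Suc r) * Z $$ (Suc r, 0) else 0)) = 0"
    if r: "3 < r" "r \<le> d" for r
  proof -
    have m: "(M - N) $$ (r, 0) = M $$ (r, 0) - N $$ (r, 0)" if "N \<in> sq d" for M N :: "'a mat"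
      using that r by auto
    define k where "k = r - 4"
    have k: "r = Suc (Suc (Suc (Suc k)))" using r by (simp add: k_def)
    have c': "?U * ?L \<in> sq d" "?L * (?U * ?L) \<in> sq d" "?L * ?L \<in> sq d" "?U * (?L * ?L) \<in> sq d" by simp_all
    have l1: "(?L * (?L * (?U * ?L))) $$ (r, 0) = 0"
      using r(2) unfolding k by (simp add: low_mult c' mult_low upp_index del: index_mult_mat assoc_mult_mat)
    have l2: "(?L * (?U * (?L * ?L))) $$ (r, 0) = 0"
      using r(2) unfolding k by (simp add: low_mult c' upp_mult low_index del: index_mult_mat assoc_mult_mat)
    have "(Z * ?U - ?U * Z) $$ (r, 0) = (?L * (?L * (?U * ?L)) - ?L * (?U * (?L * ?L))) $$ (r, 0)"
      unfolding one ..
    then have "(Z * ?U - ?U * Z) $$ (r, 0) = 0"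
      using l1 l2 c' by (simp add: m del: index_mult_mat assoc_mult_mat)
    then show ?thesis using r c by (simp add: m mult_upp upp_mult del: index_mult_mat assoc_mult_mat)
  qed
  \<comment> \<open>Downward induction from \<open>d\<close>: the entry is multiplied by
    \<open>\<theta>s 0 - \<theta>s r\<close>, which is nonzero, and the neighbouring entry below is
    already zero.\<close>
  have n0: "Z $$ (r, 0) = 0" if r: "r \<le> d" "3 < r" for r
    using r
  proof (induction r rule: inc_induct)
    case base
    have "\<theta>s 0 \<noteq> \<theta>s d" using inj_onD[OF inj(2), of 0 d] d by auto
    then show ?case using col[of d] base by (auto simp: algebra_simps)
  next
    case (step r)
    have "\<theta>s 0 \<noteq> \<theta>s r" using inj_onD[OF inj(2), of 0 r] step by auto
    then show ?case using col[of r] step by (auto simp: algebra_simps)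
  qed
  have "z i = Z $$ (0, 0) + (\<theta> i - \<theta> 0) * Z $$ (1, 0) + (\<theta> i - \<theta> 1) * (\<theta> i - \<theta> 0) * Z $$ (2, 0)
     + (\<theta> i - \<theta> 2) * (\<theta> i - \<theta> 1) * (\<theta> i - \<theta> 0) * Z $$ (3, 0)" if i: "i \<le> d" for i
  proof -
    \<comment> \<open>A left eigenvector with first entry zero would be zero. Dividing by this entry
      leaves Newton polynomials of degree at most 3.\<close>
    have Y0: "Y $$ (i, 0) \<noteq> 0"
    proof
      assume 0: "Y $$ (i, 0) = 0"
      have "Y $$ (i, k) = 0" if "k \<le> d" for k using that
        by (induction k) (simp_all add: 0 eigdec_low_row[OF e i])
      then show False using eigdec_low_triangular(3)[OF e inj(1) i] i by simp
    qed
    have Y123: "Y $$ (i, 1) = (\<theta> i - \<theta> 0) * Y $$ (i, 0)"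
      "Y $$ (i, 2) = (\<theta> i - \<theta> 1) * Y $$ (i, 1)" "Y $$ (i, 3) = (\<theta> i - \<theta> 2) * Y $$ (i, 2)"
      using eigdec_low_row[OF e i, of 0] eigdec_low_row[OF e i, of 1] eigdec_low_row[OF e i, of 2] d
      by (simp_all add: numeral_2_eq_2 numeral_3_eq_3)
    have "Y * Z = Zd * Y" unfolding Z_def by (rule mc[OF D(3,2,5)]) (use D(3) c in simp)
    then have "z i * Y $$ (i, 0) = (Y * Z) $$ (i, 0)"
      using diag_mult_index(1)[OF D(3) i, of 0 z] by (simp add: Zd_def)
    also have "\<dots> = (\<Sum>r\<le>d. Y $$ (i, r) * Z $$ (r, 0))" by (rule mult_index[OF D(3) c(4) i]) simp
    also have "\<dots> = (\<Sum>r\<le>3. Y $$ (i, r) * Z $$ (r, 0))"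
      using d n0 by (intro sum.mono_neutral_right) auto
    also have "\<dots> = Y $$ (i, 0) * Z $$ (0, 0) + Y $$ (i, 1) * Z $$ (1, 0) + Y $$ (i, 2) * Z $$ (2, 0)
       + Y $$ (i, 3) * Z $$ (3, 0)"
      by (simp add: eval_nat_numeral)
    also have "\<dots> = (Z $$ (0, 0) + (\<theta> i - \<theta> 0) * Z $$ (1, 0) + (\<theta> i - \<theta> 1) * (\<theta> i - \<theta> 0) * Z $$ (2, 0)
     + (\<theta> i - \<theta> 2) * (\<theta> i - \<theta> 1) * (\<theta> i - \<theta> 0) * Z $$ (3, 0)) * Y $$ (i, 0)"
      unfolding Y123 by (simp add: algebra_simps)
    finally show ?thesis using Y0 by simp
  qed
  then show ?thesis by (rule that)
qed

text \<open>Dividing the increments of the cubic by those of \<theta> gives a symmetric quadratic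
  relation between neighbours. Subtracting two consecutive instances and dividing once more leaves a
  linear relation among three neighbours.\<close>

lemma tri_three_term:
  fixes \<theta> \<theta>s f :: "nat \<Rightarrow> 'a::field"
  assumes e: "eigdec d (low d \<theta>) \<theta> X Y" and t: "tri d (\<lambda>i j. (Y * upp d \<theta>s f * X) $$ (i, j))"
    and inj: "inj_on \<theta> {0..d}" "inj_on \<theta>s {0..d}"
  obtains \<beta> \<gamma> where "three_term d \<beta> \<gamma> \<theta>"
proof (cases "3 \<le> d")
  case False
  have "three_term d 0 (\<theta> 0 + \<theta> 2) \<theta>"
    unfolding three_term_def
  proof (intro allI impI)
    fix i assume "i + 2 \<le> d"
    then have "i = 0" using False by simp
    then show "\<theta> i - 0 * \<theta> (i + 1) + \<theta> (i + 2) = \<theta> 0 + \<theta> 2" by (simp add: numeral_2_eq_2)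
  qed
  then show ?thesis by (rule that)
next
  case True
  define z where "z i = (\<Sum>h<i. \<theta> (Suc h) * \<theta> h * (\<theta> (Suc h) - \<theta> h))" for i
  have zS: "z (Suc i) = z i + \<theta> (Suc i) * \<theta> i * (\<theta> (Suc i) - \<theta> i)" for i by (simp add: z_def)
  obtain n0 n1 n2 n3 where n: "\<And>i. i \<le> d \<Longrightarrow> z i = n0 + (\<theta> i - \<theta> 0) * n1
      + (\<theta> i - \<theta> 1) * (\<theta> i - \<theta> 0) * n2 + (\<theta> i - \<theta> 2) * (\<theta> i - \<theta> 1) * (\<theta> i - \<theta> 0) * n3"
    using tri_cubic[OF e t inj True zS] by blast
  have ne: "\<theta> i \<noteq> \<theta> j" if "i \<le> d" "j \<le> d" "i \<noteq> j" for i j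
    using inj_onD[OF inj(1), of i j] that by auto
  define s where "s = \<theta> 0 + \<theta> 1 + \<theta> 2"
  define Q where "Q x y = n1 + n2 * (x + y - \<theta> 0 - \<theta> 1) + n3 * (x * x + x * y + y * y - s * (x + y)
      + \<theta> 0 * \<theta> 1 + \<theta> 0 * \<theta> 2 + \<theta> 1 * \<theta> 2)" for x y
  have Q: "\<theta> (Suc i) * \<theta> i = Q (\<theta> (Suc i)) (\<theta> i)" if i: "i < d" for i
  proof -
    have "(\<theta> (Suc i) - \<theta> i) * (\<theta> (Suc i) * \<theta> i) = z (Suc i) - z i" by (simp add: zS)
    also have "\<dots> = (\<theta> (Suc i) - \<theta> i) * Q (\<theta> (Suc i)) (\<theta> i)"
      using i by (simp add: n Q_def s_def) (simp add: algebra_simps)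
    finally show ?thesis using ne[of "Suc i" i] i by simp
  qed
  have mid: "\<theta> (Suc i) = n2 + n3 * (\<theta> i + \<theta> (Suc i) + \<theta> (Suc (Suc i)) - s)" if i: "i + 2 \<le> d" for i
  proof -
    have "(\<theta> i - \<theta> (Suc (Suc i))) * \<theta> (Suc i) = Q (\<theta> (Suc i)) (\<theta> i) - Q (\<theta> (Suc (Suc i))) (\<theta> (Suc i))"
      using Q[of i] Q[of "Suc i"] i by (simp add: algebra_simps)
    also have "\<dots> = (\<theta> i - \<theta> (Suc (Suc i))) * (n2 + n3 * (\<theta> i + \<theta> (Suc i) + \<theta> (Suc (Suc i)) - s))"
      by (simp add: Q_def) (simp add: algebra_simps)
    finally show ?thesis using ne[of i "Suc (Suc i)"] i by simp
  qed
  \<comment> \<open>Otherwise the linear relation would give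
    \<open>\<theta> 1 = n2 = \<theta> 2\<close>.\<close>
  have n3: "n3 \<noteq> 0"
  proof
    assume "n3 = 0"
    then show False using mid[of 0] mid[of 1] ne[of 1 2] True by (simp add: numeral_2_eq_2)
  qed
  have "three_term d (1 / n3 - 1) (s - n2 / n3) \<theta>"
    unfolding three_term_def
  proof (intro allI impI)
    fix i assume i: "i + 2 \<le> d"
    have "\<theta> (Suc i) / n3 = n2 / n3 + (\<theta> i + \<theta> (Suc i) + \<theta> (Suc (Suc i)) - s)"
      using arg_cong[OF mid[OF i], of "\<lambda>x. x / n3"] n3 by (simp add: add_divide_distrib)
    then show "\<theta> i - (1 / n3 - 1) * \<theta> (i + 1) + \<theta> (i + 2) = s - n2 / n3"
      by (simp add: algebra_simps)
  qed
  then show ?thesis by (rule that)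
qed

text \<open>In the eigenbasis the expression is diagonal, so it commutes with
  \<open>low d \<theta>\<close>. A matrix commuting with \<open>low d \<theta>\<close> is fixed by
  its first column, and here that column has at most three nonzero entries, which a quadratic
  polynomial can match.\<close>

lemma tri_askey_wilson:
  fixes \<theta> \<theta>s f :: "nat \<Rightarrow> 'a::field"
  assumes e: "eigdec d (low d \<theta>) \<theta> X Y" and t: "tri d (\<lambda>i j. (Y * upp d \<theta>s f * X) $$ (i, j))"
    and r: "\<And>i. i < d \<Longrightarrow> aw_root \<beta> \<gamma> \<rho> (\<theta> i) (\<theta> (Suc i)) = 0" and d: "d > 0"
  obtains \<gamma>s \<omega> \<eta> where "aw2 \<beta> \<gamma> \<rho> (low d \<theta>) (low d \<theta>) (upp d \<theta>s f) = poly2 d \<gamma>s \<omega> \<eta> (low d \<theta>)"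
proof -
  note D = eigdecD[OF e] note mc = mult_cancel_left_inverse
  let ?L = "low d \<theta>" and ?U = "upp d \<theta>s f" and ?Th = "mat_diag (Suc d) \<theta>"
  let ?W = "aw2 \<beta> \<gamma> \<rho> ?L ?L ?U"
  define B where "B = Y * ?U * X"
  have cB: "B \<in> sq d" using D(2,3) by (simp add: B_def)
  define N where "N = aw2 \<beta> \<gamma> \<rho> ?Th ?Th B"
  have cN: "N \<in> sq d" and cW: "?W \<in> sq d" using cB by (simp_all add: N_def)
  have "N = aw2 \<beta> \<gamma> \<rho> ?Th ?L (Y * ?U) * X"
    unfolding N_def B_def by (rule aw2_mult_right[where d = d]) (use D(2,3,6) in simp_all)
  also have "aw2 \<beta> \<gamma> \<rho> ?Th ?L (Y * ?U) = Y * ?W"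
    by (rule aw2_mult_left[where d = d]) (use D(3,7) in simp_all)
  finally have NW: "N = Y * ?W * X" .
  have Nij: "N $$ (i, j) = 0" if ij: "i \<le> d" "j \<le> d" "i \<noteq> j" for i j
  proof -
    consider "i = Suc j" | "j = Suc i" | "B $$ (i, j) = 0"
      using t ij unfolding tri_def B_def[symmetric] by (metis not_less_eq linorder_neqE_nat less_antisym)
    then show ?thesis unfolding N_def aw2_diag[OF cB ij(1,2)]
      using r[of i] r[of j] ij by cases (auto simp: aw_root_commute[of \<beta> \<gamma> \<rho> "\<theta> (Suc j)"])
  qed
  have "?Th * N = N * ?Th"
  proof (rule sq_eqI[where d = d])
    fix i j assume "i \<le> d" "j \<le> d"
    then show "(?Th * N) $$ (i, j) = (N * ?Th) $$ (i, j)"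
      using Nij[of i j] by (cases "i = j") (simp_all add: diag_mult_index[OF cN] del: index_mult_mat)
  qed (use cN in simp_all)
  then have "X * (?Th * N) * Y = X * (N * ?Th) * Y" by simp
  moreover have "X * (?Th * N) * Y = ?L * ?W"
  proof -
    have "X * (?Th * N) * Y = (X * ?Th) * (N * Y)" using D(2,3) cN by (simp add: assoc_sq[where d = d])
    also have "\<dots> = ?L * (X * (N * Y))" unfolding D(6)[symmetric] using D(2,3) cN by (simp add: assoc_sq[where d = d])
    also have "X * (N * Y) = ?W" unfolding NW
      using D(2-5) cW by (simp add: assoc_sq[where d = d] mc[OF D(2,3,4)] right_mult_one_mat[OF cW])
    finally show ?thesis .
  qed
  moreover have "X * (N * ?Th) * Y = ?W * ?L"
  proof -
    have "X * (N * ?Th) * Y = X * (N * (?Th * Y))" using D(2,3) cN by (simp add: assoc_sq[where d = d])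
    also have "\<dots> = X * (N * Y) * ?L" unfolding D(7)[symmetric] using D(2,3) cN by (simp add: assoc_sq[where d = d])
    also have "X * (N * Y) = ?W" unfolding NW
      using D(2-5) cW by (simp add: assoc_sq[where d = d] mc[OF D(2,3,4)] right_mult_one_mat[OF cW])
    finally show ?thesis .
  qed
  ultimately have LW: "?L * ?W = ?W * ?L" by simp
  \<comment> \<open>The powers of \<open>?L\<close> applied to the first basis vector have leading
    coefficient 1 in rows 0, 1, 2, so the coefficients are solved from the bottom row upwards. For
    \<open>d = 1\<close> row 2 does not exist and 0 is taken.\<close>
  define \<gamma>s where "\<gamma>s = (if 2 \<le> d then ?W $$ (2, 0) else 0)"
  define \<omega> where "\<omega> = ?W $$ (1, 0) - \<gamma>s * (\<theta> 1 + \<theta> 0)"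
  define \<eta> where "\<eta> = ?W $$ (0, 0) - \<gamma>s * \<theta> 0 ^ 2 - \<omega> * \<theta> 0"
  let ?P = "poly2 d \<gamma>s \<omega> \<eta> ?L"
  have cP: "?P \<in> sq d" by simp
  have LP: "?L * ?P = ?P * ?L" by (rule poly2_intertwine[symmetric, where d = d]) simp_all
  have m: "(?W - ?P) $$ (i, j) = ?W $$ (i, j) - ?P $$ (i, j)" if "i \<le> d" "j \<le> d" for i j
    using that carrier_matD[OF cP] by simp
  have "?W - ?P = 0\<^sub>m (Suc d) (Suc d)"
  proof (rule low_intertwine_zero[where L = ?L and \<theta>' = \<theta>])
    show "?L * (?W - ?P) = (?W - ?P) * ?L"
      unfolding mult_minus_distrib_mat[OF low_carrier cW cP] minus_mult_distrib_mat[OF cW cP low_carrier] LW LP ..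
    fix i assume i: "i \<le> d"
    have w: "?W $$ (0, 0) = \<gamma>s * \<theta> 0 ^ 2 + \<omega> * \<theta> 0 + \<eta>" "?W $$ (Suc 0, 0) = \<gamma>s * (\<theta> (Suc 0) + \<theta> 0) + \<omega>"
      "Suc (Suc 0) \<le> d \<Longrightarrow> ?W $$ (Suc (Suc 0), 0) = \<gamma>s"
      by (simp_all add: \<eta>_def \<omega>_def \<gamma>s_def numeral_2_eq_2)
    consider "i = 0" | "i = Suc 0" | "i = Suc (Suc 0)" | "Suc (Suc 0) < i" by linarith
    then have "?W $$ (i, 0) = ?P $$ (i, 0)"
    proof cases
      case 4
      then show ?thesis using i W_other[of i d 0 \<beta> \<gamma> \<rho> \<theta> \<theta>s f]
        by (simp add: poly2_index low_low_index low_index del: index_mult_mat)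
    qed (use i d in \<open>simp_all add: poly2_index low_low_index low_index w del: index_mult_mat\<close>)
    then show "(?W - ?P) $$ (i, 0) = 0" using m[OF i, of 0] by simp
  qed (use cW in simp_all)
  note z = this
  have "?W $$ (i, j) = ?P $$ (i, j)" if ij: "i \<le> d" "j \<le> d" for i j
    using m[OF ij] ij unfolding z by simp
  then have "?W = ?P" by (rule sq_eqI[OF cW cP])
  then show ?thesis by (rule that)
qed

text \<open>Conjugation by the unit upper triangular \<open>G\<close> keeps the matrix upper
  triangular with diagonal \<theta>s. In the reversed eigenbasis it is still tridiagonal, and the
  eigenvector matrices there are lower triangular, so only one superdiagonal remains: it is the
  candidate \<open>g\<close>.\<close>

lemma tri_reversed_pair:
  fixes \<theta> \<theta>s f :: "nat \<Rightarrow> 'a::field"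
  assumes e: "eigdec d (low d \<theta>) \<theta> X Y" and t: "tri d (\<lambda>i j. (Y * upp d \<theta>s f * X) $$ (i, j))"
    and inj: "inj_on \<theta> {0..d}" and y: "\<And>i. i \<le> d \<Longrightarrow> Y $$ (i, 0) \<noteq> 0"
  obtains G H g where "G \<in> sq d" "H \<in> sq d" "G * H = 1\<^sub>m (Suc d)" "H * G = 1\<^sub>m (Suc d)"
    "low d \<theta> * G = G * low d (\<lambda>i. \<theta> (d - i))" "\<And>i. i \<le> d \<Longrightarrow> G $$ (i, 0) = (if i = 0 then 1 else 0)"
    "upp d \<theta>s f * G = G * upp d \<theta>s g" "\<And>i. i \<in> {1..d} \<Longrightarrow> g i \<noteq> 0" "g 0 = 0" "g (Suc d) = 0"
proof -
  let ?L = "low d \<theta>" and ?L' = "low d (\<lambda>i. \<theta> (d - i))" and ?U = "upp d \<theta>s f"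
  note inj' = inj_on_reverse[OF inj]
  obtain X' Y' where e': "eigdec d ?L' (\<lambda>i. \<theta> (d - i)) X' Y'"
    and y': "\<And>i. i \<le> d \<Longrightarrow> Y' $$ (i, 0) \<noteq> 0"
    using low_eigdec[OF inj'] by metis
  obtain G H where G: "G \<in> sq d" "H \<in> sq d" "G * H = 1\<^sub>m (Suc d)" "H * G = 1\<^sub>m (Suc d)"
    "?L * G = G * ?L'" "\<And>i. i \<le> d \<Longrightarrow> G $$ (i, 0) = (if i = 0 then 1 else 0)"
    "\<And>U U' i j. U \<in> sq d \<Longrightarrow> U' \<in> sq d \<Longrightarrow> U * G = G * U' \<Longrightarrow> i \<le> d \<Longrightarrow> j \<le> d \<Longrightarrow>
       (Y * U * X) $$ (i, j) = 0 \<longleftrightarrow> (Y' * U' * X') $$ (d - i, d - j) = 0"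
    using eigdec_intertwiner[OF e e' y y'] by blast
  note mc = mult_cancel_left_inverse
  note D' = eigdecD[OF e']
  define U' where "U' = H * (?U * G)"
  have c: "U' \<in> sq d" using G by (simp add: U'_def)
  have UG: "?U * G = G * U'" unfolding U'_def by (rule mc[symmetric, OF G(1,2,3)]) (use G in simp)
  have HL: "?L' * H = H * ?L"
  proof -
    have "?L' * H = H * ((G * ?L') * H)" using G by (simp add: assoc_sq[where d = d] mc[OF G(2,1,4)])
    also have "\<dots> = H * ?L" unfolding G(5)[symmetric] using G(1-4) by (simp add: assoc_sq[where d = d] right_mult_one_mat[OF low_carrier])
    finally show ?thesis .
  qed
  have H0: "H $$ (i, 0) = (if i = 0 then 1 else 0)" if i: "i \<le> d" for i
  proof -
    have "(H * G) $$ (i, 0) = (\<Sum>k\<le>d. if k = 0 then H $$ (i, 0) else 0)"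
      unfolding mult_index[OF G(2,1) i le0] by (rule sum.cong) (auto simp: G(6))
    then show ?thesis unfolding G(4) using i by simp
  qed
  have tG: "G $$ (i, j) = (if i = j then 1 else 0)" and tH: "H $$ (i, j) = (if i = j then 1 else 0)"
    if "i \<le> d" "j \<le> i" for i j
    using low_intertwine_triangular[OF G(1,5) G(6) that] low_intertwine_triangular[OF G(2) HL H0 that] by simp_all
  have low: "U' $$ (i, j) = (if i = j then \<theta>s i else 0)" if ij: "i \<le> d" "j \<le> i" for i j
  proof -
    have j: "j \<le> d" using ij by simp
    have UGk: "(?U * G) $$ (k, j) = (if k = j then \<theta>s j else 0)" if "k \<le> d" "j \<le> k" for k
      using that tG[of k j] tG[of "Suc k" j]
      unfolding upp_mult[OF G(1) that(1) j] by (cases "k < d") auto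
    have "U' $$ (i, j) = (\<Sum>k\<le>d. H $$ (i, k) * (?U * G) $$ (k, j))"
      unfolding U'_def by (rule mult_index) (use G ij j in simp_all)
    also have "\<dots> = (\<Sum>k\<le>d. if k = i then (if i = j then \<theta>s i else 0) else 0)"
    proof (rule sum.cong[OF refl])
      fix k assume "k \<in> {..d}"
      then have k: "k \<le> d" by simp
      show "H $$ (i, k) * (?U * G) $$ (k, j) = (if k = i then if i = j then \<theta>s i else 0 else 0)"
      proof (cases "k < i")
        case True
        then show ?thesis using tH[OF ij(1), of k] by simp
      next
        case False
        then show ?thesis using UGk[OF k] tH[OF ij(1), of k] ij by (auto simp del: index_mult_mat)
      qed
    qed
    finally show ?thesis using ij by simp
  qed
  define B' where "B' = Y' * U' * X'"
  have cB: "B' \<in> sq d" using c D'(2,3) by (simp add: B'_def)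
  have B': "B' $$ (i, j) = 0 \<longleftrightarrow> (Y * ?U * X) $$ (d - i, d - j) = 0" if "i \<le> d" "j \<le> d" for i j
    unfolding B'_def using G(7)[OF upp_carrier c UG, of "d - i" "d - j"] that by simp
  have "band d 1 B'" unfolding band_def
  proof (intro allI impI)
    fix i j assume ij: "i \<le> d" "j \<le> d" "i + 1 < j"
    then have "Suc (d - j) < d - i" by simp
    then show "B' $$ (i, j) = 0" unfolding B'[OF ij(1,2)] using t by (simp add: tri_def)
  qed
  note T = eigdec_low_triangular[OF e' inj']
  have "U' = X' * B' * Y'"
    unfolding B'_def using c D'(2-4) by (simp add: assoc_sq[where d = d] mc[OF D'(2,3,4)] right_mult_one_mat[OF c])
  then have up: "band d 1 U'"
    using band_mult(1)[OF sq_mult[OF D'(2) cB] D'(3) band_mult(1)[OF D'(2) cB T(1) \<open>band d 1 B'\<close>] T(2)] by simp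
  define g where "g i = (if i \<in> {1..d} then U' $$ (i - 1, i) else 0)" for i
  have U': "U' = upp d \<theta>s g"
  proof (rule sq_eqI[OF c upp_carrier])
    fix i j assume ij: "i \<le> d" "j \<le> d"
    consider "j \<le> i" | "j = Suc i" | "i + 1 < j" by linarith
    then show "U' $$ (i, j) = upp d \<theta>s g $$ (i, j)"
      using ij low up by cases (auto simp: upp_index g_def band_def)
  qed
  have "g i \<noteq> 0" if "i \<in> {1..d}" for i
  proof -
    have i: "i - 1 < d" "Suc (i - 1) = i" "d - (i - 1) = Suc (d - i)" using that by auto
    have "(Y * ?U * X) $$ (Suc (d - i), d - i) \<noteq> 0"
      using t[unfolded tri_def, rule_format, of "Suc (d - i)" "d - i"] i(1) that
      by (simp add: Suc_le_eq diff_less)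
    then have "B' $$ (i - 1, i) \<noteq> 0" using B'[of "i - 1" i] that i(1) unfolding i(3) by simp
    then show ?thesis using low_upp_hessenberg(2)[OF e' inj' i(1), of \<theta>s g] unfolding i(2) B'_def U' by simp
  qed
  then show ?thesis using that[OF G(1-6) UG[unfolded U']] by (simp add: g_def)
qed

text \<open>The pair and its reversal satisfy the same Askey-Wilson relation. Each supplies the
  second equation for \<eta> that the other needs, so \<open>split_formula_unique\<close> applies in
  both directions and yields both split formulas.\<close>

lemma tri_parameter_array:
  fixes \<theta> \<theta>s f :: "nat \<Rightarrow> 'a::field"
  assumes e: "eigdec d (low d \<theta>) \<theta> X Y" and t: "tri d (\<lambda>i j. (Y * upp d \<theta>s f * X) $$ (i, j))"
    and inj: "inj_on \<theta> {0..d}" "inj_on \<theta>s {0..d}" and y: "\<And>i. i \<le> d \<Longrightarrow> Y $$ (i, 0) \<noteq> 0"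
    and ext: "\<theta> \<in> extensional {0..d}" "\<theta>s \<in> extensional {0..d}"
    and f: "f 0 = 0" "f (Suc d) = 0" and d: "d > 0"
  obtains g where "parameter_array d \<lparr>pa_theta = \<theta>, pa_thetas = \<theta>s, pa_vphi = (\<lambda>i\<in>{1..d}. f i), pa_phi = (\<lambda>i\<in>{1..d}. g i)\<rparr>"
proof -
  let ?L = "low d \<theta>" and ?r = "\<lambda>i. \<theta> (d - i)" and ?U = "upp d \<theta>s f"
  let ?L' = "low d ?r"
  note mc = mult_cancel_left_inverse
  have ne: "\<theta> i \<noteq> \<theta> j" "\<theta>s i \<noteq> \<theta>s j" if "i \<le> d" "j \<le> d" "i \<noteq> j" for i j
    using inj_onD[OF inj(1), of i j] inj_onD[OF inj(2), of i j] that by auto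
  have ne0: "\<theta> 0 \<noteq> \<theta> d" and ne0': "?r 0 \<noteq> ?r d" using ne(1)[of 0 d] d by auto
  obtain \<beta> \<gamma> where tt: "three_term d \<beta> \<gamma> \<theta>" by (rule tri_three_term[OF e t inj])
  note tr = three_term_reverse[OF tt]
  define \<rho> where "\<rho> = \<theta> 0 ^ 2 - \<beta> * \<theta> 0 * \<theta> 1 + \<theta> 1 ^ 2 - \<gamma> * (\<theta> 0 + \<theta> 1)"
  have r0: "aw_root \<beta> \<gamma> \<rho> (\<theta> 0) (\<theta> 1) = 0" by (simp add: \<rho>_def aw_root_def)
  have r: "aw_root \<beta> \<gamma> \<rho> (\<theta> i) (\<theta> (Suc i)) = 0" if "i < d" for i
    using aw_root_consecutive[OF tt r0 that] .
  have rr: "aw_root \<beta> \<gamma> \<rho> (?r 0) (?r 1) = 0"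
    using r[of "d - 1"] d by (simp add: aw_root_commute)
  obtain \<gamma>s \<omega> \<eta> where W: "aw2 \<beta> \<gamma> \<rho> ?L ?L ?U = poly2 d \<gamma>s \<omega> \<eta> ?L"
    by (rule tri_askey_wilson[OF e t r d])
  obtain G H g where G: "G \<in> sq d" "H \<in> sq d" "G * H = 1\<^sub>m (Suc d)" "H * G = 1\<^sub>m (Suc d)"
    "?L * G = G * ?L'" "\<And>i. i \<le> d \<Longrightarrow> G $$ (i, 0) = (if i = 0 then 1 else 0)"
    "?U * G = G * upp d \<theta>s g" and gnz: "\<And>i. i \<in> {1..d} \<Longrightarrow> g i \<noteq> 0" and g: "g 0 = 0" "g (Suc d) = 0"
    by (rule tri_reversed_pair[OF e t inj(1) y]) blast+
  have "G * aw2 \<beta> \<gamma> \<rho> ?L' ?L' (upp d \<theta>s g) = aw2 \<beta> \<gamma> \<rho> ?L ?L' (G * upp d \<theta>s g)"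
    by (rule aw2_mult_left[symmetric, where d = d]) (use G in simp_all)
  also have "\<dots> = aw2 \<beta> \<gamma> \<rho> ?L ?L ?U * G"
    unfolding G(7)[symmetric] by (rule aw2_mult_right[where d = d]) (use G in simp_all)
  also have "\<dots> = G * poly2 d \<gamma>s \<omega> \<eta> ?L'"
    unfolding W by (rule poly2_intertwine[OF low_carrier low_carrier G(1,5)])
  finally have "H * (G * aw2 \<beta> \<gamma> \<rho> ?L' ?L' (upp d \<theta>s g)) = H * (G * poly2 d \<gamma>s \<omega> \<eta> ?L')" by simp
  then have W': "aw2 \<beta> \<gamma> \<rho> ?L' ?L' (upp d \<theta>s g) = poly2 d \<gamma>s \<omega> \<eta> ?L'"
    using mc[OF G(2,1,4)] by simp
  note A = aw2_low_upp_D[OF f W] and A' = aw2_low_upp_D[OF g W']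
  note ts = A(1)
  have a: "f 1 = g 1 + (\<theta>s 1 - \<theta>s 0) * (\<theta> 0 - \<theta> d)"
  proof -
    have Gc1: "G $$ (i, Suc 0) = (if i = 0 then \<theta> 0 - \<theta> d else 1)" if "i \<le> 1" for i
      using low_intertwine_columns[OF G(1) low_carrier G(5) _ d, of i] low_mult[OF G(1), of i 0 \<theta>] that G(6) d
      by (auto simp: le_Suc_eq simp del: index_mult_mat)
    have "(?U * G) $$ (0, Suc 0) = (G * upp d \<theta>s g) $$ (0, Suc 0)" unfolding G(7) ..
    then show ?thesis using G(1) d by (simp add: upp_mult mult_upp Gc1 G(6) algebra_simps del: index_mult_mat)
  qed
  have F: "f i = split_formula d \<theta> \<theta>s (g 1) i" if "i \<le> d" for i
    by (rule split_formula_unique[OF tt ne0 d ts r0 f(1) g(1) A(2) A(3)[OF le0] _ a that])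
      (use A'(3)[OF le0] in simp_all)
  have Gf: "g i = split_formula d ?r \<theta>s (f 1) i" if "i \<le> d" for i
    by (rule split_formula_unique[where f = g and g = f, OF tr ne0' d ts rr g(1) f(1) A'(2) A'(3)[OF le0] _ _ that])
      (use A(3)[OF le0] a d in \<open>simp_all add: aw_diag_def algebra_simps\<close>)
  have fnz: "f i \<noteq> 0" if "i \<in> {1..d}" for i
  proof -
    have i: "i - 1 < d" "Suc (i - 1) = i" using that by auto
    have "(Y * ?U * X) $$ (i - 1, i) \<noteq> 0"
      using t[unfolded tri_def, rule_format, of "i - 1" i] i(2) that by simp
    then show ?thesis using low_upp_hessenberg(2)[OF e inj(1) i(1), of \<theta>s f] unfolding i(2) by simp
  qed
  have iv: "{0..i - 1} = {..<i}" if "i \<in> {1..d}" for i using that by auto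
  let ?F = "\<lambda>i. g 1 * (\<Sum>h = 0..i - 1. (\<theta> h - \<theta> (d - h)) / (\<theta> 0 - \<theta> d))
        + (\<theta>s i - \<theta>s 0) * (\<theta> (i - 1) - \<theta> d)"
  let ?G = "\<lambda>i. f 1 * (\<Sum>h = 0..i - 1. (\<theta> h - \<theta> (d - h)) / (\<theta> 0 - \<theta> d))
        + (\<theta>s i - \<theta>s 0) * (\<theta> (d - i + 1) - \<theta> 0)"
  have p3: "\<forall>i \<in> {1..d}. f i = ?F i"
  proof
    fix i assume i: "i \<in> {1..d}"
    then show "f i = ?F i"
      unfolding iv[OF i] using F[of i] by (simp add: split_formula_def)
  qed
  have p4: "\<forall>i \<in> {1..d}. g i = ?G i"
  proof
    fix i assume i: "i \<in> {1..d}"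
    have s: "(\<Sum>h<i. (\<theta> (d - h) - \<theta> (d - (d - h))) / (\<theta> (d - 0) - \<theta> (d - d)))
      = (\<Sum>h<i. (\<theta> h - \<theta> (d - h)) / (\<theta> 0 - \<theta> d))"
      by (rule sum_reverse_ratio) (use i in simp)
    have "d - (i - 1) = d - i + 1" using i by auto
    then show "g i = ?G i"
      unfolding iv[OF i] using Gf[of i] i unfolding split_formula_def s by simp
  qed
  have ratio: "(t (i - 2) - t (i + 1)) / (t (i - 1) - t i) = \<beta> + 1"
    if tt: "three_term d \<beta> c t" and nt: "\<And>i j. i \<le> d \<Longrightarrow> j \<le> d \<Longrightarrow> i \<noteq> j \<Longrightarrow> t i \<noteq> t j" and i: "i \<in> {2..d - 1}" for t c i
  proof -
    define k where "k = i - 2"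
    have k: "i = Suc (Suc k)" "k + 2 \<le> d" "Suc k + 2 \<le> d" using i by (auto simp: k_def)
    have "t (Suc k) - t (Suc (Suc k)) \<noteq> 0" using nt[of "Suc k" "Suc (Suc k)"] k by simp
    moreover have "t k - t (Suc (Suc (Suc k))) = (\<beta> + 1) * (t (Suc k) - t (Suc (Suc k)))"
      unfolding three_termD[OF tt k(3)] unfolding three_termD[OF tt k(2)] by (simp add: algebra_simps)
    ultimately show ?thesis unfolding k(1) by (simp add: divide_eq_eq)
  qed
  have p5: "\<exists>c. \<forall>i \<in> {2..d - 1}. (\<theta> (i - 2) - \<theta> (i + 1)) / (\<theta> (i - 1) - \<theta> i) = c \<and>
          (\<theta>s (i - 2) - \<theta>s (i + 1)) / (\<theta>s (i - 1) - \<theta>s i) = c"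
    using ratio[OF tt ne(1)] ratio[OF ts ne(2)] by blast
  have one: "1 \<in> {1..d}" using d by simp
  have "parameter_array d \<lparr>pa_theta = \<theta>, pa_thetas = \<theta>s, pa_vphi = (\<lambda>i\<in>{1..d}. f i), pa_phi = (\<lambda>i\<in>{1..d}. g i)\<rparr>"
    unfolding parameter_array_def Let_def parameter_data.simps restrict_apply'[OF one]
  proof (intro conjI)
    show "\<forall>i\<in>{1..d}. (\<lambda>i\<in>{1..d}. f i) i \<noteq> 0 \<and> (\<lambda>i\<in>{1..d}. g i) i \<noteq> 0" using fnz gnz by simp
    show "\<forall>i\<in>{0..d}. \<forall>j\<in>{0..d}. i \<noteq> j \<longrightarrow> \<theta> i \<noteq> \<theta> j \<and> \<theta>s i \<noteq> \<theta>s j" using ne by simp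
    show "\<forall>i\<in>{1..d}. (\<lambda>i\<in>{1..d}. f i) i = ?F i"
      by (rule ballI) (simp only: restrict_apply' bspec[OF p3])
    show "\<forall>i\<in>{1..d}. (\<lambda>i\<in>{1..d}. g i) i = ?G i"
      by (rule ballI) (simp only: restrict_apply' bspec[OF p4])
    show "\<exists>c. \<forall>i\<in>{2..d - 1}. (\<theta> (i - 2) - \<theta> (i + 1)) / (\<theta> (i - 1) - \<theta> i) = c \<and>
            (\<theta>s (i - 2) - \<theta>s (i + 1)) / (\<theta>s (i - 1) - \<theta>s i) = c" by (rule p5)
  qed (use ext in simp_all)
  then show ?thesis by (rule that)
qed

section \<open>Canonical forms\<close>

lemma bidiagonal_forms:
  fixes A As :: "'a::field mat"
  assumes "A \<in> sq d" "As \<in> sq d" "lower_bidiagonal A" "upper_bidiagonal As"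
    and "\<And>i. i \<in> {1..d} \<Longrightarrow> A $$ (i, i - 1) = 1"
    and "\<And>i. i \<le> d \<Longrightarrow> A $$ (i, i) = \<theta> i" "\<And>i. i \<le> d \<Longrightarrow> As $$ (i, i) = \<theta>s i"
    and "\<And>i. i \<in> {1..d} \<Longrightarrow> As $$ (i - 1, i) = f i"
  shows "A = low d \<theta>" "As = upp d \<theta>s f"
proof -
  have A: "A $$ (i, j) = 0" if "i \<le> d" "j \<le> d" "i \<noteq> j" "i \<noteq> Suc j" for i j
    using assms(3)[unfolded lower_bidiagonal_def, rule_format, of i j] assms(1) that by auto
  have As: "As $$ (i, j) = 0" if "i \<le> d" "j \<le> d" "i \<noteq> j" "j \<noteq> Suc i" for i j
    using assms(4)[unfolded upper_bidiagonal_def lower_bidiagonal_def, rule_format, of j i] assms(2) that by auto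
  show "A = low d \<theta>"
  proof (rule sq_eqI[OF assms(1) low_carrier])
    fix i j assume "i \<le> d" "j \<le> d"
    then show "A $$ (i, j) = low d \<theta> $$ (i, j)"
      using A[of i j] assms(5)[of i] assms(6)[of i] by (auto simp: low_index)
  qed
  show "As = upp d \<theta>s f"
  proof (rule sq_eqI[OF assms(2) upp_carrier])
    fix i j assume "i \<le> d" "j \<le> d"
    then show "As $$ (i, j) = upp d \<theta>s f $$ (i, j)"
      using As[of i j] assms(7)[of i] assms(8)[of j] by (auto simp: upp_index)
  qed
qed

lemma eigenvalues_low: "{k. eigenvalue (low d \<theta>) k} = \<theta> ` {0..d}"
proof -
  have "{k. eigenvalue (low d \<theta>) k} = {k. eigenvalue ((low d \<theta>)\<^sup>T) k}"
    by (simp add: eigenvalue_root_char_poly[where n = "Suc d"] char_poly_transpose_mat[where n = "Suc d"])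
  also have "\<dots> = (\<lambda>i. (low d \<theta>)\<^sup>T $$ (i, i)) ` {0..d}"
    by (rule eigenvalues_upper_triangular) (auto simp: low_def)
  also have "\<dots> = \<theta> ` {0..d}" by (intro image_cong) (auto simp: low_def)
  finally show ?thesis .
qed

lemma eigenvalues_upp: "{k. eigenvalue (upp d \<theta>s f) k} = \<theta>s ` {0..d}"
proof -
  have "{k. eigenvalue (upp d \<theta>s f) k} = (\<lambda>i. upp d \<theta>s f $$ (i, i)) ` {0..d}"
    by (rule eigenvalues_upper_triangular) (auto simp: upp_def)
  also have "\<dots> = \<theta>s ` {0..d}" by (intro image_cong) (auto simp: upp_def)
  finally show ?thesis .
qed

text \<open>The \<open>d + 1\<close> distinct eigenvalues are the values of \<theta> on
  \<open>d + 1\<close> indices. For bidiagonal matrices this makes the diagonal entries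
  distinct.\<close>

lemma multiplicity_free_inj:
  assumes "multiplicity_free d A" "{k. eigenvalue A k} = \<theta> ` {0..d}"
  shows "inj_on \<theta> {0..d}"
  using assms by (intro eq_card_imp_inj_on) (simp_all add: multiplicity_free_def)

lemma leonard_pair_parameter_array:
  fixes A As :: "'a::field mat"
  assumes "leonard_pair d A As" "LB_UB_canonical_form d A As"
  shows "\<exists>p. parameter_array d p \<and> LB_UB_entries d A As p"
proof -
  define \<theta> where "\<theta> = (\<lambda>i\<in>{0..d}. A $$ (i, i))"
  define \<theta>s where "\<theta>s = (\<lambda>i\<in>{0..d}. As $$ (i, i))"
  define f where "f i = (if i \<in> {1..d} then As $$ (i - 1, i) else 0)" for i
  have c: "A \<in> sq d" "As \<in> sq d" and one: "\<And>i. i \<in> {1..d} \<Longrightarrow> A $$ (i, i - 1) = 1"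
    using assms(2) unfolding LB_UB_canonical_form_def by auto
  have ext: "\<theta> \<in> extensional {0..d}" "\<theta>s \<in> extensional {0..d}" by (simp_all add: \<theta>_def \<theta>s_def)
  have bi: "lower_bidiagonal A" "upper_bidiagonal As" using assms(2) unfolding LB_UB_canonical_form_def by auto
  have eq: "A = low d \<theta>" "As = upp d \<theta>s f"
    by (rule bidiagonal_forms[OF c bi one]; simp add: \<theta>_def \<theta>s_def f_def)+
  have mf: "multiplicity_free d A" "multiplicity_free d As" using assms(1) by (simp_all add: leonard_pair_def)
  have inj: "inj_on \<theta> {0..d}" "inj_on \<theta>s {0..d}"
    using multiplicity_free_inj[OF mf(1)] multiplicity_free_inj[OF mf(2)] unfolding eq
    by (simp_all add: eigenvalues_low eigenvalues_upp)
  have ent: "LB_UB_entries d A As \<lparr>pa_theta = \<theta>, pa_thetas = \<theta>s, pa_vphi = (\<lambda>i\<in>{1..d}. f i), pa_phi = h\<rparr>" for h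
    unfolding LB_UB_entries_def using one by (auto simp: \<theta>_def \<theta>s_def f_def)
  show ?thesis
  proof (cases "d = 0")
    case True
    have "parameter_array d \<lparr>pa_theta = \<theta>, pa_thetas = \<theta>s, pa_vphi = (\<lambda>i\<in>{1..d}. f i), pa_phi = (\<lambda>i\<in>{1..d}. f i)\<rparr>"
      using ext True by (simp add: parameter_array_def restrict_def)
    with ent show ?thesis by blast
  next
    case False
    obtain X Y where e: "eigdec d (low d \<theta>) \<theta> X Y" and y: "\<And>i. i \<le> d \<Longrightarrow> Y $$ (i, 0) \<noteq> 0"
      using low_eigdec[OF inj(1)] by metis
    obtain E where E: "idempotent_sequence d (low d \<theta>) (upp d \<theta>s f) E"
      using assms(1) unfolding leonard_pair_def eq by blast
    \<comment> \<open>The given idempotents may be ordered differently from the diagonal of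
      \<open>A\<close>; the Hessenberg shape then removes the permutation.\<close>
    obtain \<sigma> where "bij_betw \<sigma> {0..d} {0..d}" "tri d (\<lambda>i j. (Y * upp d \<theta>s f * X) $$ (\<sigma> i, \<sigma> j))"
      by (rule idempotent_sequence_permuted[OF e inj(1) upp_carrier E])
    then have t: "tri d (\<lambda>i j. (Y * upp d \<theta>s f * X) $$ (i, j))"
      by (rule tri_permuted) (rule low_upp_hessenberg(1)[OF e inj(1)])
    have f: "f 0 = 0" "f (Suc d) = 0" by (simp_all add: f_def)
    obtain g where "parameter_array d \<lparr>pa_theta = \<theta>, pa_thetas = \<theta>s, pa_vphi = (\<lambda>i\<in>{1..d}. f i), pa_phi = (\<lambda>i\<in>{1..d}. g i)\<rparr>"
      using tri_parameter_array[OF e t inj y ext f] False by blast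
    with ent show ?thesis by blast
  qed
qed

text \<open>The Leonard system built from the array has the diagonals of the two matrices as its
  eigenvalue sequences, so it is the designated one, and its split sequences are those of the array.
  As this holds for every such array, the array is unique.\<close>

lemma parameter_array_leonard:
  fixes A As :: "'a::field mat"
  assumes c: "A \<in> sq d" "As \<in> sq d" and bi: "lower_bidiagonal A" "upper_bidiagonal As"
    and p: "parameter_array d p" and ent: "LB_UB_entries d A As p"
  shows "leonard_pair d A As \<and> LB_UB_canonical_form d A As \<and> p = designated_parameter_array d A As"
proof -
  define f where "f i = (if i \<in> {1..d} then pa_vphi p i else 0)" for i
  define g where "g i = (if i \<in> {1..d} then pa_phi p i else 0)" for i
  interpret split_pair d "pa_theta p" "pa_thetas p" f g
    by (rule parameter_array_split_pair[OF p f_def g_def])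
  have eq: "A = low d (pa_theta p)" "As = upp d (pa_thetas p) f"
    by (rule bidiagonal_forms[OF c bi]; use ent in \<open>simp add: LB_UB_entries_def f_def\<close>)+
  obtain \<Phi> where \<Phi>: "leonard_system d \<Phi>" "ls_A \<Phi> = A" "ls_As \<Phi> = As"
    "eigenvalue_seq d \<Phi> = pa_theta p" "dual_eigenvalue_seq d \<Phi> = pa_thetas p"
    "first_split_seq d \<Phi> = (\<lambda>i\<in>{1..d}. f i)" "second_split_seq d \<Phi> = (\<lambda>i\<in>{1..d}. g i)"
    and unique: "\<And>\<Psi>. leonard_system d \<Psi> \<Longrightarrow> ls_A \<Psi> = A \<Longrightarrow> ls_As \<Psi> = As \<Longrightarrow>
       eigenvalue_seq d \<Psi> = pa_theta p \<Longrightarrow> dual_eigenvalue_seq d \<Psi> = pa_thetas p \<Longrightarrow> \<Psi> = \<Phi>"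
    by (rule leonard[folded eq], rule that; assumption)
  have ext: "pa_theta p \<in> extensional {0..d}" "pa_thetas p \<in> extensional {0..d}"
    "pa_vphi p \<in> extensional {1..d}" "pa_phi p \<in> extensional {1..d}"
    using p unfolding parameter_array_def Let_def by blast+
  have diag: "(\<lambda>i\<in>{0..d}. A $$ (i, i)) = pa_theta p" "(\<lambda>i\<in>{0..d}. As $$ (i, i)) = pa_thetas p"
    by (rule extensionalityI[OF restrict_extensional]; use ext ent in \<open>simp add: LB_UB_entries_def\<close>)+
  have "designated_leonard_system d A As = \<Phi>"
    unfolding designated_leonard_system_def associated_def diag
  proof (rule the_equality)
    show "\<Psi> = \<Phi>" if "leonard_system d \<Psi> \<and> (ls_A \<Psi> = A \<and> ls_As \<Psi> = As) \<and>
      eigenvalue_seq d \<Psi> = pa_theta p \<and> dual_eigenvalue_seq d \<Psi> = pa_thetas p" for \<Psi>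
      by (rule unique) (use that in simp_all)
  qed (simp add: \<Phi>)
  moreover have "(\<lambda>i\<in>{1..d}. f i) = pa_vphi p" "(\<lambda>i\<in>{1..d}. g i) = pa_phi p"
    by (rule extensionalityI[OF restrict_extensional]; use ext in \<open>simp add: f_def g_def\<close>)+
  ultimately have "p = designated_parameter_array d A As"
    unfolding designated_parameter_array_def parameter_array_of_def
    by (intro parameter_data.equality) (simp_all add: \<Phi>)
  moreover have "leonard_pair d A As"
    using \<Phi>(1) unfolding leonard_system_def leonard_pair_def \<Phi>(2,3) by blast
  moreover have "LB_UB_canonical_form d A As"
    using c bi ent by (simp add: LB_UB_canonical_form_def LB_UB_entries_def)
  ultimately show ?thesis by blast
qed

theorem theorem16p1:
  fixes d :: nat and A As :: "'a::field mat"
  assumes "A \<in> carrier_mat (d + 1) (d + 1)" and "As \<in> carrier_mat (d + 1) (d + 1)"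
    and "lower_bidiagonal A" and "upper_bidiagonal As"
  shows "((leonard_pair d A As \<and> LB_UB_canonical_form d A As) \<longleftrightarrow>
            (\<exists>p. parameter_array d p \<and> LB_UB_entries d A As p)) \<and>
         ((leonard_pair d A As \<and> LB_UB_canonical_form d A As) \<and>
            (\<exists>p. parameter_array d p \<and> LB_UB_entries d A As p) \<longrightarrow>
            (\<exists>!p. parameter_array d p \<and> LB_UB_entries d A As p) \<and>
            (\<forall>p. parameter_array d p \<and> LB_UB_entries d A As p \<longrightarrow>
               p = designated_parameter_array d A As))"
proof -
  have "A \<in> sq d" "As \<in> sq d" using assms(1,2) by simp_all
  note conv = parameter_array_leonard[OF this assms(3,4)]
  show ?thesis using leonard_pair_parameter_array[of d A As] conv by blast
qed

end
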